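(* Consider the $L_\infty$ approximation problem ${\rm APP}=\{{\rm APP}_{\infty,d}\}_{d\in\mathbb N}$, ${\rm APP}_{\infty,d}:H(K_{d,\mathbf a,\mathbf b})\to L_\infty([0,1]^d)$, $f\mapsto f$, in the worst case setting, where $\omega\in(0,1)$ and $0<a_1\le a_2\le\cdots$, $\inf_i b_i>0$. The following hold for $\Lambda^{\rm std}$ and for $\Lambda^{\rm all}$, under ABS or NOR. 1. EXP-UWT holds iff $\lim_{j\to\infty}\frac{\ln a_j}{\ln j}=\infty$. 2. EXP-$(s,t)$-WT with $s>0$, $t>1$ always holds. 3. EXP-$(s,t)$-WT with $0<s<1$ and $0<t\le1$ holds iff $\lim_{j\to\infty}\frac{a_j}{j^{(1-s)/s}}=\infty$. 4. EXP-$(1,t)$-WT with $t<1$ holds iff $\lim_{j\to\infty}\frac{a_j}{\ln j}=\infty$. 5. EXP-$(s,t)$-WT with $s>1$ and $t<1$ holds iff $\lim_{j\to\infty}j^{1-t}a_j\omega^{a_j}=0$.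
   Context: $H(K_{d,\mathbf a,\mathbf b})$ is the reproducing kernel Hilbert space of complex-valued 1-periodic continuous functions on $[0,1]^d$ with kernel $K_{d,\mathbf a,\mathbf b}(\mathbf x,\mathbf y)=\sum_{\mathbf h\in\mathbb Z^d}\omega_{\mathbf h}e^{2\pi i\mathbf h\cdot(\mathbf x-\mathbf y)}$, $\omega_{\mathbf h}=\omega^{\sum_{k=1}^d a_k|h_k|^{b_k}}$, and norm $\|f\|^2=\sum_{\mathbf h}\omega_{\mathbf h}^{-1}|\hat f(\mathbf h)|^2$, $\hat f(\mathbf h)=\int_{[0,1]^d}f(\mathbf x)e^{-2\pi i\mathbf h\cdot\mathbf x}d\mathbf x$. $L_\infty$ carries the sup norm. $\Lambda^{\rm all}$: all continuous linear functionals; $\Lambda^{\rm std}$: point evaluations. $e(n,{\rm APP}_{\infty,d};\Lambda)$: infimum over algorithms $A(f)=\phi(L_1f,\dots,L_nf)$, $L_i\in\Lambda$, $\phi$ arbitrary, of $\sup_{\|f\|\le1}\|f-A(f)\|_\infty$; $e(0,{\rm APP}_{\infty,d})=\sup_{\|f\|\le1}\|f\|_\infty$. $n^\star(\varepsilon,d;\Lambda)=\inf\{n\ge0:e(n,{\rm APP}_{\infty,d};\Lambda)\le\varepsilon{\rm CRI}_d\}$ with ${\rm CRI}_d=1$ (ABS) or $e(0,{\rm APP}_{\infty,d})$ (NOR). With $n=n^\star(\varepsilon,d;\Lambda)$, $d\in\mathbb N$, $\varepsilon\in(0,1)$, limits as $\varepsilon^{-1}+d\to\infty$: EXP-UWT: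 $\ln n/((1+\ln\varepsilon^{-1})^\alpha+d^\beta)\to0$ for all $\alpha,\beta>0$; EXP-$(s,t)$-WT: $\ln n/((1+\ln\varepsilon^{-1})^s+d^t)\to0$.
   Formalization: In items 4 and 5 the parameter t is taken with 0 < t < 1 instead of only t < 1, because for t ≤ 0 the notion fails for fixed small ε as d → ∞ even when the stated limit condition holds (e.g. a_j = j). *)

theory Defs
  imports "HOL-Analysis.Analysis"
begin

text \<open>Coordinates and frequencies are indexed by 1..d. A point of [0,1]^d is an
 extensional function nat => real supported on {1..d}; a frequency vector is an
 integer-valued function vanishing outside {1..d}.\<close>

definition freqs :: "nat \<Rightarrow> (nat \<Rightarrow> int) set" where
  "freqs d = {h. \<forall>k. k \<notin> {1..d} \<longrightarrow> h k = 0}"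

definition cube :: "nat \<Rightarrow> (nat \<Rightarrow> real) set" where
  "cube d = PiE {1..d} (\<lambda>_. {0..1})"

definition wt :: "real \<Rightarrow> (nat \<Rightarrow> real) \<Rightarrow> (nat \<Rightarrow> real) \<Rightarrow> nat \<Rightarrow> (nat \<Rightarrow> int) \<Rightarrow> real" where
  "wt \<omega> a b d h = \<omega> powr (\<Sum>k=1..d. a k * \<bar>real_of_int (h k)\<bar> powr b k)"

definition char_fun :: "nat \<Rightarrow> (nat \<Rightarrow> int) \<Rightarrow> (nat \<Rightarrow> real) \<Rightarrow> complex" where
  "char_fun d h x = exp (2 * complex_of_real pi * \<i> * complex_of_real (\<Sum>k=1..d. real_of_int (h k) * x k))"

definition fseries :: "nat \<Rightarrow> ((nat \<Rightarrow> int) \<Rightarrow> complex) \<Rightarrow> (nat \<Rightarrow> real) \<Rightarrow> complex" where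
  "fseries d c x = infsum (\<lambda>h. c h * char_fun d h x) (freqs d)"

definition cnorm2 :: "real \<Rightarrow> (nat \<Rightarrow> real) \<Rightarrow> (nat \<Rightarrow> real) \<Rightarrow> nat \<Rightarrow> ((nat \<Rightarrow> int) \<Rightarrow> complex) \<Rightarrow> real" where
  "cnorm2 \<omega> a b d c = infsum (\<lambda>h. (cmod (c h))\<^sup>2 / wt \<omega> a b d h) (freqs d)"

definition coefs :: "real \<Rightarrow> (nat \<Rightarrow> real) \<Rightarrow> (nat \<Rightarrow> real) \<Rightarrow> nat \<Rightarrow> ((nat \<Rightarrow> int) \<Rightarrow> complex) set" where
  "coefs \<omega> a b d = {c. (\<forall>h. h \<notin> freqs d \<longrightarrow> c h = 0) \<and>
      (\<lambda>h. (cmod (c h))\<^sup>2 / wt \<omega> a b d h) summable_on freqs d}"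

text \<open>The space H(K_{d,a,b}): 1-periodic functions whose Fourier coefficients have finite
 weighted l2 norm (the functions are the sums of their Fourier series).\<close>
definition Hsp :: "real \<Rightarrow> (nat \<Rightarrow> real) \<Rightarrow> (nat \<Rightarrow> real) \<Rightarrow> nat \<Rightarrow> ((nat \<Rightarrow> real) \<Rightarrow> complex) set" where
  "Hsp \<omega> a b d = {f. \<exists>c \<in> coefs \<omega> a b d. f = fseries d c}"

definition Hnorm :: "real \<Rightarrow> (nat \<Rightarrow> real) \<Rightarrow> (nat \<Rightarrow> real) \<Rightarrow> nat \<Rightarrow> ((nat \<Rightarrow> real) \<Rightarrow> complex) \<Rightarrow> real" where
  "Hnorm \<omega> a b d f = sqrt (cnorm2 \<omega> a b d (THE c. c \<in> coefs \<omega> a b d \<and> f = fseries d c))"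

definition Hball :: "real \<Rightarrow> (nat \<Rightarrow> real) \<Rightarrow> (nat \<Rightarrow> real) \<Rightarrow> nat \<Rightarrow> ((nat \<Rightarrow> real) \<Rightarrow> complex) set" where
  "Hball \<omega> a b d = {f \<in> Hsp \<omega> a b d. Hnorm \<omega> a b d f \<le> 1}"

datatype info_class = Lstd | Lall
datatype err_crit = ABS | NOR

definition Lam :: "info_class \<Rightarrow> real \<Rightarrow> (nat \<Rightarrow> real) \<Rightarrow> (nat \<Rightarrow> real) \<Rightarrow> nat \<Rightarrow>
    (((nat \<Rightarrow> real) \<Rightarrow> complex) \<Rightarrow> complex) set" where
  "Lam cl \<omega> a b d = (case cl of
      Lstd \<Rightarrow> {L. \<exists>x \<in> cube d. L = (\<lambda>f. f x)}
    | Lall \<Rightarrow> {L. (\<forall>f \<in> Hsp \<omega> a b d. \<forall>g \<in> Hsp \<omega> a b d. L (\<lambda>x. f x + g x) = L f + L g)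
                 \<and> (\<forall>f \<in> Hsp \<omega> a b d. \<forall>\<alpha>. L (\<lambda>x. \<alpha> * f x) = \<alpha> * L f)
                 \<and> (\<exists>C. \<forall>f \<in> Hsp \<omega> a b d. cmod (L f) \<le> C * Hnorm \<omega> a b d f)})"

definition alg_err :: "real \<Rightarrow> (nat \<Rightarrow> real) \<Rightarrow> (nat \<Rightarrow> real) \<Rightarrow> nat \<Rightarrow> nat \<Rightarrow>
    (nat \<Rightarrow> ((nat \<Rightarrow> real) \<Rightarrow> complex) \<Rightarrow> complex) \<Rightarrow>
    ((nat \<Rightarrow> complex) \<Rightarrow> (nat \<Rightarrow> real) \<Rightarrow> complex) \<Rightarrow> ereal" where
  "alg_err \<omega> a b d n L \<phi> =
     (SUP f \<in> Hball \<omega> a b d. SUP x \<in> cube d.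
        ereal (cmod (f x - \<phi> (\<lambda>i. if i < n then L i f else 0) x)))"

definition min_err :: "info_class \<Rightarrow> real \<Rightarrow> (nat \<Rightarrow> real) \<Rightarrow> (nat \<Rightarrow> real) \<Rightarrow> nat \<Rightarrow> nat \<Rightarrow> ereal" where
  "min_err cl \<omega> a b d n =
     (INF (L, \<phi>) \<in> {(L, \<phi>). \<forall>i < n. L i \<in> Lam cl \<omega> a b d}. alg_err \<omega> a b d n L \<phi>)"

definition init_err :: "real \<Rightarrow> (nat \<Rightarrow> real) \<Rightarrow> (nat \<Rightarrow> real) \<Rightarrow> nat \<Rightarrow> ereal" where
  "init_err \<omega> a b d = (SUP f \<in> Hball \<omega> a b d. SUP x \<in> cube d. ereal (cmod (f x)))"

definition CRI :: "err_crit \<Rightarrow> real \<Rightarrow> (nat \<Rightarrow> real) \<Rightarrow> (nat \<Rightarrow> real) \<Rightarrow> nat \<Rightarrow> ereal" where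
  "CRI cr \<omega> a b d = (case cr of ABS \<Rightarrow> 1 | NOR \<Rightarrow> init_err \<omega> a b d)"

definition good_n :: "info_class \<Rightarrow> err_crit \<Rightarrow> real \<Rightarrow> (nat \<Rightarrow> real) \<Rightarrow> (nat \<Rightarrow> real) \<Rightarrow> real \<Rightarrow> nat \<Rightarrow> nat \<Rightarrow> bool" where
  "good_n cl cr \<omega> a b \<epsilon> d n \<longleftrightarrow> min_err cl \<omega> a b d n \<le> ereal \<epsilon> * CRI cr \<omega> a b d"

definition nstar :: "info_class \<Rightarrow> err_crit \<Rightarrow> real \<Rightarrow> (nat \<Rightarrow> real) \<Rightarrow> (nat \<Rightarrow> real) \<Rightarrow> real \<Rightarrow> nat \<Rightarrow> nat" where
  "nstar cl cr \<omega> a b \<epsilon> d = (LEAST n. good_n cl cr \<omega> a b \<epsilon> d n)"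

definition EXP_WT :: "info_class \<Rightarrow> err_crit \<Rightarrow> real \<Rightarrow> (nat \<Rightarrow> real) \<Rightarrow> (nat \<Rightarrow> real) \<Rightarrow> real \<Rightarrow> real \<Rightarrow> bool" where
  "EXP_WT cl cr \<omega> a b s t \<longleftrightarrow>
     (\<forall>\<epsilon> d. 0 < \<epsilon> \<longrightarrow> \<epsilon> < 1 \<longrightarrow> d \<ge> 1 \<longrightarrow> (\<exists>n. good_n cl cr \<omega> a b \<epsilon> d n)) \<and>
     (\<forall>\<eta> > 0. \<exists>M. \<forall>\<epsilon> d. 0 < \<epsilon> \<longrightarrow> \<epsilon> < 1 \<longrightarrow> d \<ge> 1 \<longrightarrow> 1 / \<epsilon> + real d \<ge> M \<longrightarrow>
        ln (real (nstar cl cr \<omega> a b \<epsilon> d)) / ((1 + ln (1 / \<epsilon>)) powr s + real d powr t) \<le> \<eta>)"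

definition EXP_UWT :: "info_class \<Rightarrow> err_crit \<Rightarrow> real \<Rightarrow> (nat \<Rightarrow> real) \<Rightarrow> (nat \<Rightarrow> real) \<Rightarrow> bool" where
  "EXP_UWT cl cr \<omega> a b \<longleftrightarrow> (\<forall>\<alpha> > 0. \<forall>\<beta> > 0. EXP_WT cl cr \<omega> a b \<alpha> \<beta>)"

end

theory Submission
  imports Defs
begin

text \<open>
  Write \<open>x\<^sub>k = - ln \<omega> * a\<^sub>k\<close>, \<open>L = 1 + ln (1 / \<epsilon>)\<close> and let \<open>S(\<tau>)\<close> be the sum of the \<open>\<tau>\<close>-th powers of the
  weights \<open>\<omega>\<^sub>h\<close>; it factorises over the coordinates. Allowing more functionals or the normalised criterion
  only helps, so upper bounds are needed for function values under ABS and lower bounds for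
  arbitrary functionals under NOR.

  Upper bound: for a finite downward closed frequency set \<open>A\<close> of size \<open>N\<close> there is a rank-1 lattice with \<open>N\<^sup>3\<close>
  nodes on which the frequencies of \<open>A\<close> stay distinct. Sampling on it is exact on \<open>A\<close> up to aliasing, and the worst
  case error is at most twice the square root of the weight sum outside \<open>A\<close>. For level sets \<open>A\<close> of the weights this gives
  \<open>ln n \<le> 6 / (1 - \<tau>) * (ln S(\<tau>) + \<tau> * L)\<close> for every \<open>0 < \<tau> < 1\<close>, and each sufficiency claim is a choice of \<open>\<tau>\<close>.

  Lower bound: \<open>n\<close> functionals leave a worst case error \<open>e\<close> with \<open>e\<^sup>2 \<ge> (\<Sum>h. min \<omega>\<^sub>h \<theta>) - n * \<theta>\<close> for every \<open>\<theta>\<close>.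
  Applied to 0/1 frequency vectors with a prescribed number of ones this settles \<open>s \<le> 1\<close>. For \<open>s > 1\<close> and
  fixed \<open>\<epsilon>\<close> it bounds \<open>ln n\<close> from below by a Renyi entropy of the normalised weights, of order \<open>1 + 1 / ln d\<close>, which is
  of the size \<open>d * a\<^sub>d * \<omega> powr a\<^sub>d\<close>.
\<close>

text \<open>All the notions see only \<open>ln n\<close>, so the polynomial cost of a lattice is
  invisible; hence function values do as well as arbitrary functionals. \<open>\<tau>\<close>
  balances \<open>ln (S d \<tau>)\<close> against \<open>\<tau> * L\<close>: it is of order
  \<open>1 / L\<close> for \<open>t > 1\<close>, a small constant for \<open>s = 1\<close>, of order
  \<open>L powr (s - 1)\<close> for \<open>s < 1\<close>, and \<open>1 - \<tau>\<close> is of order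
  \<open>1 / ln d\<close> for \<open>s > 1\<close>. The last case is the delicate one. Comparing
  \<open>n\<close> with \<open>S d 1\<close> only shows that \<open>d * \<omega> powr a d\<close> is
  small against \<open>d powr t\<close> and misses the factor \<open>a d\<close>. Orders at distance
  \<open>1 / ln d\<close> from 1 supply a factor \<open>ln d\<close>, as
  \<open>6 / (1 - \<tau>)\<close> in the upper bound and as \<open>1 / (p - 1)\<close> in the lower
  one. It can be exchanged for \<open>a d\<close>: the limit condition and the crude comparison both
  force \<open>a d\<close> to be at least a multiple of \<open>ln d\<close>, and indices where
  \<open>- ln \<omega> * a d\<close> exceeds \<open>2 * ln d\<close> are negligible. No integral
  over the cube is used; orthogonality of characters on lattices takes its place, also in showing
  that a function determines its coefficients.\<close>

section \<open>Two elementary inequalities for exponentials and logarithms\<close>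

text \<open>Raise \<open>u / p <= exp (u / p)\<close> to the power \<open>p\<close>. The free
  \<open>p\<close> trades exponential decay for any desired power.\<close>

lemma exp_minus_le_powr:
  fixes p u :: real
  assumes "p > 0" "u > 0"
  shows "exp (- u) \<le> p powr p * u powr (- p)"
proof -
  have "u / p \<le> exp (u / p)"
    using exp_ge_add_one_self[of "u/p"] by linarith
  then have "(u / p) powr p \<le> exp (u / p) powr p"
    using assms by (intro powr_mono2) auto
  also have "\<dots> = exp u" using assms by (simp add: powr_def)
  finally have "(u / p) powr p \<le> exp u" .
  then have "inverse (exp u) \<le> inverse ((u / p) powr p)"
    using assms by (intro le_imp_inverse_le) auto
  also have "\<dots> = p powr p * u powr (- p)"
    using assms by (simp add: powr_divide powr_minus divide_simps)
  finally show ?thesis by (simp add: exp_minus)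
qed

text \<open>Below 1 the power \<open>q <= 1\<close> dominates \<open>y\<close> itself, above 1 it
  dominates \<open>ln y\<close>. This yields small exponents for \<open>ln theta\<close> although
  \<open>theta - 1\<close> is only controlled with large ones.\<close>

lemma ln_add_one_le_powr:
  fixes y q :: real
  assumes "0 \<le> y" "0 < q" "q \<le> 1"
  shows "ln (1 + y) \<le> (1 + 1 / q) * y powr q"
proof (cases "y \<le> 1")
  case True
  have "y \<le> y powr q"
  proof (cases "y = 0")
    case False
    then have "y powr 1 \<le> y powr q" using assms True by (intro powr_mono') auto
    then show ?thesis using assms False by simp
  qed simp
  moreover have "ln (1 + y) \<le> y" using assms ln_add_one_self_le_self by auto
  moreover have "0 \<le> (1/q) * y powr q" using assms by simp
  ultimately show ?thesis by (simp add: distrib_right)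
next
  case False
  have "ln (1 + y) \<le> ln (2 * y)" using False by simp
  also have "\<dots> = ln 2 + ln y" using False by (simp add: ln_mult)
  also have "\<dots> \<le> 1 + y powr q / q"
    using False assms ln_powr_bound[of y q] ln_2_less_1 by linarith
  also have "\<dots> \<le> y powr q + y powr q / q" using False assms by (simp add: ge_one_powr_ge_zero)
  finally show ?thesis by (simp add: distrib_right)
qed

section \<open>One-dimensional weight sums\<close>

text \<open>The weight sum of a single coordinate; for \<open>b = 2\<close> a Jacobi theta
  constant.\<close>

definition theta :: "real \<Rightarrow> real \<Rightarrow> real" where
  "theta x b = infsum (\<lambda>j::int. exp (- (x * \<bar>real_of_int j\<bar> powr b))) UNIV"

text \<open>Twice the Riemann zeta value at 2.\<close>

definition zeta_int :: real where
  "zeta_int = infsum (\<lambda>j::int. \<bar>real_of_int j\<bar> powr (- 2)) (UNIV - {0})"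

lemma summable_zeta_int: "(\<lambda>j::int. \<bar>real_of_int j\<bar> powr (- 2)) summable_on A"
proof -
  let ?f = "\<lambda>j::int. \<bar>real_of_int j\<bar> powr (- 2)"
  have nat: "(\<lambda>n::nat. real n powr (- 2)) summable_on UNIV"
    by (subst summable_on_UNIV_nonneg_real_iff) (auto simp: summable_real_powr_iff)
  have 1: "?f summable_on range int"
    by (subst summable_on_reindex) (use nat in \<open>auto simp: o_def inj_on_def\<close>)
  have 2: "?f summable_on range (\<lambda>n. - int n)"
    by (subst summable_on_reindex) (use nat in \<open>auto simp: o_def inj_on_def\<close>)
  have "?f summable_on (range int \<union> range (\<lambda>n. - int n))"
    using 1 2 by (rule summable_on_union)
  moreover have "A \<subseteq> range int \<union> range (\<lambda>n. - int n)"
  proof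
    fix j :: int
    have "j = int (nat j) \<or> j = - int (nat (- j))" by linarith
    then show "j \<in> range int \<union> range (\<lambda>n. - int n)" by blast
  qed
  ultimately show ?thesis by (rule summable_on_subset)
qed

lemma zeta_int_nonneg: "0 \<le> zeta_int"
  unfolding zeta_int_def by (rule infsum_nonneg) auto

lemma abs_powr_mono_int:
  fixes j :: int
  assumes "j \<noteq> 0" "\<beta> \<le> b"
  shows "\<bar>real_of_int j\<bar> powr \<beta> \<le> \<bar>real_of_int j\<bar> powr b"
proof -
  have "1 \<le> \<bar>real_of_int j\<bar>" using assms by linarith
  then show ?thesis using assms by (intro powr_mono)
qed

lemma abs_powr_ge_1_int:
  fixes j :: int
  assumes "j \<noteq> 0" "0 \<le> b"
  shows "1 \<le> \<bar>real_of_int j\<bar> powr b"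
proof -
  have "1 \<le> \<bar>real_of_int j\<bar>" using assms by linarith
  then show ?thesis using assms by (intro ge_one_powr_ge_zero)
qed

text \<open>The condition \<open>2 <= \<beta> * p\<close> leaves a summable power of
  \<open>j\<close>, and the constant is free of \<open>b\<close>, so one bound serves all
  coordinates.\<close>

lemma theta_term_le:
  fixes j :: int
  assumes "x > 0" "0 < \<beta>" "\<beta> \<le> b" "2 \<le> \<beta> * p" "j \<noteq> 0"
  shows "exp (- (x * \<bar>real_of_int j\<bar> powr b)) \<le> p powr p * x powr (- p) * \<bar>real_of_int j\<bar> powr (- 2)"
proof -
  let ?a = "\<bar>real_of_int j\<bar>"
  have a1: "1 \<le> ?a" using assms by linarith
  have p: "p > 0" using assms by (metis linorder_not_less mult_nonneg_nonpos not_numeral_le_zero order.strict_implies_order order.trans)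
  have "exp (- (x * ?a powr b)) \<le> exp (- (x * ?a powr \<beta>))"
    using assms abs_powr_mono_int[of j \<beta> b] by auto
  also have "\<dots> \<le> p powr p * (x * ?a powr \<beta>) powr (- p)"
    using assms p a1 by (intro exp_minus_le_powr) auto
  also have "\<dots> = p powr p * (x powr (- p) * ?a powr (- (\<beta> * p)))"
    using assms a1 by (simp add: powr_mult powr_powr)
  also have "\<dots> \<le> p powr p * (x powr (- p) * ?a powr (- 2))"
    using a1 assms by (intro mult_left_mono powr_mono) auto
  finally show ?thesis by (simp add: mult.assoc)
qed

lemma summable_theta:
  assumes "x > 0" "0 < b"
  shows "(\<lambda>j::int. exp (- (x * \<bar>real_of_int j\<bar> powr b))) summable_on A"
proof -
  let ?f = "\<lambda>j::int. exp (- (x * \<bar>real_of_int j\<bar> powr b))"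
  have "?f summable_on (UNIV - {0})"
  proof (rule summable_on_comparison_test)
    show "(\<lambda>j::int. (2 / b) powr (2 / b) * x powr (- (2 / b)) * \<bar>real_of_int j\<bar> powr (- 2)) summable_on (UNIV - {0})"
      by (intro summable_on_cmult_right summable_zeta_int)
  qed (use assms theta_term_le[of x b b "2/b"] in auto)
  then have "?f summable_on insert 0 (UNIV - {0})"
    by (subst summable_on_insert_iff)
  then show ?thesis by (rule summable_on_subset) auto
qed

lemma theta_eq:
  assumes "x > 0" "0 < b"
  shows "theta x b = 1 + infsum (\<lambda>j::int. exp (- (x * \<bar>real_of_int j\<bar> powr b))) (UNIV - {0})"
proof -
  let ?f = "\<lambda>j::int. exp (- (x * \<bar>real_of_int j\<bar> powr b))"
  have "infsum ?f (insert 0 (UNIV - {0})) = ?f 0 + infsum ?f (UNIV - {0})"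
    by (rule infsum_insert) (use summable_theta assms in auto)
  moreover have "insert 0 (UNIV - {0}) = (UNIV :: int set)" by auto
  ultimately show ?thesis by (simp add: theta_def)
qed

lemma theta_ge:
  assumes "x > 0" "0 < b"
  shows "1 + 2 * exp (- x) \<le> theta x b"
proof -
  let ?f = "\<lambda>j::int. exp (- (x * \<bar>real_of_int j\<bar> powr b))"
  have "sum ?f {-1, 0, 1} \<le> infsum ?f UNIV"
    by (rule finite_sum_le_infsum) (use summable_theta assms in auto)
  then show ?thesis by (simp add: theta_def)
qed

lemma theta_ge_1:
  assumes "x > 0" "0 < b"
  shows "1 \<le> theta x b"
  using theta_ge[OF assms] exp_gt_zero[of "-x"] by linarith

lemma theta_antimono:
  assumes "0 < x" "x \<le> y" "0 < b"
  shows "theta y b \<le> theta x b"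
  unfolding theta_def
  by (rule infsum_mono) (use assms in \<open>auto intro!: summable_theta mult_right_mono\<close>)

lemma theta_antimono_exponent:
  assumes "0 < x" "0 < \<beta>" "\<beta> \<le> b"
  shows "theta x b \<le> theta x \<beta>"
proof -
  have "infsum (\<lambda>j::int. exp (- (x * \<bar>real_of_int j\<bar> powr b))) (UNIV - {0}) \<le>
        infsum (\<lambda>j::int. exp (- (x * \<bar>real_of_int j\<bar> powr \<beta>))) (UNIV - {0})"
    by (rule infsum_mono)
       (use assms in \<open>auto intro!: summable_theta mult_left_mono abs_powr_mono_int\<close>)
  then show ?thesis using assms by (simp add: theta_eq)
qed

lemma theta_minus_1_le_powr:
  assumes "x > 0" "0 < \<beta>" "\<beta> \<le> b" "2 \<le> \<beta> * p"
  shows "theta x b - 1 \<le> p powr p * zeta_int * x powr (- p)"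
proof -
  have "infsum (\<lambda>j::int. exp (- (x * \<bar>real_of_int j\<bar> powr b))) (UNIV - {0}) \<le>
        infsum (\<lambda>j::int. p powr p * x powr (- p) * \<bar>real_of_int j\<bar> powr (- 2)) (UNIV - {0})"
    by (rule infsum_mono)
       (use assms in \<open>auto intro!: summable_theta summable_on_cmult_right summable_zeta_int theta_term_le[of _ \<beta>]\<close>)
  also have "\<dots> = p powr p * x powr (- p) * zeta_int"
    unfolding zeta_int_def by (rule infsum_cmult_right) (rule summable_zeta_int)
  finally show ?thesis using assms by (simp add: theta_eq mult_ac)
qed

text \<open>The termwise estimate needs a large exponent \<open>P\<close> with
  \<open>\<beta> * P >= 2\<close>. A smaller \<open>p\<close> is reached through the logarithm, by
  \<open>ln (1 + y) <= C * y powr q\<close> with \<open>q = p / P\<close>.\<close>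

lemma ln_theta_le_powr:
  assumes "0 < \<beta>" "0 < p"
  obtains C where "C > 0" "\<And>x b. 0 < x \<Longrightarrow> \<beta> \<le> b \<Longrightarrow> ln (theta x b) \<le> C * x powr (- p)"
proof -
  define P where "P = max p (2 / \<beta>)"
  define q where "q = p / P"
  have P: "P > 0" "p \<le> P" "2 \<le> \<beta> * P" using assms by (auto simp: P_def max_def field_simps)
  have q: "0 < q" "q \<le> 1" using P assms by (auto simp: q_def)
  define B where "B = P powr P * zeta_int + 1"
  have B: "B > 0" using zeta_int_nonneg by (simp add: B_def add_nonneg_pos)
  define C where "C = (1 + 1 / q) * B powr q"
  have "C > 0" using q B by (auto simp: C_def intro!: mult_pos_pos add_pos_pos)
  moreover have "ln (theta x b) \<le> C * x powr (- p)" if x: "0 < x" "\<beta> \<le> b" for x b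
  proof -
    have 1: "theta x b - 1 \<le> B * x powr (- P)"
    proof -
      have "theta x b - 1 \<le> P powr P * zeta_int * x powr (- P)"
        using theta_minus_1_le_powr[OF x(1) assms(1) x(2) P(3)] .
      also have "\<dots> \<le> B * x powr (- P)" by (simp add: B_def distrib_right)
      finally show ?thesis .
    qed
    have 0: "0 \<le> theta x b - 1" using theta_ge_1 x assms by auto
    have "ln (theta x b) = ln (1 + (theta x b - 1))" by simp
    also have "\<dots> \<le> (1 + 1 / q) * (theta x b - 1) powr q"
      by (rule ln_add_one_le_powr) (use 0 q in auto)
    also have "\<dots> \<le> (1 + 1 / q) * (B * x powr (- P)) powr q"
      using 0 1 q by (intro mult_left_mono powr_mono2) auto
    also have "\<dots> = C * x powr (- p)"
      using B P x by (simp add: C_def powr_mult powr_powr q_def)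
    finally show ?thesis .
  qed
  ultimately show ?thesis by (rule that)
qed

text \<open>Away from 0 the frequencies 1 and -1 dominate: as
  \<open>\<bar>j\<bar> powr b >= 1\<close>, the part \<open>x - x0\<close> of the exponent yields a
  factor \<open>exp (x0 - x)\<close> for every nonzero \<open>j\<close>, and the series left over at
  \<open>x0\<close> is a constant.\<close>

lemma ln_theta_le_exp:
  assumes "0 < \<beta>" "0 < x0"
  obtains C where "C > 0" "\<And>x b. x0 \<le> x \<Longrightarrow> \<beta> \<le> b \<Longrightarrow> ln (theta x b) \<le> C * exp (- x)"
proof -
  define C where "C = exp x0 * (theta x0 \<beta> - 1)"
  have "0 < theta x0 \<beta> - 1" using theta_ge[of x0 \<beta>] assms exp_gt_zero[of "-x0"] by linarith
  then have "C > 0" by (simp add: C_def)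
  moreover have "ln (theta x b) \<le> C * exp (- x)" if x: "x0 \<le> x" "\<beta> \<le> b" for x b
  proof -
    have "infsum (\<lambda>j::int. exp (- (x * \<bar>real_of_int j\<bar> powr b))) (UNIV - {0}) \<le>
          infsum (\<lambda>j::int. exp (x0 - x) * exp (- (x0 * \<bar>real_of_int j\<bar> powr \<beta>))) (UNIV - {0})"
    proof (rule infsum_mono)
      fix j :: int assume "j \<in> UNIV - {0}"
      then have j: "j \<noteq> 0" by simp
      have "(x - x0) * 1 \<le> (x - x0) * \<bar>real_of_int j\<bar> powr b"
        using x assms j abs_powr_ge_1_int[of j b] by (intro mult_left_mono) auto
      moreover have "x0 * \<bar>real_of_int j\<bar> powr \<beta> \<le> x0 * \<bar>real_of_int j\<bar> powr b"
        using x assms j abs_powr_mono_int[of j \<beta> b] by auto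
      ultimately have "- (x * \<bar>real_of_int j\<bar> powr b) \<le> (x0 - x) + - (x0 * \<bar>real_of_int j\<bar> powr \<beta>)"
        by (simp add: algebra_simps)
      then show "exp (- (x * \<bar>real_of_int j\<bar> powr b)) \<le> exp (x0 - x) * exp (- (x0 * \<bar>real_of_int j\<bar> powr \<beta>))"
        by (simp flip: exp_add)
    qed (use x assms in \<open>auto intro!: summable_theta summable_on_cmult_right\<close>)
    also have "\<dots> = exp (x0 - x) * (theta x0 \<beta> - 1)"
      using assms by (subst infsum_cmult_right) (auto intro!: summable_theta simp: theta_eq)
    finally have "theta x b - 1 \<le> C * exp (- x)"
      using x assms by (simp add: theta_eq C_def exp_diff exp_minus field_simps)
    moreover have "ln (theta x b) \<le> theta x b - 1"
      using x assms theta_ge_1[of x b] by (intro ln_le_minus_one) auto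
    ultimately show ?thesis by linarith
  qed
  ultimately show ?thesis by (rule that)
qed

text \<open>Passing to \<open>p * x\<close> shrinks every nonzero term at least by the factor
  \<open>\<kappa>\<close>, and these terms have mass at least \<open>2 * exp (- x)\<close>. This is
  the gain of one coordinate in the entropy estimate. The 2/3 comes from
  \<open>1 + 2 * exp (- x) <= 3\<close>.\<close>

lemma ln_theta_scale_diff:
  assumes "0 < x" "0 < b" "1 \<le> p" "exp (- ((p - 1) * x)) \<le> \<kappa>" "\<kappa> \<le> 1"
  shows "(1 - \<kappa>) * (2 / 3) * exp (- x) \<le> ln (theta x b) - ln (theta (p * x) b)"
proof -
  define g where "g = theta x b - 1"
  have x': "0 < p * x" using assms by auto
  have g: "2 * exp (- x) \<le> g" using theta_ge[of x b] assms by (simp add: g_def)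
  have ex: "0 < exp (- x)" "exp (- x) \<le> 1" using assms by auto
  have "infsum (\<lambda>j::int. exp (- (p * x * \<bar>real_of_int j\<bar> powr b))) (UNIV - {0}) \<le>
        infsum (\<lambda>j::int. \<kappa> * exp (- (x * \<bar>real_of_int j\<bar> powr b))) (UNIV - {0})"
  proof (rule infsum_mono)
    fix j :: int assume "j \<in> UNIV - {0}"
    then have j: "j \<noteq> 0" by simp
    have "((p - 1) * x) * 1 \<le> ((p - 1) * x) * \<bar>real_of_int j\<bar> powr b"
      using assms j abs_powr_ge_1_int[of j b] by (intro mult_left_mono) auto
    then have "exp (- (p * x * \<bar>real_of_int j\<bar> powr b)) \<le> exp (- ((p - 1) * x)) * exp (- (x * \<bar>real_of_int j\<bar> powr b))"
      by (simp add: algebra_simps flip: exp_add)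
    also have "\<dots> \<le> \<kappa> * exp (- (x * \<bar>real_of_int j\<bar> powr b))"
      using assms by (intro mult_right_mono) auto
    finally show "exp (- (p * x * \<bar>real_of_int j\<bar> powr b)) \<le> \<kappa> * exp (- (x * \<bar>real_of_int j\<bar> powr b))" .
  qed (use x' assms in \<open>auto intro!: summable_theta summable_on_cmult_right\<close>)
  also have "\<dots> = \<kappa> * g"
    using assms by (subst infsum_cmult_right) (auto intro!: summable_theta simp: theta_eq g_def)
  finally have 1: "theta (p * x) b \<le> 1 + \<kappa> * g" using x' assms by (simp add: theta_eq)
  have pos: "0 < theta (p * x) b" "0 < theta x b"
    using theta_ge_1[of "p * x" b] theta_ge_1[of x b] x' assms by linarith+
  have "2 * exp (- x) / 3 \<le> 2 * exp (- x) / (1 + 2 * exp (- x))"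
    using ex by (intro divide_left_mono) (auto simp: add_pos_pos)
  then have "(1 - \<kappa>) * (2 / 3) * exp (- x) \<le> (1 - \<kappa>) * (2 * exp (- x) / (1 + 2 * exp (- x)))"
    unfolding mult.assoc using assms by (intro mult_left_mono) auto
  also have "\<dots> \<le> (1 - \<kappa>) * (g / (1 + g))"
  proof -
    have "y / (1 + y) \<le> g / (1 + g)" if "0 < y" "y \<le> g" for y
      using that by (simp add: field_simps)
    then show ?thesis using assms ex g by (intro mult_left_mono) auto
  qed
  also have "\<dots> = 1 - (1 + \<kappa> * g) / (1 + g)"
  proof -
    have "0 < 1 + g" using g ex by linarith
    then show ?thesis by (simp add: field_simps)
  qed
  also have "\<dots> \<le> 1 - theta (p * x) b / theta x b"
    using 1 pos by (auto simp: g_def intro!: divide_right_mono)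
  also have "\<dots> \<le> - ln (theta (p * x) b / theta x b)"
    using ln_le_minus_one[of "theta (p * x) b / theta x b"] pos by simp
  also have "\<dots> = ln (theta x b) - ln (theta (p * x) b)"
    using pos by (simp add: ln_div)
  finally show ?thesis .
qed

section \<open>Multivariate weight sums\<close>

lemma freqs_0: "freqs 0 = {\<lambda>_. 0}"
  by (auto simp: freqs_def)

lemma bij_betw_freqs_Suc:
  "bij_betw (\<lambda>(h, j). h(Suc d := j)) (freqs d \<times> UNIV) (freqs (Suc d))"
proof (rule bij_betw_byWitness[where f' = "\<lambda>h. (h(Suc d := 0), h (Suc d))"])
  show "\<forall>a\<in>freqs d \<times> UNIV. (\<lambda>h. (h(Suc d := 0), h (Suc d))) ((\<lambda>(h, j). h(Suc d := j)) a) = a"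
    by (auto simp: freqs_def fun_eq_iff)
qed (auto simp: freqs_def fun_eq_iff)

text \<open>Tonelli by induction on the dimension: one entry is appended at a time, and
  nonnegativity makes the iterated sum unconditional.\<close>

lemma has_sum_freqs_prod:
  fixes f :: "nat \<Rightarrow> int \<Rightarrow> real"
  assumes "\<And>k. k \<in> {1..d} \<Longrightarrow> (f k has_sum S k) UNIV" "\<And>k j. 0 \<le> f k j"
  shows "((\<lambda>h. \<Prod>k=1..d. f k (h k)) has_sum (\<Prod>k=1..d. S k)) (freqs d)"
  using assms(1)
proof (induction d)
  case 0
  show ?case by (simp add: freqs_0 has_sum_finite_iff)
next
  case (Suc d)
  let ?F = "\<lambda>h. \<Prod>k=1..d. f k (h k)"
  have IH: "(?F has_sum (\<Prod>k=1..d. S k)) (freqs d)" using Suc by auto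
  have inner: "((\<lambda>j. case (h, j) of (h, j) \<Rightarrow> ?F h * f (Suc d) j) has_sum (?F h * S (Suc d))) UNIV" for h
    using Suc.prems[of "Suc d"] by (auto intro!: has_sum_cmult_right)
  have outer: "((\<lambda>h. ?F h * S (Suc d)) has_sum (\<Prod>k=1..d. S k) * S (Suc d)) (freqs d)"
    by (intro has_sum_cmult_left IH)
  have "((\<lambda>(h, j). ?F h * f (Suc d) j) has_sum (\<Prod>k=1..d. S k) * S (Suc d)) (freqs d \<times> UNIV)"
  proof (rule has_sum_SigmaI[OF inner outer], rule summable_on_SigmaI[OF inner])
    show "(\<lambda>h. ?F h * S (Suc d)) summable_on freqs d" using outer by (rule has_sum_imp_summable)
  qed (auto intro!: mult_nonneg_nonneg prod_nonneg assms)
  also have "(\<lambda>(h, j). ?F h * f (Suc d) j) =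
     (\<lambda>p. (\<lambda>h. \<Prod>k=1..Suc d. f k (h k)) ((\<lambda>(h, j). h(Suc d := j)) p))"
    by (auto simp: fun_eq_iff intro!: prod.cong)
  finally show ?case
    by (subst (asm) has_sum_reindex_bij_betw[OF bij_betw_freqs_Suc]) (simp add: mult.commute)
qed

lemma has_sum_wt_powr:
  assumes "0 < \<omega>" "\<omega> < 1" "\<And>k. k \<in> {1..d} \<Longrightarrow> 0 < a k" "\<And>k. k \<in> {1..d} \<Longrightarrow> 0 < b k" "0 < \<tau>"
  shows "((\<lambda>h. wt \<omega> a b d h powr \<tau>) has_sum (\<Prod>k=1..d. theta (\<tau> * (- ln \<omega> * a k)) (b k))) (freqs d)"
proof -
  have "((\<lambda>h. \<Prod>k=1..d. exp (- (\<tau> * (- ln \<omega> * a k) * \<bar>real_of_int (h k)\<bar> powr b k)))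
      has_sum (\<Prod>k=1..d. theta (\<tau> * (- ln \<omega> * a k)) (b k))) (freqs d)"
  proof (rule has_sum_freqs_prod[of d "\<lambda>k j. exp (- (\<tau> * (- ln \<omega> * a k) * \<bar>real_of_int j\<bar> powr b k))"])
    fix k assume k: "k \<in> {1..d}"
    have "0 < \<tau> * (- ln \<omega> * a k)"
      using assms(1,2,5) assms(3)[OF k] by (intro mult_pos_pos) auto
    then show "((\<lambda>j. exp (- (\<tau> * (- ln \<omega> * a k) * \<bar>real_of_int j\<bar> powr b k))) has_sum theta (\<tau> * (- ln \<omega> * a k)) (b k)) UNIV"
      unfolding theta_def by (intro has_sum_infsum summable_theta assms(4)[OF k])
  qed auto
  also have "(\<lambda>h. \<Prod>k=1..d. exp (- (\<tau> * (- ln \<omega> * a k) * \<bar>real_of_int (h k)\<bar> powr b k))) =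
     (\<lambda>h. wt \<omega> a b d h powr \<tau>)"
    using assms(1) by (simp add: wt_def powr_powr powr_def sum_distrib_left sum_distrib_right mult_ac fun_eq_iff flip: exp_sum)
  finally show ?thesis .
qed

section \<open>Lattice rules\<close>

text \<open>The multiples of \<open>m\<close> among the values \<open>s + c * w\<close> lie in a
  half-open interval of length \<open>\<bar>c\<bar> * m\<close>, and each is hit by at most one
  \<open>w\<close>. The count holds for composite \<open>m\<close> too, which leaves the number of
  nodes free.\<close>

lemma card_linear_congruence_le:
  fixes s c :: int
  assumes "c \<noteq> 0" "m > 0"
  shows "card {w \<in> {0..<int m}. int m dvd s + c * w} \<le> nat \<bar>c\<bar>"
proof -
  have pos: "card {w \<in> {0..<int m}. int m dvd s + c * w} \<le> nat c" if c: "c > 0" for s c :: int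
  proof -
    \<comment> \<open>\<open>q0\<close> is the ceiling of \<open>s / m\<close>, so the possible
      quotients are \<open>q0, ..., q0 + c - 1\<close>.\<close>
    define q0 where "q0 = - ((- s) div int m)"
    have q0: "s \<le> q0 * int m" "q0 * int m < s + int m"
    proof -
      have "(-s) div int m * int m + (-s) mod int m = -s" by simp
      moreover have "0 \<le> (-s) mod int m" "(-s) mod int m < int m" using assms by auto
      ultimately show "s \<le> q0 * int m" "q0 * int m < s + int m"
        unfolding q0_def minus_mult_left[symmetric] by linarith+
    qed
    let ?W = "{w \<in> {0..<int m}. int m dvd s + c * w}"
    let ?f = "\<lambda>w. (s + c * w) div int m - q0"
    have f: "(?f w + q0) * int m = s + c * w" if "w \<in> ?W" for w
      using that by simp
    have "inj_on ?f ?W"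
    proof (rule inj_onI)
      fix w v assume w: "w \<in> ?W" "v \<in> ?W" "?f w = ?f v"
      then have "s + c * w = s + c * v" using f[of w] f[of v] by metis
      then show "w = v" using c by simp
    qed
    moreover have "?f ` ?W \<subseteq> {0..<c}"
    proof
      fix y assume "y \<in> ?f ` ?W"
      then obtain w where w: "w \<in> ?W" "y = ?f w" by blast
      have e: "(y + q0) * int m = s + c * w" using f w by simp
      have "c * w \<ge> 0" using w c by auto
      then have "(y + q0) * int m > (q0 - 1) * int m"
        using e q0 by (simp add: algebra_simps)
      then have "0 \<le> y" using assms by (simp add: mult_less_cancel_right)
      have "c * w < c * int m" using w c by auto
      then have "(y + q0) * int m < (q0 + c) * int m"
        using e q0 by (simp add: algebra_simps)
      then have "y < c" using assms by (simp add: mult_less_cancel_right)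
      then show "y \<in> {0..<c}" using \<open>0 \<le> y\<close> by simp
    qed
    ultimately have "card ?W \<le> card {0..<c}" by (intro card_inj_on_le) auto
    then show ?thesis by simp
  qed
  show ?thesis
  proof (cases "c > 0")
    case True
    then show ?thesis using pos[of c s] by simp
  next
    case False
    have "{w \<in> {0..<int m}. int m dvd s + c * w} = {w \<in> {0..<int m}. int m dvd (- s) + (- c) * w}"
      by (metis (no_types, opaque_lifting) add.inverse_distrib_swap add.commute dvd_minus_iff mult_minus_left)
    then show ?thesis using pos[of "- c" "- s"] False assms by simp
  qed
qed

text \<open>Component-by-component construction. Vectors with last entry 0 are handled by the first
  \<open>d\<close> components; each other vector excludes at most \<open>B\<close> residues for the
  last component, fewer than \<open>m\<close> in total.\<close>

lemma exists_separating_vector: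
  fixes G :: "(nat \<Rightarrow> int) set"
  assumes "finite G" "G \<subseteq> freqs d" "(\<lambda>_. 0) \<notin> G" "\<And>g k. g \<in> G \<Longrightarrow> \<bar>g k\<bar> \<le> int B" "card G * B < m"
  shows "\<exists>z. \<forall>g\<in>G. \<not> int m dvd (\<Sum>k=1..d. g k * z k)"
  using assms
proof (induction d arbitrary: G)
  case 0
  then show ?case by (auto simp: freqs_0)
next
  case (Suc d)
  define G0 where "G0 = {g \<in> G. g (Suc d) = 0}"
  define G1 where "G1 = G - G0"
  have fin: "finite G0" "finite G1" using Suc.prems by (auto simp: G0_def G1_def)
  have "card G0 * B \<le> card G * B" using Suc.prems by (intro mult_right_mono card_mono) (auto simp: G0_def)
  have "\<exists>z. \<forall>g\<in>G0. \<not> int m dvd (\<Sum>k=1..d. g k * z k)"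
  proof (rule Suc.IH)
    show "G0 \<subseteq> freqs d"
    proof
      fix g assume g: "g \<in> G0"
      then have "g \<in> freqs (Suc d)" "g (Suc d) = 0" using Suc.prems by (auto simp: G0_def)
      then show "g \<in> freqs d" unfolding freqs_def using le_Suc_eq by fastforce
    qed
    show "card G0 * B < m" using Suc.prems \<open>card G0 * B \<le> card G * B\<close> by linarith
  qed (use Suc.prems fin in \<open>auto simp: G0_def\<close>)
  then obtain z where z: "\<And>g. g \<in> G0 \<Longrightarrow> \<not> int m dvd (\<Sum>k=1..d. g k * z k)" by blast
  define bad where "bad g = {w \<in> {0..<int m}. int m dvd (\<Sum>k=1..d. g k * z k) + g (Suc d) * w}" for g
  have m: "m > 0" using Suc.prems by linarith
  have "card (\<Union>g\<in>G1. bad g) \<le> (\<Sum>g\<in>G1. card (bad g))"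
    using fin(2) by (rule card_UN_le)
  also have "\<dots> \<le> (\<Sum>g\<in>G1. B)"
  proof (rule sum_mono)
    fix g assume g: "g \<in> G1"
    then have "g (Suc d) \<noteq> 0" "g \<in> G" by (auto simp: G1_def G0_def)
    then have "card (bad g) \<le> nat \<bar>g (Suc d)\<bar>"
      unfolding bad_def using m by (intro card_linear_congruence_le)
    moreover have "nat \<bar>g (Suc d)\<bar> \<le> B" using Suc.prems(4)[OF \<open>g \<in> G\<close>, of "Suc d"] by linarith
    ultimately show "card (bad g) \<le> B" by linarith
  qed
  also have "\<dots> = card G1 * B" by simp
  also have "\<dots> \<le> card G * B" using Suc.prems by (intro mult_right_mono card_mono) (auto simp: G1_def)
  also have "\<dots> < card {0..<int m}" using Suc.prems by simp
  finally have less: "card (\<Union>g\<in>G1. bad g) < card {0..<int m}" .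
  have "finite (\<Union>g\<in>G1. bad g)" using fin by (auto simp: bad_def intro: finite_subset[of _ "{0..<int m}"])
  then have "\<not> {0..<int m} \<subseteq> (\<Union>g\<in>G1. bad g)"
    using card_mono less linorder_not_less by blast
  then obtain w where w: "w \<in> {0..<int m}" "\<And>g. g \<in> G1 \<Longrightarrow> w \<notin> bad g" by blast
  have eq: "(\<Sum>k=1..Suc d. g k * (z(Suc d := w)) k) = (\<Sum>k=1..d. g k * z k) + g (Suc d) * w" for g
    by simp
  show ?case
  proof (intro exI[of _ "z(Suc d := w)"] ballI)
    fix g assume g: "g \<in> G"
    show "\<not> int m dvd (\<Sum>k=1..Suc d. g k * (z(Suc d := w)) k)"
    proof (cases "g \<in> G0")
      case True
      then show ?thesis using z[of g] unfolding eq by (simp add: G0_def)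
    next
      case False
      then show ?thesis using w g unfolding eq by (auto simp: G1_def bad_def)
    qed
  qed
qed

text \<open>Separation is applied to the differences of frequencies: at most
  \<open>card A ^ 2\<close> of them, with entries bounded by \<open>B\<close> because of the factor
  2 in the hypothesis.\<close>

lemma exists_separating_lattice:
  fixes A :: "(nat \<Rightarrow> int) set"
  assumes "finite A" "A \<subseteq> freqs d" "\<And>h k. h \<in> A \<Longrightarrow> 2 * \<bar>h k\<bar> \<le> int B" "card A ^ 2 * B < m"
  shows "\<exists>z. inj_on (\<lambda>h. (\<Sum>k=1..d. h k * z k) mod int m) A"
proof -
  define G where "G = (\<lambda>(h, h') k. h k - h' k) ` (A \<times> A) - {\<lambda>_. 0}"
  have "card G \<le> card ((\<lambda>(h, h') k. h k - h' k :: int) ` (A \<times> A))"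
    unfolding G_def using assms(1) by (intro card_mono) auto
  also have "\<dots> \<le> card (A \<times> A)" using assms(1) by (intro card_image_le) auto
  also have "\<dots> = card A ^ 2" by (simp add: card_cartesian_product power2_eq_square)
  finally have "card G * B \<le> card A ^ 2 * B" by simp
  then have "card G * B < m" using assms(4) by linarith
  have "\<exists>z. \<forall>g\<in>G. \<not> int m dvd (\<Sum>k=1..d. g k * z k)"
  proof (rule exists_separating_vector)
    have "(\<lambda>k. h k - h' k) \<in> freqs d" if "h \<in> A" "h' \<in> A" for h h'
    proof -
      have "h \<in> freqs d" "h' \<in> freqs d" using that assms(2) by auto
      then show ?thesis by (simp add: freqs_def)
    qed
    then show "G \<subseteq> freqs d" by (auto simp: G_def)
    show "\<bar>g k\<bar> \<le> int B" if g: "g \<in> G" for g k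
    proof -
      obtain h h' where h: "h \<in> A" "h' \<in> A" "g k = h k - h' k" using g by (auto simp: G_def)
      then show ?thesis using assms(3)[of h k] assms(3)[of h' k] by linarith
    qed
  qed (use assms(1) \<open>card G * B < m\<close> in \<open>auto simp: G_def\<close>)
  then obtain z where z: "\<And>g. g \<in> G \<Longrightarrow> \<not> int m dvd (\<Sum>k=1..d. g k * z k)" by blast
  have "inj_on (\<lambda>h. (\<Sum>k=1..d. h k * z k) mod int m) A"
  proof (rule inj_onI, rule ccontr)
    fix h h' assume h: "h \<in> A" "h' \<in> A" "(\<Sum>k=1..d. h k * z k) mod int m = (\<Sum>k=1..d. h' k * z k) mod int m" "h \<noteq> h'"
    then have "(\<lambda>k. h k - h' k) \<in> G" by (auto simp: G_def fun_eq_iff)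
    from z[OF this] have "\<not> int m dvd ((\<Sum>k=1..d. h k * z k) - (\<Sum>k=1..d. h' k * z k))"
      by (simp add: left_diff_distrib sum_subtractf)
    then show False using h(3) by (simp add: mod_eq_dvd_iff)
  qed
  then show ?thesis by blast
qed

section \<open>Lattice nodes and orthogonality of characters on them\<close>

text \<open>Taking fractional parts moves the node into the cube and changes no character, since
  frequencies are integral.\<close>

definition lattice_node :: "nat \<Rightarrow> nat \<Rightarrow> (nat \<Rightarrow> int) \<Rightarrow> nat \<Rightarrow> nat \<Rightarrow> real" where
  "lattice_node d m z i = restrict (\<lambda>k. frac (real i * real_of_int (z k) / real m)) {1..d}"

lemma lattice_node_in_cube: "lattice_node d m z i \<in> cube d"
  by (auto simp: lattice_node_def cube_def PiE_def frac_ge_0 frac_lt_1 less_imp_le)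

lemma char_fun_eq_cis:
  "char_fun d h x = cis (2 * pi * (\<Sum>k=1..d. real_of_int (h k) * x k))"
  by (simp add: char_fun_def cis_conv_exp mult_ac)

lemma cis_2pi_eq_iff: "cis (2 * pi * x) = 1 \<longleftrightarrow> x \<in> \<int>"
proof -
  have "cis (2 * pi * x) = 1 \<longleftrightarrow> (\<exists>n::int. 2 * pi * x = of_int (2 * n) * pi)"
    by (simp add: cis_conv_exp exp_eq_1)
  also have "\<dots> \<longleftrightarrow> (\<exists>n::int. x = of_int n)" by simp
  finally show ?thesis by (auto simp: Ints_def)
qed

lemma char_fun_lattice_node:
  "char_fun d h (lattice_node d m z i) =
     cis (2 * pi * (real_of_int (\<Sum>k=1..d. h k * z k) / real m)) ^ i"
proof -
  \<comment> \<open>\<open>n\<close> collects the integer parts removed by \<open>frac\<close>,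
    which contribute a trivial phase.\<close>
  define n where "n = (\<Sum>k=1..d. h k * \<lfloor>real i * real_of_int (z k) / real m\<rfloor>)"
  have "(\<Sum>k=1..d. real_of_int (h k) * lattice_node d m z i k) =
        (\<Sum>k=1..d. real_of_int (h k) * (real i * real_of_int (z k) / real m) -
                    real_of_int (h k * \<lfloor>real i * real_of_int (z k) / real m\<rfloor>))"
    by (intro sum.cong) (auto simp: lattice_node_def frac_def algebra_simps)
  also have "\<dots> = real i * (real_of_int (\<Sum>k=1..d. h k * z k) / real m) - real_of_int n"
    unfolding n_def of_int_sum sum_subtractf
    by (simp add: sum_distrib_left sum_divide_distrib mult_ac)
  finally have "char_fun d h (lattice_node d m z i) =
      cis (2 * pi * (real i * (real_of_int (\<Sum>k=1..d. h k * z k) / real m) - real_of_int n))"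
    by (simp only: char_fun_eq_cis)
  also have "\<dots> = cis (2 * pi * (real i * (real_of_int (\<Sum>k=1..d. h k * z k) / real m))) * cis (2 * pi * (- real_of_int n))"
    unfolding cis_mult by (rule arg_cong[of _ _ cis]) (simp add: right_diff_distrib)
  also have "cis (2 * pi * (- real_of_int n)) = 1" unfolding cis_2pi_eq_iff by simp
  finally show ?thesis by (simp only: Complex.DeMoivre mult_ac mult_1_right mult_1_left)
qed

text \<open>Orthogonality on the cyclic group of order \<open>m\<close>: the terms are powers of an
  \<open>m\<close>-th root of unity, and their geometric sum vanishes unless the root is 1.\<close>

lemma sum_char_fun_lattice_node:
  assumes "m > 0"
  shows "(\<Sum>i<m. char_fun d k (lattice_node d m z i) * cnj (char_fun d h (lattice_node d m z i))) =
     (if (\<Sum>j=1..d. h j * z j) mod int m = (\<Sum>j=1..d. k j * z j) mod int m then of_nat m else 0)"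
proof -
  let ?r = "\<lambda>h. \<Sum>j=1..d. h j * z j"
  define q where "q = cis (2 * pi * (real_of_int (?r k - ?r h) / real m))"
  have summand: "char_fun d k (lattice_node d m z i) * cnj (char_fun d h (lattice_node d m z i)) = q ^ i" for i
  proof -
    have "char_fun d k (lattice_node d m z i) * cnj (char_fun d h (lattice_node d m z i)) =
       (cis (2 * pi * (real_of_int (?r k) / real m)) * cnj (cis (2 * pi * (real_of_int (?r h) / real m)))) ^ i"
      by (simp add: char_fun_lattice_node power_mult_distrib del: of_int_sum)
    also have "cis (2 * pi * (real_of_int (?r k) / real m)) * cnj (cis (2 * pi * (real_of_int (?r h) / real m))) = q"
      unfolding q_def cis_cnj cis_mult by (simp add: diff_divide_distrib right_diff_distrib)
    finally show ?thesis .
  qed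
  have q1: "q = 1 \<longleftrightarrow> ?r h mod int m = ?r k mod int m"
  proof -
    have "q = 1 \<longleftrightarrow> int m dvd (?r k - ?r h)"
      unfolding q_def cis_2pi_eq_iff
    proof
      assume "real_of_int (?r k - ?r h) / real m \<in> \<int>"
      then obtain n where "real_of_int (?r k - ?r h) / real m = real_of_int n" by (auto elim: Ints_cases)
      then have "real_of_int (?r k - ?r h) = real_of_int (n * int m)" using assms by (simp add: field_simps)
      then have "?r k - ?r h = n * int m" by linarith
      then show "int m dvd (?r k - ?r h)" by simp
    next
      assume "int m dvd (?r k - ?r h)"
      then obtain n where "?r k - ?r h = int m * n" by blast
      then show "real_of_int (?r k - ?r h) / real m \<in> \<int>" using assms by (simp del: of_int_diff of_int_sum)
    qed
    also have "\<dots> \<longleftrightarrow> ?r k mod int m = ?r h mod int m" by (simp add: mod_eq_dvd_iff)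
    finally show ?thesis by metis
  qed
  show ?thesis
  proof (cases "q = 1")
    case True
    then show ?thesis using q1 by (simp add: summand)
  next
    case False
    have "q ^ m = cis (2 * pi * real_of_int (?r k - ?r h))"
    proof -
      have "real m * (2 * pi * (R / real m)) = 2 * pi * R" for R
        using assms by simp
      then show ?thesis unfolding q_def by (simp only: Complex.DeMoivre)
    qed
    also have "\<dots> = 1" unfolding cis_2pi_eq_iff by (rule Ints_of_int)
    finally have "(\<Sum>i<m. q ^ i) = 0" using False by (simp add: geometric_sum)
    then show ?thesis using q1 False by (simp add: summand)
  qed
qed

text \<open>From here on a lattice is known only through its nodes and the map \<open>r\<close> from
  frequencies to residues.\<close>

lemma lattice_rule:
  fixes A :: "(nat \<Rightarrow> int) set"
  assumes "finite A" "A \<subseteq> freqs d" "\<And>h k. h \<in> A \<Longrightarrow> 2 * \<bar>h k\<bar> \<le> int B" "card A ^ 2 * B < m"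
  obtains x and r :: "(nat \<Rightarrow> int) \<Rightarrow> int" where
    "\<And>i. x i \<in> cube d" "inj_on r A"
    "\<And>h k. (\<Sum>i<m. char_fun d k (x i) * cnj (char_fun d h (x i))) = (if r h = r k then of_nat m else 0)"
proof -
  obtain z where z: "inj_on (\<lambda>h. (\<Sum>k=1..d. h k * z k) mod int m) A"
    using exists_separating_lattice[of A d B m] assms by blast
  have "m > 0" using assms(4) by linarith
  show ?thesis
    by (rule that[of "lattice_node d m z", OF lattice_node_in_cube z])
       (rule sum_char_fun_lattice_node[OF \<open>m > 0\<close>])
qed

text \<open>Serves where the lattice merely replaces integration; its size is then immaterial, so a
  crude bound on all entries is enough.\<close>

lemma lattice_rule_exists:
  fixes A :: "(nat \<Rightarrow> int) set"
  assumes "finite A" "A \<subseteq> freqs d"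
  obtains m x and r :: "(nat \<Rightarrow> int) \<Rightarrow> int" where
    "m > 0" "\<And>i. x i \<in> cube d" "inj_on r A"
    "\<And>h k. (\<Sum>i<m. char_fun d k (x i) * cnj (char_fun d h (x i))) = (if r h = r k then of_nat m else 0)"
proof -
  define B where "B = (\<Sum>h\<in>A. \<Sum>k=1..d. nat (2 * \<bar>h k\<bar>))"
  have B: "2 * \<bar>h k\<bar> \<le> int B" if h: "h \<in> A" for h k
  proof (cases "k \<in> {1..d}")
    case True
    have "nat (2 * \<bar>h k\<bar>) \<le> (\<Sum>k=1..d. nat (2 * \<bar>h k\<bar>))"
      using True by (intro member_le_sum) auto
    also have "\<dots> \<le> B" unfolding B_def using h assms(1)
      by (intro member_le_sum[of h A "\<lambda>h. \<Sum>k=1..d. nat (2 * \<bar>h k\<bar>)"]) auto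
    finally show ?thesis by linarith
  next
    case False
    then have "h k = 0" using h assms(2) by (auto simp: freqs_def)
    then show ?thesis by simp
  qed
  obtain x r where "\<And>i. x i \<in> cube d" "inj_on (r :: (nat \<Rightarrow> int) \<Rightarrow> int) A"
    "\<And>h k. (\<Sum>i<Suc (card A ^ 2 * B). char_fun d k (x i) * cnj (char_fun d h (x i))) =
       (if r h = r k then of_nat (Suc (card A ^ 2 * B)) else 0)"
    using lattice_rule[of A d B "Suc (card A ^ 2 * B)"] assms B by blast
  then show ?thesis using that[of "Suc (card A ^ 2 * B)" x r] by simp
qed

section \<open>Absolutely convergent Fourier series\<close>

lemma norm_char_fun [simp]: "cmod (char_fun d h x) = 1"
  by (simp add: char_fun_eq_cis)

lemma has_sum_sum:
  fixes f :: "'i \<Rightarrow> 'a \<Rightarrow> 'b :: topological_comm_monoid_add"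
  assumes "\<And>i. i \<in> I \<Longrightarrow> (f i has_sum S i) A"
  shows "((\<lambda>x. \<Sum>i\<in>I. f i x) has_sum (\<Sum>i\<in>I. S i)) A"
  using assms by (induction I rule: infinite_finite_induct) (auto intro: has_sum_add)

lemma has_sum_fseries:
  assumes "(\<lambda>h. cmod (c h)) summable_on freqs d"
  shows "((\<lambda>h. c h * char_fun d h x) has_sum fseries d c x) (freqs d)"
  unfolding fseries_def
  by (rule has_sum_infsum, rule abs_summable_summable) (use assms in \<open>simp add: norm_mult\<close>)

lemma norm_fseries_le:
  assumes "(\<lambda>h. cmod (c h)) summable_on freqs d"
  shows "cmod (fseries d c x) \<le> infsum (\<lambda>h. cmod (c h)) (freqs d)"
  using norm_infsum_bound[of "\<lambda>h. c h * char_fun d h x" "freqs d"] assms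
  by (simp add: fseries_def norm_mult)

text \<open>The aliasing identity: sampling cannot tell apart frequencies with the same residue, so
  their coefficients are added up.\<close>

lemma lattice_average_fseries:
  fixes r :: "(nat \<Rightarrow> int) \<Rightarrow> int"
  assumes "(\<lambda>h. cmod (c h)) summable_on freqs d" "m > 0"
    and "\<And>h k. (\<Sum>i<m. char_fun d k (x i) * cnj (char_fun d h (x i))) = (if r h = r k then of_nat m else 0)"
  shows "(\<Sum>i<m. fseries d c (x i) * cnj (char_fun d h (x i))) / of_nat m = infsum c {k \<in> freqs d. r k = r h}"
proof -
  have "((\<lambda>k. \<Sum>i<m. c k * char_fun d k (x i) * cnj (char_fun d h (x i))) has_sum
      (\<Sum>i<m. fseries d c (x i) * cnj (char_fun d h (x i)))) (freqs d)"
    by (intro has_sum_sum has_sum_cmult_left has_sum_fseries assms)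
  also have "(\<lambda>k. \<Sum>i<m. c k * char_fun d k (x i) * cnj (char_fun d h (x i))) =
      (\<lambda>k. c k * (if r h = r k then of_nat m else 0))"
    by (simp add: mult.assoc flip: sum_distrib_left assms(3))
  finally have "((\<lambda>k. c k * (if r h = r k then of_nat m else 0) / of_nat m) has_sum
     (\<Sum>i<m. fseries d c (x i) * cnj (char_fun d h (x i))) / of_nat m) (freqs d)"
    by (rule has_sum_divide_const)
  then have "(c has_sum (\<Sum>i<m. fseries d c (x i) * cnj (char_fun d h (x i))) / of_nat m) {k \<in> freqs d. r k = r h}"
    by (rule has_sum_cong_neutral[THEN iffD1, rotated -1]) (use assms(2) in auto)
  then show ?thesis by (simp add: infsumI)
qed

text \<open>\<open>h\<close> is the only member of \<open>A\<close> in its residue class, so the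
  rest of the class lies outside \<open>A\<close>.\<close>

lemma lattice_average_aliasing:
  fixes r :: "(nat \<Rightarrow> int) \<Rightarrow> int"
  assumes c: "(\<lambda>h. cmod (c h)) summable_on freqs d" and "m > 0"
    and "\<And>h k. (\<Sum>i<m. char_fun d k (x i) * cnj (char_fun d h (x i))) = (if r h = r k then of_nat m else 0)"
    and "A \<subseteq> freqs d" "inj_on r A" "h \<in> A"
  shows "cmod (c h - (\<Sum>i<m. fseries d c (x i) * cnj (char_fun d h (x i))) / of_nat m)
     \<le> infsum (\<lambda>k. cmod (c k)) {k \<in> freqs d - A. r k = r h}"
proof -
  let ?D = "{k \<in> freqs d - A. r k = r h}"
  have eq: "{k \<in> freqs d. r k = r h} = insert h ?D"
    using assms(4-6) by (auto dest: inj_onD)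
  have sD: "(\<lambda>k. cmod (c k)) summable_on ?D"
    by (rule summable_on_subset[OF c]) auto
  then have "c summable_on ?D" by (rule abs_summable_summable)
  then have "infsum c {k \<in> freqs d. r k = r h} = c h + infsum c ?D"
    unfolding eq using assms(6) by (subst infsum_insert) auto
  then have "c h - (\<Sum>i<m. fseries d c (x i) * cnj (char_fun d h (x i))) / of_nat m = - infsum c ?D"
    using lattice_average_fseries[OF assms(1-3)] by simp
  then show ?thesis using norm_infsum_bound[of c ?D] sD by simp
qed

text \<open>Since \<open>r\<close> is injective on \<open>A\<close>, every frequency outside \<open>A\<close> is aliased to at most one
  frequency of \<open>A\<close>, so aliasing costs no more than truncation.\<close>

lemma lattice_algorithm_error:
  fixes r :: "(nat \<Rightarrow> int) \<Rightarrow> int"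
  assumes c: "(\<lambda>h. cmod (c h)) summable_on freqs d" and "m > 0"
    and "\<And>h k. (\<Sum>i<m. char_fun d k (x i) * cnj (char_fun d h (x i))) = (if r h = r k then of_nat m else 0)"
    and A: "A \<subseteq> freqs d" "inj_on r A" "finite A"
  shows "cmod (fseries d c y - (\<Sum>h\<in>A. (\<Sum>i<m. fseries d c (x i) * cnj (char_fun d h (x i))) / of_nat m * char_fun d h y))
     \<le> 2 * infsum (\<lambda>k. cmod (c k)) (freqs d - A)"
proof -
  let ?T = "infsum (\<lambda>k. cmod (c k)) (freqs d - A)"
  let ?q = "\<lambda>h. (\<Sum>i<m. fseries d c (x i) * cnj (char_fun d h (x i))) / of_nat m"
  let ?g = "\<lambda>h. c h * char_fun d h y"
  have sT: "(\<lambda>k. cmod (c k)) summable_on D" if "D \<subseteq> freqs d" for D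
    using c that by (rule summable_on_subset)
  have sg: "?g summable_on D" if "D \<subseteq> freqs d" for D
    by (rule abs_summable_summable) (use sT[OF that] in \<open>simp add: norm_mult\<close>)
  have "fseries d c y = infsum ?g (A \<union> (freqs d - A))"
    using A by (simp add: fseries_def Un_absorb1)
  also have "\<dots> = sum ?g A + infsum ?g (freqs d - A)"
    using A sg by (subst infsum_Un_disjoint) auto
  finally have "fseries d c y - (\<Sum>h\<in>A. ?q h * char_fun d h y) =
      infsum ?g (freqs d - A) + (\<Sum>h\<in>A. (c h - ?q h) * char_fun d h y)"
    by (simp add: left_diff_distrib sum_subtractf)
  then have "cmod (fseries d c y - (\<Sum>h\<in>A. ?q h * char_fun d h y)) \<le>
      cmod (infsum ?g (freqs d - A)) + cmod (\<Sum>h\<in>A. (c h - ?q h) * char_fun d h y)"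
    by (simp only: norm_triangle_ineq)
  moreover have "cmod (infsum ?g (freqs d - A)) \<le> ?T"
    using norm_infsum_bound[of ?g "freqs d - A"] sT[OF Diff_subset[of _ A]] by (simp add: norm_mult)
  moreover have "cmod (\<Sum>h\<in>A. (c h - ?q h) * char_fun d h y) \<le> ?T"
  proof -
    have "cmod (\<Sum>h\<in>A. (c h - ?q h) * char_fun d h y) \<le> (\<Sum>h\<in>A. cmod ((c h - ?q h) * char_fun d h y))"
      by (rule norm_sum)
    also have "\<dots> \<le> (\<Sum>h\<in>A. infsum (\<lambda>k. cmod (c k)) {k \<in> freqs d - A. r k = r h})"
      unfolding norm_mult norm_char_fun mult_1_right
      by (rule sum_mono) (rule lattice_average_aliasing[OF assms(1-5)])
    also have "\<dots> = infsum (\<lambda>k. cmod (c k)) (\<Union>h\<in>A. {k \<in> freqs d - A. r k = r h})"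
      using A by (intro sum_infsum) (auto intro!: sT simp: inj_on_eq_iff)
    also have "\<dots> \<le> ?T"
      by (rule infsum_mono2) (use A in \<open>auto intro!: sT\<close>)
    finally show ?thesis .
  qed
  ultimately show ?thesis by linarith
qed

text \<open>If \<open>A\<close> carries all but \<open>e\<close> of the joint mass of both families,
  the lattice averages, which depend on the function only, are so close to both coefficients that
  these differ by at most \<open>e\<close>. This gives the definite description in
  \<open>Hnorm\<close> its meaning.\<close>

lemma fseries_inj:
  assumes c: "(\<lambda>h. cmod (c h)) summable_on freqs d" "(\<lambda>h. cmod (c' h)) summable_on freqs d"
    and eq: "fseries d c = fseries d c'" and h: "h \<in> freqs d"
  shows "c h = c' h"
proof -
  have "cmod (c h - c' h) \<le> e" if e: "e > 0" for e
  proof -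
    let ?g = "\<lambda>h. cmod (c h) + cmod (c' h)"
    have sg: "?g summable_on freqs d" using c by (rule summable_on_add)
    obtain F where F: "finite F" "F \<subseteq> freqs d" "dist (sum ?g F) (infsum ?g (freqs d)) \<le> e"
      using infsum_finite_approximation[OF sg e] by blast
    define A where "A = insert h F"
    have A: "finite A" "A \<subseteq> freqs d" "h \<in> A" "F \<subseteq> A" using F h by (auto simp: A_def)
    obtain m x and r :: "(nat \<Rightarrow> int) \<Rightarrow> int" where
      m: "m > 0" "\<And>i. x i \<in> cube d" "inj_on r A"
      "\<And>h k. (\<Sum>i<m. char_fun d k (x i) * cnj (char_fun d h (x i))) = (if r h = r k then of_nat m else 0)"
      using lattice_rule_exists[OF A(1,2)] by blast
    let ?D = "{k \<in> freqs d - A. r k = r h}"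
    have "cmod (c h - c' h) \<le> infsum (\<lambda>k. cmod (c k)) ?D + infsum (\<lambda>k. cmod (c' k)) ?D"
      using lattice_average_aliasing[OF c(1) m(1,4) A(2) m(3) A(3)]
            lattice_average_aliasing[OF c(2) m(1,4) A(2) m(3) A(3)]
      unfolding eq by norm
    also have "\<dots> = infsum ?g ?D"
      by (rule infsum_add[symmetric]) (auto intro: summable_on_subset[OF c(1)] summable_on_subset[OF c(2)])
    also have "\<dots> \<le> infsum ?g (freqs d - F)"
      by (rule infsum_mono2) (use A in \<open>auto intro: summable_on_subset[OF sg]\<close>)
    also have "\<dots> = infsum ?g (freqs d) - sum ?g F"
      using F by (subst infsum_Diff) (auto intro: sg)
    also have "\<dots> \<le> e" using F(3) by (simp add: dist_real_def)
    finally show ?thesis .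
  qed
  then have "cmod (c h - c' h) \<le> 0" using field_le_epsilon[of "cmod (c h - c' h)" 0] by simp
  then show ?thesis by simp
qed

section \<open>The weighted Korobov space\<close>

text \<open>One lower bound \<open>\<beta>\<close> of the exponents is fixed, so that all constants
  below are uniform in the coordinate.\<close>

locale korobov =
  fixes \<omega> :: real and a b :: "nat \<Rightarrow> real" and \<beta> :: real
  assumes \<omega>: "0 < \<omega>" "\<omega> < 1"
    and a1: "0 < a 1" and a_Suc: "\<And>j. 1 \<le> j \<Longrightarrow> a j \<le> a (Suc j)"
    and \<beta>: "0 < \<beta>" and b_ge: "\<And>i. 1 \<le> i \<Longrightarrow> \<beta> \<le> b i"
begin

definition x :: "nat \<Rightarrow> real" where
  "x k = - ln \<omega> * a k"

lemma a_mono: "1 \<le> i \<Longrightarrow> i \<le> j \<Longrightarrow> a i \<le> a j"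
proof (induction j)
  case (Suc j)
  show ?case
  proof (cases "i = Suc j")
    case False
    then have "a i \<le> a j" "1 \<le> j" using Suc by auto
    then show ?thesis using a_Suc[of j] by linarith
  qed simp
qed simp

lemma x_mono: "1 \<le> i \<Longrightarrow> i \<le> j \<Longrightarrow> x i \<le> x j"
  using \<omega> a_mono by (simp add: x_def mult_left_mono_neg)

lemma x_1_pos: "0 < x 1"
  using \<omega> a1 by (simp add: x_def mult_neg_pos)

lemma x_pos: "1 \<le> k \<Longrightarrow> 0 < x k"
  using x_mono[of 1 k] x_1_pos by simp

lemma a_pos: "1 \<le> k \<Longrightarrow> 0 < a k"
  using a_mono[of 1 k] a1 by simp

lemma b_pos: "1 \<le> k \<Longrightarrow> 0 < b k"
  using b_ge[of k] \<beta> by simp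

definition S :: "nat \<Rightarrow> real \<Rightarrow> real" where
  "S d \<tau> = (\<Prod>k=1..d. theta (\<tau> * x k) (b k))"

abbreviation w :: "nat \<Rightarrow> (nat \<Rightarrow> int) \<Rightarrow> real" where
  "w d h \<equiv> wt \<omega> a b d h"

lemma has_sum_w_powr: "0 < \<tau> \<Longrightarrow> ((\<lambda>h. w d h powr \<tau>) has_sum S d \<tau>) (freqs d)"
  unfolding S_def x_def by (intro has_sum_wt_powr) (auto simp: \<omega> a_pos b_pos)

lemma w_pos: "0 < w d h"
  using \<omega> by (simp add: wt_def)

lemma w_eq_exp: "w d h = exp (- (\<Sum>k=1..d. x k * \<bar>real_of_int (h k)\<bar> powr b k))"
proof -
  have "ln \<omega> * (\<Sum>k=1..d. a k * \<bar>real_of_int (h k)\<bar> powr b k) =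
      - (\<Sum>k=1..d. x k * \<bar>real_of_int (h k)\<bar> powr b k)"
    unfolding sum_distrib_left sum_negf[symmetric] by (rule sum.cong) (auto simp: x_def)
  then show ?thesis using \<omega> by (simp add: wt_def powr_def mult.commute)
qed

lemma w_le_1: "w d h \<le> 1"
proof -
  have "0 \<le> (\<Sum>k=1..d. x k * \<bar>real_of_int (h k)\<bar> powr b k)"
    using x_pos by (intro sum_nonneg mult_nonneg_nonneg) (auto simp: less_imp_le)
  then show ?thesis by (simp add: w_eq_exp)
qed

lemma has_sum_w: "(w d has_sum S d 1) (freqs d)"
  by (rule has_sum_cong[THEN iffD1, OF _ has_sum_w_powr]) (auto simp: w_pos less_imp_le)

lemma summable_w: "D \<subseteq> freqs d \<Longrightarrow> w d summable_on D"
  by (rule summable_on_subset[OF has_sum_imp_summable[OF has_sum_w]])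

lemma S_ge_1: "0 < \<tau> \<Longrightarrow> 1 \<le> S d \<tau>"
  unfolding S_def by (intro prod_ge_1 theta_ge_1) (auto simp: x_pos b_pos)

text \<open>Cauchy-Schwarz with the factor \<open>sqrt (w d h)\<close> inserted. The finite form
  comes first because it also proves absolute summability.\<close>

lemma sum_norm_coefs_le:
  assumes "c \<in> coefs \<omega> a b d" "finite F" "F \<subseteq> D" "D \<subseteq> freqs d"
  shows "(\<Sum>h\<in>F. cmod (c h)) \<le> sqrt (cnorm2 \<omega> a b d c) * sqrt (infsum (w d) D)"
proof -
  have s: "(\<lambda>h. (cmod (c h))\<^sup>2 / w d h) summable_on freqs d" using assms by (simp add: coefs_def)
  have "(\<Sum>h\<in>F. cmod (c h)) = (\<Sum>h\<in>F. \<bar>cmod (c h) / sqrt (w d h)\<bar> * \<bar>sqrt (w d h)\<bar>)"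
    using w_pos[of d] by (intro sum.cong) (auto simp: less_imp_le less_imp_neq[symmetric])
  also have "\<dots> \<le> L2_set (\<lambda>h. cmod (c h) / sqrt (w d h)) F * L2_set (\<lambda>h. sqrt (w d h)) F"
    by (rule L2_set_mult_ineq)
  also have "\<dots> = sqrt (\<Sum>h\<in>F. (cmod (c h))\<^sup>2 / w d h) * sqrt (\<Sum>h\<in>F. w d h)"
    using w_pos[of d] by (simp add: L2_set_def power_divide less_imp_le)
  also have "\<dots> \<le> sqrt (cnorm2 \<omega> a b d c) * sqrt (infsum (w d) D)"
    unfolding cnorm2_def
    by (intro mult_mono real_sqrt_le_mono finite_sum_le_infsum s summable_w)
       (use assms w_pos[of d] in \<open>auto intro!: infsum_nonneg sum_nonneg divide_nonneg_nonneg simp: less_imp_le\<close>)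
  finally show ?thesis .
qed

lemma summable_norm_coefs:
  assumes "c \<in> coefs \<omega> a b d" "D \<subseteq> freqs d"
  shows "(\<lambda>h. cmod (c h)) summable_on D"
proof (rule nonneg_bdd_above_summable_on)
  show "bdd_above (sum (\<lambda>h. cmod (c h)) ` {F. F \<subseteq> D \<and> finite F})"
  proof (rule bdd_aboveI2)
    fix F assume "F \<in> {F. F \<subseteq> D \<and> finite F}"
    then have "F \<subseteq> D" "finite F" by auto
    then show "(\<Sum>h\<in>F. cmod (c h)) \<le> sqrt (cnorm2 \<omega> a b d c) * sqrt (infsum (w d) D)"
      using sum_norm_coefs_le[of c d F D] assms by blast
  qed
qed simp

lemma infsum_norm_coefs_le:
  assumes "c \<in> coefs \<omega> a b d" "D \<subseteq> freqs d"
  shows "infsum (\<lambda>h. cmod (c h)) D \<le> sqrt (cnorm2 \<omega> a b d c) * sqrt (infsum (w d) D)"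
  by (rule infsum_le_finite_sums[OF summable_norm_coefs[OF assms]])
     (rule sum_norm_coefs_le[OF assms(1) _ _ assms(2)])

lemma Hnorm_fseries:
  assumes "c \<in> coefs \<omega> a b d"
  shows "Hnorm \<omega> a b d (fseries d c) = sqrt (cnorm2 \<omega> a b d c)"
proof -
  have "(THE c'. c' \<in> coefs \<omega> a b d \<and> fseries d c = fseries d c') = c"
  proof (rule the_equality)
    fix c' assume c': "c' \<in> coefs \<omega> a b d \<and> fseries d c = fseries d c'"
    show "c' = c"
    proof
      fix h
      show "c' h = c h"
      proof (cases "h \<in> freqs d")
        case True
        have "c' \<in> coefs \<omega> a b d" "fseries d c = fseries d c'" using c' by blast+
        from fseries_inj[OF summable_norm_coefs[OF assms order_refl]
            summable_norm_coefs[OF this(1) order_refl] this(2) True]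
        show ?thesis by (rule sym)
      next
        case False
        then show ?thesis using assms c' by (simp add: coefs_def)
      qed
    qed
  qed (simp add: assms)
  then show ?thesis by (simp add: Hnorm_def)
qed

lemma Hball_eq: "Hball \<omega> a b d = fseries d ` {c \<in> coefs \<omega> a b d. cnorm2 \<omega> a b d c \<le> 1}"
proof -
  have "Hnorm \<omega> a b d (fseries d c) \<le> 1 \<longleftrightarrow> cnorm2 \<omega> a b d c \<le> 1" if "c \<in> coefs \<omega> a b d" for c
    unfolding Hnorm_fseries[OF that] by simp
  then show ?thesis unfolding Hball_def Hsp_def by blast
qed

lemma norm_fseries_le_Hnorm:
  assumes "c \<in> coefs \<omega> a b d"
  shows "cmod (fseries d c y) \<le> sqrt (cnorm2 \<omega> a b d c) * sqrt (S d 1)"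
  by (rule order_trans[OF norm_fseries_le[OF summable_norm_coefs[OF assms order_refl]]])
     (rule infsum_norm_coefs_le[OF assms order_refl, unfolded infsumI[OF has_sum_w]])

section \<open>Initial error, and comparison of information classes and error criteria\<close>

text \<open>\<open>S d 1\<close> is the value of the kernel on the diagonal. Lower bounds on
  \<open>n\<close> need only this direction: it limits the tolerance under the normalised
  criterion.\<close>

lemma init_err_le: "init_err \<omega> a b d \<le> ereal (sqrt (S d 1))"
  unfolding init_err_def
proof (intro SUP_least)
  fix f y assume "f \<in> Hball \<omega> a b d"
  then obtain c where c: "c \<in> coefs \<omega> a b d" "cnorm2 \<omega> a b d c \<le> 1" "f = fseries d c"
    by (auto simp: Hball_eq)
  have "cmod (f y) \<le> sqrt (cnorm2 \<omega> a b d c) * sqrt (S d 1)"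
    using c norm_fseries_le_Hnorm by simp
  also have "\<dots> \<le> 1 * sqrt (S d 1)"
    using c S_ge_1[of 1 d] by (intro mult_right_mono) auto
  finally show "ereal (cmod (f y)) \<le> ereal (sqrt (S d 1))" by simp
qed

lemma finite_support_coefs:
  assumes "finite B" "B \<subseteq> freqs d" "\<And>h. h \<notin> B \<Longrightarrow> c h = 0"
  shows "c \<in> coefs \<omega> a b d" "cnorm2 \<omega> a b d c = (\<Sum>h\<in>B. (cmod (c h))\<^sup>2 / w d h)"
    "fseries d c y = (\<Sum>h\<in>B. c h * char_fun d h y)"
proof -
  have 1: "((\<lambda>h. (cmod (c h))\<^sup>2 / w d h) has_sum (\<Sum>h\<in>B. (cmod (c h))\<^sup>2 / w d h)) (freqs d)"
    by (rule has_sum_finite_neutralI[OF assms(1,2) _ refl]) (simp add: assms(3))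
  show "c \<in> coefs \<omega> a b d"
    unfolding coefs_def using has_sum_imp_summable[OF 1] assms(2,3) by blast
  show "cnorm2 \<omega> a b d c = (\<Sum>h\<in>B. (cmod (c h))\<^sup>2 / w d h)"
    unfolding cnorm2_def by (rule infsumI[OF 1])
  show "fseries d c y = (\<Sum>h\<in>B. c h * char_fun d h y)"
    unfolding fseries_def
    by (rule infsumI, rule has_sum_finite_neutralI[OF assms(1,2) _ refl]) (simp add: assms(3))
qed

lemma cube_nonempty: "(\<lambda>k\<in>{1..d}. 0) \<in> cube d"
  by (auto simp: cube_def)

text \<open>The constant function 1 has norm 1. Hence the normalised tolerance is never below the
  absolute one.\<close>

lemma init_err_ge_1: "1 \<le> init_err \<omega> a b d"
proof -
  define c :: "(nat \<Rightarrow> int) \<Rightarrow> complex" where "c h = (if h = (\<lambda>_. 0) then 1 else 0)" for h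
  have c: "c \<in> coefs \<omega> a b d" "cnorm2 \<omega> a b d c = 1" "fseries d c y = 1" for y
    using finite_support_coefs[of "{\<lambda>_. 0}" d c] \<omega>
    by (auto simp: c_def freqs_def wt_def char_fun_def)
  have "fseries d c \<in> Hball \<omega> a b d" using c by (auto simp: Hball_eq)
  then have "(SUP y\<in>cube d. ereal (cmod (fseries d c y))) \<le> init_err \<omega> a b d"
    unfolding init_err_def by (rule SUP_upper)
  moreover have "ereal (cmod (fseries d c (\<lambda>k\<in>{1..d}. 0))) \<le> (SUP y\<in>cube d. ereal (cmod (fseries d c y)))"
    by (rule SUP_upper[OF cube_nonempty])
  ultimately have "ereal (cmod (fseries d c (\<lambda>k\<in>{1..d}. 0))) \<le> init_err \<omega> a b d"
    by (rule order_trans[rotated])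
  then show ?thesis by (simp add: c one_ereal_def)
qed

text \<open>Point evaluations are bounded on the space, with norm at most
  \<open>sqrt (S d 1)\<close>.\<close>

lemma Lam_std_subset_all: "Lam Lstd \<omega> a b d \<subseteq> Lam Lall \<omega> a b d"
proof
  fix L assume "L \<in> Lam Lstd \<omega> a b d"
  then obtain y where y: "L = (\<lambda>f. f y)" by (auto simp: Lam_def)
  have "cmod (f y) \<le> sqrt (S d 1) * Hnorm \<omega> a b d f" if "f \<in> Hsp \<omega> a b d" for f
    using that norm_fseries_le_Hnorm Hnorm_fseries by (auto simp: Hsp_def mult.commute)
  then show "L \<in> Lam Lall \<omega> a b d" by (auto simp: Lam_def y)
qed

lemma good_n_weaken:
  assumes "good_n cl cr \<omega> a b \<epsilon> d n" "cl' = cl \<or> cl = Lstd" "cr' = cr \<or> cr = ABS" "0 < \<epsilon>"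
  shows "good_n cl' cr' \<omega> a b \<epsilon> d n"
proof -
  have "Lam cl \<omega> a b d \<subseteq> Lam cl' \<omega> a b d"
    using assms(2) Lam_std_subset_all by (cases cl'; cases cl) auto
  then have "min_err cl' \<omega> a b d n \<le> min_err cl \<omega> a b d n"
    unfolding min_err_def by (intro INF_superset_mono) auto
  also have "\<dots> \<le> ereal \<epsilon> * CRI cr \<omega> a b d"
    using assms(1) by (simp add: good_n_def)
  also have "\<dots> \<le> ereal \<epsilon> * CRI cr' \<omega> a b d"
  proof (rule ereal_mult_left_mono)
    show "CRI cr \<omega> a b d \<le> CRI cr' \<omega> a b d"
      using assms(3) init_err_ge_1[of d] by (cases cr; cases cr') (auto simp: CRI_def)
  qed (use assms(4) in simp)
  finally show ?thesis by (simp add: good_n_def)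
qed

section \<open>Upper bound for function values\<close>

lemma min_err_std_le:
  assumes A: "finite A" "A \<subseteq> freqs d" and B: "\<And>h k. h \<in> A \<Longrightarrow> 2 * \<bar>h k\<bar> \<le> int B" "card A ^ 2 * B < m"
  shows "min_err Lstd \<omega> a b d m \<le> ereal (2 * sqrt (infsum (w d) (freqs d - A)))"
proof -
  obtain y and r :: "(nat \<Rightarrow> int) \<Rightarrow> int" where
    y: "\<And>i. y i \<in> cube d" "inj_on r A"
    "\<And>h k. (\<Sum>i<m. char_fun d k (y i) * cnj (char_fun d h (y i))) = (if r h = r k then of_nat m else 0)"
    using lattice_rule[of A d B m] A B by blast
  have m: "m > 0" using B(2) by linarith
  define L :: "nat \<Rightarrow> ((nat \<Rightarrow> real) \<Rightarrow> complex) \<Rightarrow> complex" where "L i f = f (y i)" for i f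
  \<comment> \<open>The output is the trigonometric polynomial on \<open>A\<close> whose
    coefficients are the discrete Fourier coefficients of the samples.\<close>
  define \<phi> :: "(nat \<Rightarrow> complex) \<Rightarrow> (nat \<Rightarrow> real) \<Rightarrow> complex" where
    "\<phi> q u = (\<Sum>h\<in>A. (\<Sum>i<m. q i * cnj (char_fun d h (y i))) / of_nat m * char_fun d h u)" for q u
  have L: "L i \<in> Lam Lstd \<omega> a b d" for i
    using y(1)[of i] by (auto simp: Lam_def L_def fun_eq_iff)
  have "min_err Lstd \<omega> a b d m \<le> alg_err \<omega> a b d m L \<phi>"
    unfolding min_err_def by (rule INF_lower2[of "(L, \<phi>)"]) (use L in auto)
  also have "\<dots> \<le> ereal (2 * sqrt (infsum (w d) (freqs d - A)))"
    unfolding alg_err_def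
  proof (intro SUP_least)
    fix f u assume "f \<in> Hball \<omega> a b d"
    then obtain c where c: "c \<in> coefs \<omega> a b d" "cnorm2 \<omega> a b d c \<le> 1" and f: "f = fseries d c"
      by (auto simp: Hball_eq)
    have "f u - \<phi> (\<lambda>i. if i < m then L i f else 0) u =
      fseries d c u - (\<Sum>h\<in>A. (\<Sum>i<m. fseries d c (y i) * cnj (char_fun d h (y i))) / of_nat m * char_fun d h u)"
      by (simp add: \<phi>_def L_def f)
    then have "cmod (f u - \<phi> (\<lambda>i. if i < m then L i f else 0) u) \<le> 2 * infsum (\<lambda>k. cmod (c k)) (freqs d - A)"
      using lattice_algorithm_error[OF summable_norm_coefs[OF c(1) order_refl] m y(3) A(2) y(2) A(1)] by simp
    also have "\<dots> \<le> 2 * (sqrt (cnorm2 \<omega> a b d c) * sqrt (infsum (w d) (freqs d - A)))"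
      using infsum_norm_coefs_le[OF c(1) Diff_subset] by simp
    also have "\<dots> \<le> 2 * (1 * sqrt (infsum (w d) (freqs d - A)))"
      using c(2) w_pos by (intro mult_left_mono mult_right_mono) (auto intro!: infsum_nonneg simp: less_imp_le)
    finally show "ereal (cmod (f u - \<phi> (\<lambda>i. if i < m then L i f else 0) u)) \<le>
        ereal (2 * sqrt (infsum (w d) (freqs d - A)))" by simp
  qed
  finally show ?thesis .
qed

definition level_set :: "nat \<Rightarrow> real \<Rightarrow> (nat \<Rightarrow> int) set" where
  "level_set d \<eta> = {h \<in> freqs d. \<eta> \<le> w d h}"

text \<open>Markov's inequality for the \<open>\<tau>\<close>-th powers of the weights, first on
  finite subsets, since finiteness itself is to be shown.\<close>

lemma level_set_finite:
  assumes "0 < \<eta>" "0 < \<tau>"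
  shows "finite (level_set d \<eta>)" "real (card (level_set d \<eta>)) * \<eta> powr \<tau> \<le> S d \<tau>"
proof -
  have le: "real (card F) * \<eta> powr \<tau> \<le> S d \<tau>" if F: "finite F" "F \<subseteq> level_set d \<eta>" for F
  proof -
    have "real (card F) * \<eta> powr \<tau> = (\<Sum>h\<in>F. \<eta> powr \<tau>)" by simp
    also have "\<dots> \<le> (\<Sum>h\<in>F. w d h powr \<tau>)"
      using F assms by (intro sum_mono powr_mono2) (auto simp: level_set_def)
    also have "\<dots> \<le> S d \<tau>"
      using F by (intro finite_sum_le_has_sum[OF has_sum_w_powr[OF assms(2)]]) (auto simp: level_set_def)
    finally show ?thesis .
  qed
  show fin: "finite (level_set d \<eta>)"
  proof (rule ccontr)
    assume inf: "infinite (level_set d \<eta>)"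
    obtain F where F: "F \<subseteq> level_set d \<eta>" "finite F" "card F = Suc (nat \<lceil>S d \<tau> / \<eta> powr \<tau>\<rceil>)"
      using infinite_arbitrarily_large[OF inf] by blast
    have "S d \<tau> / \<eta> powr \<tau> < real (card F)" unfolding F(3) by linarith
    then have "S d \<tau> < real (card F) * \<eta> powr \<tau>" using assms by (simp add: field_simps)
    then show False using le F by fastforce
  qed
  show "real (card (level_set d \<eta>)) * \<eta> powr \<tau> \<le> S d \<tau>" using le fin by blast
qed

text \<open>Together with \<open>h\<close> the set contains all
  \<open>2 * \<bar>h k\<bar> + 1\<close> vectors supported on coordinate \<open>k\<close> with an
  entry of absolute value at most \<open>\<bar>h k\<bar>\<close>. So the cardinality alone controls
  the entries, whatever the exponents \<open>b\<close> are.\<close>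

lemma level_set_component_le:
  assumes "0 < \<eta>" "h \<in> level_set d \<eta>"
  shows "2 * \<bar>h k\<bar> \<le> int (card (level_set d \<eta>) - 1)"
proof (cases "k \<in> {1..d}")
  case k: True
  define g where "g j = (\<lambda>_. 0 :: int)(k := j)" for j :: int
  have "g ` {-\<bar>h k\<bar>..\<bar>h k\<bar>} \<subseteq> level_set d \<eta>"
  proof
    fix q assume "q \<in> g ` {-\<bar>h k\<bar>..\<bar>h k\<bar>}"
    then obtain j where "j \<in> {-\<bar>h k\<bar>..\<bar>h k\<bar>}" and j: "q = g j" by blast
    then have "\<bar>j\<bar> \<le> \<bar>h k\<bar>" by auto
    have "(\<Sum>i=1..d. x i * \<bar>real_of_int (q i)\<bar> powr b i) \<le> (\<Sum>i=1..d. x i * \<bar>real_of_int (h i)\<bar> powr b i)"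
    proof (rule sum_mono)
      fix i assume i: "i \<in> {1..d}"
      have "\<bar>real_of_int (q i)\<bar> \<le> \<bar>real_of_int (h i)\<bar>"
        using j \<open>\<bar>j\<bar> \<le> \<bar>h k\<bar>\<close> by (auto simp: g_def)
      then show "x i * \<bar>real_of_int (q i)\<bar> powr b i \<le> x i * \<bar>real_of_int (h i)\<bar> powr b i"
        using i x_pos[of i] b_pos[of i] by (intro mult_left_mono powr_mono2) auto
    qed
    then have "w d h \<le> w d q" by (simp add: w_eq_exp)
    then show "q \<in> level_set d \<eta>" using assms j k by (auto simp: level_set_def freqs_def g_def)
  qed
  moreover have "inj_on g {-\<bar>h k\<bar>..\<bar>h k\<bar>}" by (rule inj_onI) (metis g_def fun_upd_same)
  ultimately have "card {-\<bar>h k\<bar>..\<bar>h k\<bar>} \<le> card (level_set d \<eta>)"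
    using level_set_finite(1)[OF assms(1), of 1] by (metis card_image card_mono zero_less_one)
  then show ?thesis by simp
next
  case False
  then show ?thesis using assms by (auto simp: level_set_def freqs_def)
qed

text \<open>Write a weight as the product of its powers \<open>1 - \<tau>\<close> and
  \<open>\<tau>\<close>; outside the level set the first factor is at most
  \<open>\<eta> powr (1 - \<tau>)\<close>.\<close>

lemma infsum_w_minus_level_set_le:
  assumes "0 < \<eta>" "0 < \<tau>" "\<tau> < 1"
  shows "infsum (w d) (freqs d - level_set d \<eta>) \<le> \<eta> powr (1 - \<tau>) * S d \<tau>"
proof -
  have s: "((\<lambda>h. \<eta> powr (1 - \<tau>) * w d h powr \<tau>) has_sum \<eta> powr (1 - \<tau>) * S d \<tau>) (freqs d)"
    by (intro has_sum_cmult_right has_sum_w_powr assms)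
  have "infsum (w d) (freqs d - level_set d \<eta>) \<le> infsum (\<lambda>h. \<eta> powr (1 - \<tau>) * w d h powr \<tau>) (freqs d)"
  proof (rule infsum_mono_neutral)
    fix h assume "h \<in> (freqs d - level_set d \<eta>) \<inter> freqs d"
    then have h: "w d h \<le> \<eta>" by (auto simp: level_set_def)
    have "w d h = w d h powr (1 - \<tau>) * w d h powr \<tau>"
      using w_pos[of d h] by (simp flip: powr_add)
    also have "\<dots> \<le> \<eta> powr (1 - \<tau>) * w d h powr \<tau>"
      using h assms w_pos[of d h] by (intro mult_right_mono powr_mono2) auto
    finally show "w d h \<le> \<eta> powr (1 - \<tau>) * w d h powr \<tau>" .
  qed (use s summable_w has_sum_imp_summable in auto)
  then show ?thesis using infsumI[OF s] by simp
qed

text \<open>The size of a level set and the tail sum outside it are both controlled by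
  the sum of the \<open>\<tau>\<close>-th powers of the weights; \<open>\<eta>\<close> is chosen so that the lattice algorithm has error \<open>\<epsilon>\<close>.\<close>

lemma exists_good_n:
  assumes \<epsilon>: "0 < \<epsilon>" "\<epsilon> < 1" and \<tau>: "0 < \<tau>" "\<tau> < 1"
  shows "\<exists>n\<ge>1. good_n Lstd ABS \<omega> a b \<epsilon> d n \<and>
    ln (real n) \<le> 6 / (1 - \<tau>) * (ln (S d \<tau>) + \<tau> * (1 + ln (1 / \<epsilon>)))"
proof -
  define T where "T = S d \<tau>"
  have T: "1 \<le> T" using S_ge_1 \<tau> by (simp add: T_def)
  \<comment> \<open>\<open>Q\<close> solves \<open>2 * sqrt (Q * T) = \<epsilon>\<close>, where 2 is
    the cost of truncation plus aliasing.\<close>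
  define Q where "Q = \<epsilon>\<^sup>2 / (4 * T)"
  define \<eta> where "\<eta> = Q powr (1 / (1 - \<tau>))"
  have Q: "0 < Q" using \<epsilon> T by (simp add: Q_def)
  have \<eta>: "0 < \<eta>" using Q by (simp add: \<eta>_def)
  have "\<epsilon>\<^sup>2 \<le> 1" using \<epsilon> by (simp add: power_le_one)
  then have "Q \<le> 1" using T by (simp add: Q_def)
  then have \<eta>1: "\<eta> \<le> 1" unfolding \<eta>_def using Q \<tau> by (intro powr_le1) auto
  have \<eta>p: "\<eta> powr (1 - \<tau>) = Q" using Q \<tau> by (simp add: \<eta>_def powr_powr)
  have "ln Q = ln (\<epsilon>\<^sup>2) - ln (4 * T)" unfolding Q_def using \<epsilon> T by (simp add: ln_divide_pos)
  also have "\<dots> = 2 * ln \<epsilon> - ln 4 - ln T" using \<epsilon> T by (simp add: ln_mult ln_realpow)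
  finally have ln\<eta>: "ln \<eta> = (2 * ln \<epsilon> - ln 4 - ln T) / (1 - \<tau>)"
    unfolding \<eta>_def using Q by (simp add: ln_powr)
  define A where "A = level_set d \<eta>"
  define N where "N = card A"
  have fin: "finite A" and card: "real N * \<eta> powr \<tau> \<le> T"
    using level_set_finite[OF \<eta> \<tau>(1)] by (auto simp: A_def T_def N_def)
  have "w d (\<lambda>_. 0) = 1" by (simp add: w_eq_exp)
  then have "(\<lambda>_. 0) \<in> A" using \<eta>1 by (auto simp: A_def level_set_def freqs_def)
  then have N: "1 \<le> N" using fin by (auto simp: N_def Suc_le_eq card_gt_0_iff)
  \<comment> \<open>At most \<open>N ^ 2\<close> differences have entries bounded by
    \<open>N - 1\<close>, so \<open>N ^ 3\<close> nodes exceed the number of excluded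
    residues.\<close>
  have "min_err Lstd \<omega> a b d (N ^ 3) \<le> ereal (2 * sqrt (infsum (w d) (freqs d - A)))"
  proof (rule min_err_std_le[OF fin])
    show "2 * \<bar>h k\<bar> \<le> int (N - 1)" if "h \<in> A" for h k
      using level_set_component_le[OF \<eta>] that by (simp add: A_def N_def)
    have "N\<^sup>2 * (N - 1) < N\<^sup>2 * N" using N by simp
    then show "card A ^ 2 * (N - 1) < N ^ 3" by (simp add: N_def power2_eq_square power3_eq_cube)
  qed (auto simp: A_def level_set_def)
  also have "\<dots> \<le> ereal (2 * sqrt (\<eta> powr (1 - \<tau>) * T))"
    using infsum_w_minus_level_set_le[OF \<eta> \<tau>] by (simp add: A_def T_def)
  also have "2 * sqrt (\<eta> powr (1 - \<tau>) * T) = \<epsilon>"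
    unfolding \<eta>p Q_def using T \<epsilon> by (simp add: real_sqrt_divide)
  finally have good: "good_n Lstd ABS \<omega> a b \<epsilon> d (N ^ 3)" by (simp add: good_n_def CRI_def)
  have "ln (real N) + \<tau> * ln \<eta> = ln (real N * \<eta> powr \<tau>)"
    using N \<eta> by (simp add: ln_mult ln_powr)
  also have "\<dots> \<le> ln T" using card N \<eta> T by (subst ln_le_cancel_iff) auto
  finally have "ln (real N) \<le> ln T - \<tau> * ln \<eta>" by simp
  also have "\<dots> = (ln T + \<tau> * (2 * ln (1 / \<epsilon>) + ln 4)) / (1 - \<tau>)"
    unfolding ln\<eta> using \<tau> \<epsilon> by (simp add: field_simps ln_div)
  also have "\<dots> \<le> (2 * (ln T + \<tau> * (1 + ln (1 / \<epsilon>)))) / (1 - \<tau>)"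
  proof (rule divide_right_mono)
    have "ln (4::real) = 2 * ln 2" using ln_realpow[of 2 2] by simp
    then have "ln (4::real) \<le> 2" using ln_2_less_1 by simp
    then have "\<tau> * (2 * ln (1 / \<epsilon>) + ln 4) \<le> \<tau> * (2 * ln (1 / \<epsilon>) + 2)"
      using \<tau> by (intro mult_left_mono) auto
    moreover have "0 \<le> ln T" using T by simp
    ultimately show "ln T + \<tau> * (2 * ln (1 / \<epsilon>) + ln 4) \<le> 2 * (ln T + \<tau> * (1 + ln (1 / \<epsilon>)))"
      by (simp add: algebra_simps)
  qed (use \<tau> in auto)
  finally have lnN: "ln (real N) \<le> (2 * (ln T + \<tau> * (1 + ln (1 / \<epsilon>)))) / (1 - \<tau>)" .
  \<comment> \<open>The 6 is 3 from the cube times 2 from the square of \<open>\<epsilon>\<close>;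
    the 1 next to \<open>ln (1 / \<epsilon>)\<close> has absorbed \<open>ln 4 <= 2\<close>.\<close>
  have "ln (real (N ^ 3)) = 3 * ln (real N)" by (simp add: ln_realpow)
  also have "\<dots> \<le> 3 * ((2 * (ln T + \<tau> * (1 + ln (1 / \<epsilon>)))) / (1 - \<tau>))"
    using lnN by (rule mult_left_mono) simp
  also have "\<dots> = 6 / (1 - \<tau>) * (ln T + \<tau> * (1 + ln (1 / \<epsilon>)))" by simp
  finally have "ln (real (N ^ 3)) \<le> 6 / (1 - \<tau>) * (ln T + \<tau> * (1 + ln (1 / \<epsilon>)))" .
  moreover have "1 \<le> N ^ 3" using N by simp
  ultimately show ?thesis using good unfolding T_def by blast
qed

lemma exists_good_n_any:
  assumes "0 < \<epsilon>" "\<epsilon> < 1"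
  shows "\<exists>n. good_n cl cr \<omega> a b \<epsilon> d n"
proof -
  obtain n where "good_n Lstd ABS \<omega> a b \<epsilon> d n"
    using exists_good_n[OF assms, of "1/2"] by auto
  then show ?thesis using good_n_weaken[of Lstd ABS] assms by blast
qed

lemma ln_nstar_le:
  assumes \<epsilon>: "0 < \<epsilon>" "\<epsilon> < 1" and \<tau>: "0 < \<tau>" "\<tau> < 1"
  shows "ln (real (nstar cl cr \<omega> a b \<epsilon> d)) \<le> 6 / (1 - \<tau>) * (ln (S d \<tau>) + \<tau> * (1 + ln (1 / \<epsilon>)))"
proof -
  obtain n where n: "1 \<le> n" "good_n Lstd ABS \<omega> a b \<epsilon> d n"
    "ln (real n) \<le> 6 / (1 - \<tau>) * (ln (S d \<tau>) + \<tau> * (1 + ln (1 / \<epsilon>)))"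
    using exists_good_n[OF assms] by blast
  have "good_n cl cr \<omega> a b \<epsilon> d n" using good_n_weaken[OF n(2)] \<epsilon> by blast
  then have "nstar cl cr \<omega> a b \<epsilon> d \<le> n" unfolding nstar_def by (rule Least_le)
  \<comment> \<open>If \<open>nstar\<close> is 0, its logarithm is 0 by convention, and
    \<open>n >= 1\<close> keeps the right side nonnegative.\<close>
  then have "ln (real (nstar cl cr \<omega> a b \<epsilon> d)) \<le> ln (real n)"
    using n(1) by (cases "nstar cl cr \<omega> a b \<epsilon> d = 0") auto
  then show ?thesis using n(3) by linarith
qed

lemma ln_S: "0 < \<tau> \<Longrightarrow> ln (S d \<tau>) = (\<Sum>k=1..d. ln (theta (\<tau> * x k) (b k)))"
  unfolding S_def
proof (rule ln_prod)
  fix k assume "k \<in> {1..d}" and "0 < \<tau>"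
  then have "1 \<le> theta (\<tau> * x k) (b k)" using x_pos b_pos by (intro theta_ge_1) auto
  then show "theta (\<tau> * x k) (b k) \<noteq> 0" by simp
qed simp

end

section \<open>Orthonormal systems in the kernel of linear functionals\<close>

text \<open>Gaussian elimination: an unknown \<open>g\<close> with nonzero coefficient in equation
  \<open>k\<close> is eliminated from the other equations.\<close>

lemma homogeneous_system_solution:
  fixes M :: "nat \<Rightarrow> 'a \<Rightarrow> complex"
  assumes "finite B" "k < card B"
  shows "\<exists>v. (\<exists>h\<in>B. v h \<noteq> 0) \<and> (\<forall>i<k. (\<Sum>h\<in>B. M i h * v h) = 0)"
  using assms
proof (induction k arbitrary: B M)
  case 0
  then have "B \<noteq> {}" by auto
  then show ?case by (intro exI[of _ "\<lambda>_. 1"]) auto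
next
  case (Suc k)
  show ?case
  proof (cases "\<forall>h\<in>B. M k h = 0")
    case True
    obtain v where v: "\<exists>h\<in>B. v h \<noteq> 0" "\<And>i. i < k \<Longrightarrow> (\<Sum>h\<in>B. M i h * v h) = 0"
      using Suc.IH[of B M] Suc.prems by auto
    show ?thesis using v True by (intro exI[of _ v]) (auto simp: less_Suc_eq)
  next
    case False
    then obtain g where g: "g \<in> B" "M k g \<noteq> 0" by blast
    define B' where "B' = B - {g}"
    have B': "finite B'" "k < card B'" "g \<notin> B'" using Suc.prems g by (auto simp: B'_def)
    define M' where "M' i h = M i h - M i g * (M k h / M k g)" for i h
    obtain v where v: "\<exists>h\<in>B'. v h \<noteq> 0" "\<And>i. i < k \<Longrightarrow> (\<Sum>h\<in>B'. M' i h * v h) = 0"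
      using Suc.IH[of B' M'] B' by auto
    \<comment> \<open>Back substitution: the value at \<open>g\<close> is the one that makes
      equation \<open>k\<close> hold.\<close>
    define u where "u = v(g := - (\<Sum>h\<in>B'. M k h * v h) / M k g)"
    have split: "(\<Sum>h\<in>B. M i h * u h) = M i g * u g + (\<Sum>h\<in>B'. M i h * v h)" for i
    proof -
      have "(\<Sum>h\<in>B. M i h * u h) = M i g * u g + (\<Sum>h\<in>B'. M i h * u h)"
        unfolding B'_def using Suc.prems g by (intro sum.remove) auto
      moreover have "(\<Sum>h\<in>B'. M i h * u h) = (\<Sum>h\<in>B'. M i h * v h)"
        using B' by (intro sum.cong) (auto simp: u_def)
      ultimately show ?thesis by simp
    qed
    have "(\<Sum>h\<in>B. M i h * u h) = 0" if "i < Suc k" for i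
    proof (cases "i = k")
      case True
      show ?thesis unfolding split True using g by (simp add: u_def)
    next
      case False
      have "(\<Sum>h\<in>B. M i h * u h) = (\<Sum>h\<in>B'. M i h * v h) - M i g * ((\<Sum>h\<in>B'. M k h * v h) / M k g)"
        unfolding split by (simp add: u_def)
      also have "\<dots> = (\<Sum>h\<in>B'. M' i h * v h)"
      proof -
        have "M i g * ((\<Sum>h\<in>B'. M k h * v h) / M k g) = (\<Sum>h\<in>B'. M i g * (M k h / M k g) * v h)"
          by (simp add: sum_distrib_left sum_divide_distrib mult_ac)
        then show ?thesis unfolding M'_def left_diff_distrib sum_subtractf by simp
      qed
      also have "\<dots> = 0" using v that False by auto
      finally show ?thesis .
    qed
    moreover have "\<exists>h\<in>B. u h \<noteq> 0"
    proof -
      obtain h where h: "h \<in> B'" "v h \<noteq> 0" using v by blast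
      then have "h \<in> B" "u h = v h" using B' by (auto simp: B'_def u_def)
      then show ?thesis using h(2) by (intro bexI[of _ h]) simp_all
    qed
    ultimately show ?thesis by blast
  qed
qed

definition orthonormal_on :: "'a set \<Rightarrow> nat \<Rightarrow> (nat \<Rightarrow> 'a \<Rightarrow> complex) \<Rightarrow> bool" where
  "orthonormal_on B r v \<longleftrightarrow>
     (\<forall>j<r. \<forall>l<r. (\<Sum>h\<in>B. v j h * cnj (v l h)) = (if j = l then 1 else 0))"

lemma sum_mult_cnj_eq: "(\<Sum>h\<in>B. u h * cnj (u h)) = complex_of_real (\<Sum>h\<in>B. (cmod (u h))\<^sup>2)"
  by (simp only: of_real_sum complex_norm_square)

text \<open>Instead of projecting as in Gram-Schmidt, orthogonality to the \<open>r\<close> vectors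
  already found is imposed by \<open>r\<close> further linear equations; there are still more
  unknowns than equations.\<close>

lemma exists_orthonormal_kernel:
  fixes M :: "nat \<Rightarrow> 'a \<Rightarrow> complex"
  assumes "finite B" "n + r \<le> card B"
  shows "\<exists>v. orthonormal_on B r v \<and> (\<forall>j<r. \<forall>i<n. (\<Sum>h\<in>B. M i h * v j h) = 0)"
  using assms(2)
proof (induction r)
  case 0
  then show ?case by (simp add: orthonormal_on_def)
next
  case (Suc r)
  then obtain v where v: "orthonormal_on B r v" "\<And>j i. j < r \<Longrightarrow> i < n \<Longrightarrow> (\<Sum>h\<in>B. M i h * v j h) = 0"
    by auto
  define N where "N i = (if i < n then M i else (\<lambda>h. cnj (v (i - n) h)))" for i
  obtain u where u: "\<exists>h\<in>B. u h \<noteq> 0" "\<And>i. i < n + r \<Longrightarrow> (\<Sum>h\<in>B. N i h * u h) = 0"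
    using homogeneous_system_solution[of B "n + r" N] assms(1) Suc.prems by auto
  define s where "s = (\<Sum>h\<in>B. (cmod (u h))\<^sup>2)"
  have s: "s > 0" unfolding s_def using u(1) assms(1) by (auto intro!: sum_pos2)
  define q where "q h = u h / complex_of_real (sqrt s)" for h
  have qM: "(\<Sum>h\<in>B. M i h * q h) = 0" if "i < n" for i
    using u(2)[of i] that by (simp add: q_def N_def flip: sum_divide_distrib)
  have qv: "(\<Sum>h\<in>B. q h * cnj (v j h)) = 0" if "j < r" for j
    using u(2)[of "n + j"] that by (simp add: q_def N_def mult.commute flip: sum_divide_distrib)
  have vq: "(\<Sum>h\<in>B. v j h * cnj (q h)) = 0" if "j < r" for j
  proof -
    have "(\<Sum>h\<in>B. v j h * cnj (q h)) = cnj (\<Sum>h\<in>B. q h * cnj (v j h))"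
      by (simp add: mult.commute)
    then show ?thesis using qv[OF that] by simp
  qed
  have "(\<Sum>h\<in>B. (cmod (q h))\<^sup>2) = s / s"
    using s by (simp add: q_def norm_divide power_divide s_def flip: sum_divide_distrib)
  then have qq: "(\<Sum>h\<in>B. q h * cnj (q h)) = 1"
    unfolding sum_mult_cnj_eq using s by simp
  have "orthonormal_on B (Suc r) (v(r := q))"
    using v(1) qv vq qq by (auto simp: orthonormal_on_def less_Suc_eq)
  moreover have "\<forall>j<Suc r. \<forall>i<n. (\<Sum>h\<in>B. M i h * (v(r := q)) j h) = 0"
    using v(2) qM by (auto simp: less_Suc_eq)
  ultimately show ?case by blast
qed

lemma orthonormal_on_norm_sum:
  assumes "orthonormal_on B r v"
  shows "(\<Sum>h\<in>B. (cmod (\<Sum>j<r. t j * v j h))\<^sup>2) = (\<Sum>j<r. (cmod (t j))\<^sup>2)"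
proof -
  have "complex_of_real (\<Sum>h\<in>B. (cmod (\<Sum>j<r. t j * v j h))\<^sup>2) =
      (\<Sum>h\<in>B. (\<Sum>j<r. t j * v j h) * cnj (\<Sum>l<r. t l * v l h))"
    by (rule sum_mult_cnj_eq[symmetric])
  also have "\<dots> = (\<Sum>h\<in>B. \<Sum>j<r. \<Sum>l<r. t j * cnj (t l) * (v j h * cnj (v l h)))"
    by (simp add: sum_product mult_ac)
  also have "\<dots> = (\<Sum>j<r. \<Sum>h\<in>B. \<Sum>l<r. t j * cnj (t l) * (v j h * cnj (v l h)))"
    by (rule sum.swap)
  also have "\<dots> = (\<Sum>j<r. \<Sum>l<r. \<Sum>h\<in>B. t j * cnj (t l) * (v j h * cnj (v l h)))"
    by (intro sum.cong refl sum.swap)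
  also have "\<dots> = (\<Sum>j<r. \<Sum>l<r. t j * cnj (t l) * (if j = l then 1 else 0))"
    using assms by (intro sum.cong refl) (auto simp: orthonormal_on_def simp flip: sum_distrib_left)
  also have "\<dots> = (\<Sum>j<r. t j * cnj (t j))"
    by (intro sum.cong refl) (simp add: if_distrib sum.delta cong: if_cong)
  also have "\<dots> = complex_of_real (\<Sum>j<r. (cmod (t j))\<^sup>2)" by (rule sum_mult_cnj_eq)
  finally show ?thesis by (simp only: of_real_eq_iff)
qed

text \<open>Test the isometry with the coefficients \<open>cnj (v j h)\<close>: the combination has
  squared norm \<open>s\<close> and entry \<open>s\<close> at \<open>h\<close>, hence
  \<open>s ^ 2 <= s\<close>.\<close>

lemma orthonormal_on_bessel:
  assumes "orthonormal_on B r v" "finite B" "h \<in> B"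
  shows "(\<Sum>j<r. (cmod (v j h))\<^sup>2) \<le> 1"
proof -
  define s where "s = (\<Sum>j<r. (cmod (v j h))\<^sup>2)"
  have s: "0 \<le> s" by (simp add: s_def sum_nonneg)
  have "(\<Sum>j<r. cnj (v j h) * v j h) = complex_of_real s"
    unfolding s_def of_real_sum complex_norm_square by (simp only: mult.commute)
  then have "s\<^sup>2 = (cmod (\<Sum>j<r. cnj (v j h) * v j h))\<^sup>2" by simp
  also have "\<dots> \<le> (\<Sum>g\<in>B. (cmod (\<Sum>j<r. cnj (v j h) * v j g))\<^sup>2)"
    using assms(2,3) by (intro member_le_sum[of h B "\<lambda>g. (cmod (\<Sum>j<r. cnj (v j h) * v j g))\<^sup>2"]) auto
  also have "\<dots> = s" unfolding orthonormal_on_norm_sum[OF assms(1)] by (simp add: s_def)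
  finally have "s * s \<le> 1 * s" by (simp add: power2_eq_square)
  then show ?thesis using s unfolding s_def[symmetric] by (cases "s = 0") (auto simp: mult_le_cancel_right)
qed

text \<open>The trace of an orthogonal projection equals its rank.\<close>

lemma orthonormal_on_card:
  assumes "orthonormal_on B r v"
  shows "(\<Sum>h\<in>B. \<Sum>j<r. (cmod (v j h))\<^sup>2) = real r"
proof -
  have "(\<Sum>h\<in>B. (cmod (v j h))\<^sup>2) = 1" if "j < r" for j
  proof -
    have "complex_of_real (\<Sum>h\<in>B. (cmod (v j h))\<^sup>2) = (\<Sum>h\<in>B. v j h * cnj (v j h))"
      by (rule sum_mult_cnj_eq[symmetric])
    also have "\<dots> = complex_of_real 1" using assms that by (simp add: orthonormal_on_def)
    finally show ?thesis by (simp only: of_real_eq_iff)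
  qed
  then show ?thesis by (subst sum.swap) simp
qed

text \<open>Averaging over the nodes is exact for products of characters from \<open>B\<close>,
  which replaces Parseval's identity on the cube.\<close>

lemma lattice_parseval:
  fixes r :: "(nat \<Rightarrow> int) \<Rightarrow> int"
  assumes "inj_on r B"
    "\<And>h k. (\<Sum>i<m. char_fun d k (y i) * cnj (char_fun d h (y i))) = (if r h = r k then of_nat m else 0)"
    "finite B"
  shows "(\<Sum>i<m. (cmod (\<Sum>h\<in>B. c h * char_fun d h (y i)))\<^sup>2) = real m * (\<Sum>h\<in>B. (cmod (c h))\<^sup>2)"
proof -
  let ?e = "\<lambda>h i. char_fun d h (y i)"
  have "complex_of_real (\<Sum>i<m. (cmod (\<Sum>h\<in>B. c h * ?e h i))\<^sup>2) =
      (\<Sum>i<m. (\<Sum>h\<in>B. c h * ?e h i) * cnj (\<Sum>k\<in>B. c k * ?e k i))"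
    by (rule sum_mult_cnj_eq[symmetric])
  also have "\<dots> = (\<Sum>i<m. \<Sum>h\<in>B. \<Sum>k\<in>B. c h * cnj (c k) * (?e h i * cnj (?e k i)))"
    by (simp add: sum_product mult_ac)
  also have "\<dots> = (\<Sum>h\<in>B. \<Sum>i<m. \<Sum>k\<in>B. c h * cnj (c k) * (?e h i * cnj (?e k i)))"
    by (rule sum.swap)
  also have "\<dots> = (\<Sum>h\<in>B. \<Sum>k\<in>B. \<Sum>i<m. c h * cnj (c k) * (?e h i * cnj (?e k i)))"
    by (intro sum.cong refl sum.swap)
  also have "\<dots> = (\<Sum>h\<in>B. \<Sum>k\<in>B. c h * cnj (c k) * (if h = k then of_nat m else 0))"
    using assms(1) by (intro sum.cong refl) (auto simp: assms(2) inj_on_eq_iff simp flip: sum_distrib_left)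
  also have "\<dots> = (\<Sum>h\<in>B. of_nat m * (c h * cnj (c h)))"
    using assms(3) by (intro sum.cong refl) (simp add: if_distrib sum.delta mult_ac cong: if_cong)
  also have "\<dots> = complex_of_real (real m * (\<Sum>h\<in>B. (cmod (c h))\<^sup>2))"
    by (simp only: of_real_mult of_real_sum complex_norm_square sum_distrib_left of_real_of_nat_eq)
  finally show ?thesis by (simp only: of_real_eq_iff)
qed

section \<open>Lower bound for arbitrary linear information\<close>

context korobov
begin

text \<open>The characters scaled to norm 1; they are orthonormal in the space, so norms of
  combinations become plain square sums.\<close>

abbreviation nchar :: "nat \<Rightarrow> (nat \<Rightarrow> int) \<Rightarrow> (nat \<Rightarrow> real) \<Rightarrow> complex" where
  "nchar d h y \<equiv> complex_of_real (sqrt (w d h)) * char_fun d h y"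

lemma nchar_combination:
  assumes "finite B" "B \<subseteq> freqs d"
  shows "(\<lambda>y. \<Sum>h\<in>B. v h * nchar d h y) \<in> Hsp \<omega> a b d"
    "(\<Sum>h\<in>B. (cmod (v h))\<^sup>2) \<le> 1 \<Longrightarrow> (\<lambda>y. \<Sum>h\<in>B. v h * nchar d h y) \<in> Hball \<omega> a b d"
proof -
  define c where "c h = (if h \<in> B then v h * complex_of_real (sqrt (w d h)) else 0)" for h
  have eq: "(\<lambda>y. \<Sum>h\<in>B. v h * nchar d h y) = fseries d c"
    using finite_support_coefs(3)[OF assms, of c] by (auto simp: c_def fun_eq_iff intro!: sum.cong)
  have c: "c \<in> coefs \<omega> a b d" using finite_support_coefs(1)[OF assms, of c] by (auto simp: c_def)
  have "cnorm2 \<omega> a b d c = (\<Sum>h\<in>B. (cmod (c h))\<^sup>2 / w d h)"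
    using finite_support_coefs(2)[OF assms, of c] by (auto simp: c_def)
  also have "\<dots> = (\<Sum>h\<in>B. (cmod (v h))\<^sup>2)"
    using w_pos[of d]
    by (intro sum.cong) (auto simp: c_def norm_mult power_mult_distrib less_imp_le less_imp_neq[symmetric])
  finally have n: "cnorm2 \<omega> a b d c = (\<Sum>h\<in>B. (cmod (v h))\<^sup>2)" .
  show "(\<lambda>y. \<Sum>h\<in>B. v h * nchar d h y) \<in> Hsp \<omega> a b d"
    unfolding eq Hsp_def using c by blast
  show "(\<lambda>y. \<Sum>h\<in>B. v h * nchar d h y) \<in> Hball \<omega> a b d" if "(\<Sum>h\<in>B. (cmod (v h))\<^sup>2) \<le> 1"
    unfolding eq Hball_eq using c n that by auto
qed

lemma Lam_all_combination:
  assumes "L \<in> Lam Lall \<omega> a b d" "finite B" "B \<subseteq> freqs d"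
  shows "L (\<lambda>y. \<Sum>h\<in>B. v h * nchar d h y) = (\<Sum>h\<in>B. L (nchar d h) * v h)"
  using assms(2,3)
proof (induction B rule: finite_induct)
  case empty
  have "(\<lambda>y. \<Sum>h\<in>{}. v h * nchar d h y) \<in> Hsp \<omega> a b d" by (rule nchar_combination) auto
  then have z: "(\<lambda>_. 0) \<in> Hsp \<omega> a b d" by simp
  have "\<forall>f\<in>Hsp \<omega> a b d. \<forall>\<alpha>. L (\<lambda>y. \<alpha> * f y) = \<alpha> * L f"
    using assms(1) by (simp add: Lam_def)
  from spec[OF bspec[OF this z], of 0] show ?case by simp
next
  case (insert g B)
  have 1: "(\<lambda>y. \<Sum>h\<in>B. v h * nchar d h y) \<in> Hsp \<omega> a b d" using insert by (intro nchar_combination) auto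
  have 2: "(\<lambda>y. v g * nchar d g y) \<in> Hsp \<omega> a b d"
    using nchar_combination(1)[of "{g}" d v] insert by simp
  have 3: "nchar d g \<in> Hsp \<omega> a b d"
    using nchar_combination(1)[of "{g}" d "\<lambda>_. 1"] insert by simp
  have "L (\<lambda>y. v g * nchar d g y + (\<Sum>h\<in>B. v h * nchar d h y)) =
      L (\<lambda>y. v g * nchar d g y) + L (\<lambda>y. \<Sum>h\<in>B. v h * nchar d h y)"
    using assms(1) 1 2 by (simp add: Lam_def)
  also have "L (\<lambda>y. v g * nchar d g y) = v g * L (nchar d g)"
    using assms(1) 3 unfolding Lam_def by simp
  finally show ?case using insert by (simp add: mult.commute)
qed

text \<open>One output value must be within \<open>e\<close> of both the function and its negative.
  The estimate is made homogeneous in \<open>u\<close> so that unnormalised combinations may be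
  inserted.\<close>

lemma alg_err_kernel_bound:
  assumes L: "\<And>i. i < n \<Longrightarrow> L i \<in> Lam Lall \<omega> a b d"
    and e: "alg_err \<omega> a b d n L \<phi> \<le> ereal e" "0 \<le> e"
    and B: "finite B" "B \<subseteq> freqs d" and y: "y \<in> cube d"
    and u: "\<And>i. i < n \<Longrightarrow> (\<Sum>h\<in>B. L i (nchar d h) * u h) = 0"
  shows "(cmod (\<Sum>h\<in>B. u h * nchar d h y))\<^sup>2 \<le> e\<^sup>2 * (\<Sum>h\<in>B. (cmod (u h))\<^sup>2)"
proof -
  have unit: "cmod (\<Sum>h\<in>B. u h * nchar d h y) \<le> e"
    if u: "\<And>i. i < n \<Longrightarrow> (\<Sum>h\<in>B. L i (nchar d h) * u h) = 0" and norm: "(\<Sum>h\<in>B. (cmod (u h))\<^sup>2) \<le> 1" for u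
  proof -
    let ?p = "\<phi> (\<lambda>i. 0) y"
    have bound: "cmod ((\<Sum>h\<in>B. s * u h * nchar d h y) - ?p) \<le> e" if s: "cmod s = 1" for s
    proof -
      let ?f = "\<lambda>y. \<Sum>h\<in>B. s * u h * nchar d h y"
      have f: "?f \<in> Hball \<omega> a b d"
        using norm s by (intro nchar_combination B) (simp add: norm_mult)
      have "L i ?f = 0" if "i < n" for i
      proof -
        have "L i ?f = s * (\<Sum>h\<in>B. L i (nchar d h) * u h)"
          using Lam_all_combination[OF L[OF that] B, of "\<lambda>h. s * u h"]
          by (simp add: sum_distrib_left mult_ac)
        then show ?thesis using u[OF that] by simp
      qed
      then have info: "(\<lambda>i. if i < n then L i ?f else 0) = (\<lambda>i. 0)" by auto
      have "ereal (cmod (?f y - \<phi> (\<lambda>i. if i < n then L i ?f else 0) y)) \<le> alg_err \<omega> a b d n L \<phi>"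
        unfolding alg_err_def by (rule SUP_upper2[OF f], rule SUP_upper[OF y])
      then have "ereal (cmod (?f y - ?p)) \<le> ereal e"
        unfolding info using e(1) by (rule order_trans)
      then show ?thesis by simp
    qed
    have "cmod ((\<Sum>h\<in>B. u h * nchar d h y) - ?p) \<le> e" using bound[of 1] by simp
    moreover have "cmod (- (\<Sum>h\<in>B. u h * nchar d h y) - ?p) \<le> e" using bound[of "-1"] by (simp add: sum_negf)
    moreover have "cmod z \<le> e" if "cmod (z - p) \<le> e" "cmod (- z - p) \<le> e" for z p
    proof -
      have "(z - p) - (- z - p) = 2 * z" by simp
      then have "2 * cmod z \<le> cmod (z - p) + cmod (- z - p)"
        using norm_triangle_ineq4[of "z - p" "- z - p"] by (simp only: norm_mult norm_numeral)
      then show ?thesis using that by simp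
    qed
    ultimately show ?thesis by blast
  qed
  define s where "s = (\<Sum>h\<in>B. (cmod (u h))\<^sup>2)"
  show ?thesis
  proof (cases "s = 0")
    case True
    then have "\<forall>h\<in>B. u h = 0" using B by (simp add: s_def sum_nonneg_eq_0_iff)
    then show ?thesis by simp
  next
    case False
    then have s: "s > 0" by (metis s_def sum_nonneg zero_le_power2 order_le_less)
    have "cmod (\<Sum>h\<in>B. (u h / complex_of_real (sqrt s)) * nchar d h y) \<le> e"
    proof (rule unit)
      fix i assume "i < n"
      then show "(\<Sum>h\<in>B. L i (nchar d h) * (u h / complex_of_real (sqrt s))) = 0"
        using u by (simp flip: sum_divide_distrib)
    next
      have "(\<Sum>h\<in>B. (cmod (u h / complex_of_real (sqrt s)))\<^sup>2) = s / s"
        using s by (simp add: norm_divide power_divide s_def flip: sum_divide_distrib)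
      then show "(\<Sum>h\<in>B. (cmod (u h / complex_of_real (sqrt s)))\<^sup>2) \<le> 1" using s by simp
    qed
    moreover have "(\<Sum>h\<in>B. (u h / complex_of_real (sqrt s)) * nchar d h y) = (\<Sum>h\<in>B. u h * nchar d h y) / complex_of_real (sqrt s)"
      by (simp add: sum_divide_distrib)
    ultimately have "cmod (\<Sum>h\<in>B. u h * nchar d h y) \<le> e * sqrt s"
      using s by (simp add: norm_divide divide_le_eq)
    then have "(cmod (\<Sum>h\<in>B. u h * nchar d h y))\<^sup>2 \<le> (e * sqrt s)\<^sup>2" by (intro power_mono) auto
    then show ?thesis using s by (simp add: power_mult_distrib s_def)
  qed
qed

text \<open>Functions in the kernel of the information cannot be told apart from their negatives.
  Averaging the squared pointwise bound over a lattice replaces integration over the cube, and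
  by Bessel's inequality \<open>n\<close> functionals remove at most \<open>n * \<theta>\<close> from the truncated trace.\<close>

lemma alg_err_lower_bound:
  assumes L: "\<And>i. i < n \<Longrightarrow> L i \<in> Lam Lall \<omega> a b d"
    and e: "alg_err \<omega> a b d n L \<phi> \<le> ereal e" "0 \<le> e"
    and B: "finite B" "B \<subseteq> freqs d" and \<theta>: "0 \<le> \<theta>"
  shows "(\<Sum>h\<in>B. min (w d h) \<theta>) - real n * \<theta> \<le> e\<^sup>2"
proof (cases "card B \<le> n")
  case True
  have "(\<Sum>h\<in>B. min (w d h) \<theta>) \<le> (\<Sum>h\<in>B. \<theta>)" by (intro sum_mono) auto
  also have "\<dots> \<le> real n * \<theta>" using True \<theta> by (simp add: mult_right_mono)
  finally show ?thesis using zero_le_power2[of e] by linarith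
next
  case False
  define r where "r = card B - n"
  have r: "n + r = card B" using False by (simp add: r_def)
  obtain v where v: "orthonormal_on B r v"
      "\<And>j i. j < r \<Longrightarrow> i < n \<Longrightarrow> (\<Sum>h\<in>B. L i (nchar d h) * v j h) = 0"
    using exists_orthonormal_kernel[OF B(1), of n r "\<lambda>i h. L i (nchar d h)"] r by auto
  define f where "f j y = (\<Sum>h\<in>B. v j h * nchar d h y)" for j y
  have f_le: "(\<Sum>j<r. (cmod (f j y))\<^sup>2) \<le> e\<^sup>2" if y: "y \<in> cube d" for y
  proof -
    define s where "s = (\<Sum>j<r. (cmod (f j y))\<^sup>2)"
    \<comment> \<open>\<open>u\<close> is extremal for evaluation at \<open>y\<close> among the
      combinations of the \<open>v j\<close>: it has squared norm \<open>s\<close> and value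
      \<open>s\<close> at \<open>y\<close>, so the kernel bound gives
      \<open>s <= e ^ 2\<close>.\<close>
    define u where "u h = (\<Sum>j<r. cnj (f j y) * v j h)" for h
    have "(cmod (\<Sum>h\<in>B. u h * nchar d h y))\<^sup>2 \<le> e\<^sup>2 * (\<Sum>h\<in>B. (cmod (u h))\<^sup>2)"
    proof (rule alg_err_kernel_bound[OF L e B y])
      fix i assume i: "i < n"
      have "(\<Sum>h\<in>B. L i (nchar d h) * u h) = (\<Sum>h\<in>B. \<Sum>j<r. cnj (f j y) * (L i (nchar d h) * v j h))"
        unfolding u_def sum_distrib_left by (intro sum.cong refl mult.left_commute)
      also have "\<dots> = (\<Sum>j<r. cnj (f j y) * (\<Sum>h\<in>B. L i (nchar d h) * v j h))"
        by (subst sum.swap) (simp add: sum_distrib_left)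
      finally show "(\<Sum>h\<in>B. L i (nchar d h) * u h) = 0" using v(2) i by simp
    qed auto
    also have "(\<Sum>h\<in>B. (cmod (u h))\<^sup>2) = s"
      unfolding u_def orthonormal_on_norm_sum[OF v(1)] by (simp add: s_def)
    also have "(\<Sum>h\<in>B. u h * nchar d h y) = (\<Sum>j<r. f j y * cnj (f j y))"
    proof -
      have "(\<Sum>h\<in>B. u h * nchar d h y) = (\<Sum>h\<in>B. \<Sum>j<r. cnj (f j y) * (v j h * nchar d h y))"
        unfolding u_def sum_distrib_right by (intro sum.cong refl mult.assoc)
      also have "\<dots> = (\<Sum>j<r. cnj (f j y) * f j y)"
        by (subst sum.swap) (simp add: sum_distrib_left f_def)
      finally show ?thesis by (simp add: mult.commute)
    qed
    also have "(\<Sum>j<r. f j y * cnj (f j y)) = complex_of_real s"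
      unfolding s_def by (rule sum_mult_cnj_eq)
    finally have "s * s \<le> e\<^sup>2 * s" by (simp add: power2_eq_square)
    moreover have "0 \<le> s" by (simp add: s_def sum_nonneg)
    ultimately have "s \<le> e\<^sup>2" by (cases "s = 0") (auto simp: mult_le_cancel_right)
    then show ?thesis by (simp add: s_def)
  qed
  obtain m y and \<rho> :: "(nat \<Rightarrow> int) \<Rightarrow> int" where
    m: "m > 0" "\<And>i. y i \<in> cube d" "inj_on \<rho> B"
    "\<And>h k. (\<Sum>i<m. char_fun d k (y i) * cnj (char_fun d h (y i))) = (if \<rho> h = \<rho> k then of_nat m else 0)"
    using lattice_rule_exists[OF B] by blast
  \<comment> \<open>\<open>P h\<close> is the squared length of the projection of the basis vector
    \<open>h\<close> onto the span of the \<open>v j\<close>; the deficits \<open>1 - P h\<close>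
    add up to \<open>n\<close>.\<close>
  define P where "P h = (\<Sum>j<r. (cmod (v j h))\<^sup>2)" for h
  have parseval: "(\<Sum>i<m. (cmod (f j (y i)))\<^sup>2) = real m * (\<Sum>h\<in>B. w d h * (cmod (v j h))\<^sup>2)" for j
  proof -
    have "f j z = (\<Sum>h\<in>B. (v j h * complex_of_real (sqrt (w d h))) * char_fun d h z)" for z
      by (simp add: f_def mult.assoc)
    then have "(\<Sum>i<m. (cmod (f j (y i)))\<^sup>2) = real m * (\<Sum>h\<in>B. (cmod (v j h * complex_of_real (sqrt (w d h))))\<^sup>2)"
      using lattice_parseval[OF m(3,4) B(1), of "\<lambda>h. v j h * complex_of_real (sqrt (w d h))"] by simp
    also have "(\<Sum>h\<in>B. (cmod (v j h * complex_of_real (sqrt (w d h))))\<^sup>2) = (\<Sum>h\<in>B. w d h * (cmod (v j h))\<^sup>2)"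
      using w_pos[of d] by (intro sum.cong) (auto simp: norm_mult power_mult_distrib less_imp_le)
    finally show ?thesis .
  qed
  have "real m * (\<Sum>h\<in>B. w d h * P h) = (\<Sum>j<r. real m * (\<Sum>h\<in>B. w d h * (cmod (v j h))\<^sup>2))"
  proof -
    have "(\<Sum>h\<in>B. w d h * P h) = (\<Sum>h\<in>B. \<Sum>j<r. w d h * (cmod (v j h))\<^sup>2)"
      by (simp add: P_def sum_distrib_left)
    also have "\<dots> = (\<Sum>j<r. \<Sum>h\<in>B. w d h * (cmod (v j h))\<^sup>2)" by (rule sum.swap)
    finally show ?thesis by (simp add: sum_distrib_left)
  qed
  also have "\<dots> = (\<Sum>j<r. \<Sum>i<m. (cmod (f j (y i)))\<^sup>2)" by (simp add: parseval)
  also have "\<dots> = (\<Sum>i<m. \<Sum>j<r. (cmod (f j (y i)))\<^sup>2)" by (rule sum.swap)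
  also have "\<dots> \<le> (\<Sum>i<m. e\<^sup>2)" using f_le m(2) by (intro sum_mono) auto
  finally have wP: "(\<Sum>h\<in>B. w d h * P h) \<le> e\<^sup>2" using m(1) by simp
  have P1: "P h \<le> 1" "0 \<le> P h" if "h \<in> B" for h
    using orthonormal_on_bessel[OF v(1) B(1) that] by (auto simp: P_def sum_nonneg)
  have "(\<Sum>h\<in>B. min (w d h) \<theta>) - real n * \<theta> = (\<Sum>h\<in>B. min (w d h) \<theta>) - (\<Sum>h\<in>B. \<theta> * (1 - P h))"
  proof -
    have "(\<Sum>h\<in>B. P h) = real r" unfolding P_def by (rule orthonormal_on_card[OF v(1)])
    then have "(\<Sum>h\<in>B. 1 - P h) = real n" using r by (simp add: sum_subtractf flip: r)
    then show ?thesis by (simp add: mult.commute flip: sum_distrib_left)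
  qed
  also have "\<dots> = (\<Sum>h\<in>B. min (w d h) \<theta> - \<theta> * (1 - P h))" by (simp add: sum_subtractf)
  also have "\<dots> \<le> (\<Sum>h\<in>B. w d h * P h)"
  proof (rule sum_mono)
    fix h assume h: "h \<in> B"
    \<comment> \<open>Split \<open>min (w d h) \<theta>\<close> in the proportions
      \<open>P h\<close> and \<open>1 - P h\<close>, and bound it by \<open>w d h\<close> in the
      first share and by \<open>\<theta>\<close> in the second.\<close>
    have "min (w d h) \<theta> * (1 - P h) \<le> \<theta> * (1 - P h)" "min (w d h) \<theta> * P h \<le> w d h * P h"
      using P1[OF h] by (auto intro!: mult_right_mono)
    then show "min (w d h) \<theta> - \<theta> * (1 - P h) \<le> w d h * P h" by (simp add: algebra_simps)
  qed
  finally show ?thesis using wP by linarith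
qed

text \<open>All classes and criteria reduce to the weakest requirement. The infimum over algorithms
  need not be attained, hence the slack \<open>\<delta>\<close> in the squared error.\<close>

lemma good_n_lower_bound_finite:
  assumes good: "good_n cl cr \<omega> a b \<epsilon> d n" and \<epsilon>: "0 < \<epsilon>"
    and B: "finite B" "B \<subseteq> freqs d" and \<theta>: "0 \<le> \<theta>"
  shows "(\<Sum>h\<in>B. min (w d h) \<theta>) - real n * \<theta> \<le> \<epsilon>\<^sup>2 * S d 1"
proof (rule field_le_epsilon)
  fix \<delta> :: real assume \<delta>: "0 < \<delta>"
  have "good_n cl NOR \<omega> a b \<epsilon> d n"
    by (rule good_n_weaken[OF good]) (use \<epsilon> in \<open>cases cr; simp\<close>)+
  then have "good_n Lall NOR \<omega> a b \<epsilon> d n"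
    by (rule good_n_weaken) (use \<epsilon> in \<open>cases cl; simp\<close>)+
  then have "min_err Lall \<omega> a b d n \<le> ereal \<epsilon> * init_err \<omega> a b d"
    by (simp add: good_n_def CRI_def)
  also have "\<dots> \<le> ereal \<epsilon> * ereal (sqrt (S d 1))"
    using init_err_le \<epsilon> by (intro ereal_mult_left_mono) auto
  finally have me: "min_err Lall \<omega> a b d n \<le> ereal (\<epsilon> * sqrt (S d 1))" by simp
  define E where "E = \<epsilon> * sqrt (S d 1)"
  have E: "0 \<le> E" "E\<^sup>2 = \<epsilon>\<^sup>2 * S d 1" using \<epsilon> S_ge_1[of 1 d] by (auto simp: E_def power_mult_distrib)
  define e where "e = sqrt (E\<^sup>2 + \<delta>)"
  have "0 \<le> E\<^sup>2 + \<delta>" using \<delta> by (simp add: add_nonneg_pos less_imp_le)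
  then have e: "0 \<le> e" "e\<^sup>2 = E\<^sup>2 + \<delta>" unfolding e_def by (simp_all only: real_sqrt_ge_zero real_sqrt_pow2)
  have "E < e" unfolding e_def using E \<delta> by (intro real_less_rsqrt) auto
  then have "min_err Lall \<omega> a b d n < ereal e" using me by (metis E_def ereal_less_le less_ereal.simps(1) order_le_less_trans)
  then obtain L \<phi> where L: "\<And>i. i < n \<Longrightarrow> L i \<in> Lam Lall \<omega> a b d" and "alg_err \<omega> a b d n L \<phi> < ereal e"
    unfolding min_err_def INF_less_iff by auto
  then have "(\<Sum>h\<in>B. min (w d h) \<theta>) - real n * \<theta> \<le> e\<^sup>2"
    using alg_err_lower_bound[of n L d \<phi> e B \<theta>] L e(1) B \<theta> less_imp_le by blast
  then show "(\<Sum>h\<in>B. min (w d h) \<theta>) - real n * \<theta> \<le> \<epsilon>\<^sup>2 * S d 1 + \<delta>" using e E by simp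
qed

end

section \<open>Elementary asymptotics\<close>

text \<open>Young's inequality with an additive constant: up to the threshold
  \<open>(1 / \<eta>) powr (1 / (1 - \<rho>))\<close> the constant suffices, beyond it the linear
  term does.\<close>

lemma powr_le_linear:
  fixes \<rho> \<eta> Z :: real
  assumes "0 \<le> \<rho>" "\<rho> < 1" "0 < \<eta>" "0 < Z"
  shows "Z powr \<rho> \<le> \<eta> * Z + (1 / \<eta>) powr (\<rho> / (1 - \<rho>))"
proof (cases "Z \<le> (1 / \<eta>) powr (1 / (1 - \<rho>))")
  case True
  then have "Z powr \<rho> \<le> ((1 / \<eta>) powr (1 / (1 - \<rho>))) powr \<rho>"
    using assms by (intro powr_mono2) auto
  also have "\<dots> = (1 / \<eta>) powr (\<rho> / (1 - \<rho>))" by (simp add: powr_powr)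
  finally show ?thesis using assms by (simp add: add_increasing)
next
  case False
  then have "((1 / \<eta>) powr (1 / (1 - \<rho>))) powr (1 - \<rho>) \<le> Z powr (1 - \<rho>)"
    using assms by (intro powr_mono2) auto
  then have "1 / \<eta> \<le> Z powr (1 - \<rho>)" using assms by (simp add: powr_powr)
  then have "1 \<le> \<eta> * Z powr (1 - \<rho>)" using assms by (simp add: field_simps)
  then have "Z powr \<rho> * 1 \<le> Z powr \<rho> * (\<eta> * Z powr (1 - \<rho>))" by (intro mult_left_mono) auto
  also have "\<dots> = \<eta> * Z" using assms by (simp add: mult_ac flip: powr_add)
  finally show ?thesis by (simp add: add_increasing2)
qed

text \<open>Each factor is at most a power of \<open>Z = X powr s + Y powr t\<close>, with total
  exponent below 1. Mixed terms in \<open>L\<close> and \<open>d\<close> are absorbed this way in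
  the sufficiency proofs.\<close>

lemma powr_mult_powr_le:
  fixes s t p r \<eta> :: real
  assumes "0 < s" "0 < t" "0 \<le> p" "0 \<le> r" "p / s + r / t < 1" "0 < \<eta>"
  obtains C where "0 \<le> C"
    "\<And>X Y. 1 \<le> X \<Longrightarrow> 1 \<le> Y \<Longrightarrow> X powr p * Y powr r \<le> \<eta> * (X powr s + Y powr t) + C"
proof -
  define \<rho> where "\<rho> = p / s + r / t"
  have \<rho>: "0 \<le> \<rho>" "\<rho> < 1" using assms by (auto simp: \<rho>_def)
  have "X powr p * Y powr r \<le> \<eta> * (X powr s + Y powr t) + (1 / \<eta>) powr (\<rho> / (1 - \<rho>))"
    if XY: "1 \<le> X" "1 \<le> Y" for X Y :: real
  proof -
    define Z where "Z = X powr s + Y powr t"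
    have Z: "0 < Z" using XY by (simp add: Z_def add_pos_pos)
    have "(X powr s) powr (p / s) \<le> Z powr (p / s)" "(Y powr t) powr (r / t) \<le> Z powr (r / t)"
      using assms XY by (auto simp: Z_def intro!: powr_mono2)
    then have "X powr p * Y powr r \<le> Z powr (p / s) * Z powr (r / t)"
      using assms by (intro mult_mono) (auto simp: powr_powr)
    also have "\<dots> = Z powr \<rho>" by (simp add: \<rho>_def powr_add)
    also have "\<dots> \<le> \<eta> * Z + (1 / \<eta>) powr (\<rho> / (1 - \<rho>))"
      using powr_le_linear \<rho> assms Z by blast
    finally show ?thesis by (simp add: Z_def)
  qed
  then show ?thesis by (intro that[of "(1 / \<eta>) powr (\<rho> / (1 - \<rho>))"]) auto
qed

text \<open>Comparison with the integral of \<open>z powr (\<sigma> - 1)\<close>, by the mean value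
  theorem.\<close>

lemma sum_powr_minus_one_le:
  fixes \<sigma> :: real
  assumes "0 < \<sigma>" "\<sigma> \<le> 1"
  shows "(\<Sum>j=1..n. real j powr (\<sigma> - 1)) \<le> real n powr \<sigma> / \<sigma>"
proof (induction n)
  case (Suc n)
  have "real (Suc n) powr (\<sigma> - 1) \<le> (real (Suc n) powr \<sigma> - real n powr \<sigma>) / \<sigma>"
  proof (cases "n = 0")
    case False
    have "\<exists>z. real n < z \<and> z < real (Suc n) \<and> real (Suc n) powr \<sigma> - real n powr \<sigma>
        = (real (Suc n) - real n) * (\<sigma> * z powr (\<sigma> - 1))"
    proof (rule MVT2)
      fix z assume "real n \<le> z"
      then show "DERIV (\<lambda>z. z powr \<sigma>) z :> \<sigma> * z powr (\<sigma> - 1)"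
        using False by (intro has_real_derivative_powr) auto
    qed simp
    then obtain z where z: "real n < z" "z < real (Suc n)"
      "real (Suc n) powr \<sigma> - real n powr \<sigma> = \<sigma> * z powr (\<sigma> - 1)" by auto
    have "real (Suc n) powr (\<sigma> - 1) \<le> z powr (\<sigma> - 1)"
      using z assms by (intro powr_mono2') auto
    also have "\<dots> = (real (Suc n) powr \<sigma> - real n powr \<sigma>) / \<sigma>" using z assms by simp
    finally show ?thesis .
  qed (use assms in simp)
  then show ?case using Suc by (simp add: diff_divide_distrib)
qed simp

lemma sum_inverse_squares_le:
  assumes "1 \<le> m"
  shows "(\<Sum>j=Suc m..d. real j powr (- 2)) \<le> 1 / real m"
proof (cases "m \<le> d")
  case True
  have "(\<Sum>j=Suc m..d. real j powr (- 2)) \<le> 1 / real m - 1 / real d"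
    using True
  proof (induction d rule: dec_induct)
    case (step d)
    have d: "0 < real d" using step assms by auto
    have "real (Suc d) powr (- 2) = 1 / (real (Suc d) * real (Suc d))"
      by (simp add: powr_minus powr_numeral power2_eq_square divide_simps)
    also have "\<dots> \<le> 1 / (real d * real (Suc d))"
      using d by (intro divide_left_mono mult_right_mono) auto
    also have "\<dots> = 1 / real d - 1 / real (Suc d)" using d by (simp add: field_simps)
    finally show ?case using step by (simp add: sum.cl_ivl_Suc)
  qed simp
  moreover have "0 \<le> 1 / real d" by simp
  ultimately show ?thesis by linarith
qed simp

text \<open>A Riemann sum of mesh \<open>1 / N\<close> for a function integrable both at 0 and at
  infinity. The cut is at the integer part \<open>m\<close> of \<open>N\<close>, and
  \<open>N <= 2 * m\<close> enters the constant.\<close>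

lemma sum_min_powr_le:
  assumes "1 \<le> N"
  shows "(\<Sum>j=1..d. min ((real j / N) powr (- (1 / 2))) ((real j / N) powr (- 2))) \<le> 4 * N"
proof -
  define m where "m = nat \<lfloor>N\<rfloor>"
  have m: "1 \<le> m" "real m \<le> N" "N < real m + 1" using assms unfolding m_def by linarith+
  let ?f = "\<lambda>j. (real j / N) powr (- (1 / 2))" and ?g = "\<lambda>j. (real j / N) powr (- 2)"
  have "(\<Sum>j=1..d. min (?f j) (?g j)) \<le> (\<Sum>j\<in>{1..m} \<union> {Suc m..d}. min (?f j) (?g j))"
    by (rule sum_mono2) auto
  also have "\<dots> = (\<Sum>j=1..m. min (?f j) (?g j)) + (\<Sum>j=Suc m..d. min (?f j) (?g j))"
    by (rule sum.union_disjoint) auto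
  also have "\<dots> \<le> (\<Sum>j=1..m. ?f j) + (\<Sum>j=Suc m..d. ?g j)"
    by (intro add_mono sum_mono) auto
  also have "(\<Sum>j=1..m. ?f j) = N powr (1 / 2) * (\<Sum>j=1..m. real j powr (1 / 2 - 1))"
    using assms by (simp add: sum_distrib_left powr_divide powr_minus divide_simps)
  also have "\<dots> \<le> N powr (1 / 2) * (real m powr (1 / 2) / (1 / 2))"
    by (intro mult_left_mono sum_powr_minus_one_le) auto
  also have "\<dots> \<le> N powr (1 / 2) * (N powr (1 / 2) / (1 / 2))"
    using m by (intro mult_left_mono divide_right_mono powr_mono2) auto
  also have "\<dots> = 2 * N" using assms by (simp flip: powr_add)
  also have "(\<Sum>j=Suc m..d. ?g j) = N powr 2 * (\<Sum>j=Suc m..d. real j powr (- 2))"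
    using assms by (simp add: sum_distrib_left powr_divide powr_minus divide_simps)
  also have "\<dots> \<le> N powr 2 * (1 / real m)"
    using m by (intro mult_left_mono sum_inverse_squares_le) auto
  also have "\<dots> \<le> N powr 2 * (2 / N)"
  proof (intro mult_left_mono)
    have "1 \<le> real m" using m by simp
    then have "N \<le> 2 * real m" "0 < real m" "0 < N" using m(3) assms by linarith+
    then show "1 / real m \<le> 2 / N" by (simp add: field_simps)
  qed auto
  also have "\<dots> = 2 * N" using assms by (simp add: powr_numeral power2_eq_square)
  finally show ?thesis by simp
qed

text \<open>Beyond some \<open>J\<close> the factor \<open>f j\<close> is below
  \<open>\<eta> * \<sigma>\<close>; the finitely many earlier terms go into
  \<open>C\<close>.\<close>

lemma weighted_sum_null_sequence_le:
  fixes f :: "nat \<Rightarrow> real"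
  assumes f: "f \<longlonglongrightarrow> 0" and \<sigma>: "0 < \<sigma>" "\<sigma> \<le> 1" and \<eta>: "0 < \<eta>"
  obtains C where "0 \<le> C" "\<And>d. (\<Sum>j=1..d. f j * real j powr (\<sigma> - 1)) \<le> \<eta> * real d powr \<sigma> + C"
proof -
  have "eventually (\<lambda>j. f j < \<eta> * \<sigma>) sequentially" using f \<eta> \<sigma> by (intro order_tendstoD) auto
  then obtain J where J: "\<And>j. J \<le> j \<Longrightarrow> f j < \<eta> * \<sigma>" by (auto simp: eventually_sequentially)
  define C where "C = (\<Sum>j<J. \<bar>f j\<bar> * real j powr (\<sigma> - 1))"
  have "(\<Sum>j=1..d. f j * real j powr (\<sigma> - 1)) \<le> \<eta> * real d powr \<sigma> + C" for d
  proof -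
    have "(\<Sum>j=1..d. f j * real j powr (\<sigma> - 1)) \<le>
        (\<Sum>j=1..d. \<eta> * \<sigma> * real j powr (\<sigma> - 1) + (if j < J then \<bar>f j\<bar> * real j powr (\<sigma> - 1) else 0))"
    proof (rule sum_mono)
      fix j assume "j \<in> {1..d}"
      show "f j * real j powr (\<sigma> - 1) \<le> \<eta> * \<sigma> * real j powr (\<sigma> - 1) + (if j < J then \<bar>f j\<bar> * real j powr (\<sigma> - 1) else 0)"
      proof (cases "j < J")
        case True
        have "f j * real j powr (\<sigma> - 1) \<le> \<bar>f j\<bar> * real j powr (\<sigma> - 1)" by (intro mult_right_mono) auto
        then show ?thesis using True \<eta> \<sigma> by (simp add: add_increasing)
      next
        case False
        then show ?thesis using J[of j] by (auto intro!: mult_right_mono)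
      qed
    qed
    also have "\<dots> = \<eta> * \<sigma> * (\<Sum>j=1..d. real j powr (\<sigma> - 1)) + (\<Sum>j\<in>{1..d} \<inter> {..<J}. \<bar>f j\<bar> * real j powr (\<sigma> - 1))"
      by (simp add: sum.distrib sum_distrib_left sum.inter_restrict)
    also have "\<dots> \<le> \<eta> * \<sigma> * (real d powr \<sigma> / \<sigma>) + C"
      unfolding C_def using \<eta> \<sigma>
      by (intro add_mono mult_left_mono sum_powr_minus_one_le sum_mono2) auto
    finally show ?thesis using \<sigma> by simp
  qed
  moreover have "0 \<le> C" by (simp add: C_def sum_nonneg)
  ultimately show ?thesis by (rule that[rotated])
qed

section \<open>Sufficient conditions\<close>

context korobov
begin

text \<open>An additive constant is harmless because the denominator tends to infinity with
  \<open>1 / \<epsilon> + d\<close>.\<close>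

lemma EXP_WT_I:
  assumes st: "0 < s" "0 < t"
    and bound: "\<And>\<eta>. 0 < \<eta> \<Longrightarrow> \<exists>C. \<forall>\<epsilon> d. 0 < \<epsilon> \<longrightarrow> \<epsilon> < 1 \<longrightarrow> 1 \<le> d \<longrightarrow>
      ln (real (nstar cl cr \<omega> a b \<epsilon> d)) \<le> \<eta> * ((1 + ln (1 / \<epsilon>)) powr s + real d powr t) + C"
  shows "EXP_WT cl cr \<omega> a b s t"
  unfolding EXP_WT_def
proof (intro conjI allI impI)
  show "\<exists>n. good_n cl cr \<omega> a b \<epsilon> d n" if "0 < \<epsilon>" "\<epsilon> < 1" for \<epsilon> d
    using exists_good_n_any that by blast
next
  fix \<eta> :: real assume \<eta>: "0 < \<eta>"
  obtain C where C: "\<And>\<epsilon> d. 0 < \<epsilon> \<Longrightarrow> \<epsilon> < 1 \<Longrightarrow> 1 \<le> d \<Longrightarrow>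
      ln (real (nstar cl cr \<omega> a b \<epsilon> d)) \<le> \<eta> / 2 * ((1 + ln (1 / \<epsilon>)) powr s + real d powr t) + C"
    using bound[of "\<eta> / 2"] \<eta> by auto
  define R where "R = max 0 (2 * C / \<eta>)"
  have R: "0 \<le> R" "C \<le> \<eta> / 2 * R" using \<eta> by (auto simp: R_def max_def field_simps)
  \<comment> \<open>At or above the threshold, \<open>1 / \<epsilon>\<close> or \<open>d\<close>
    reaches its own summand, and either makes the denominator at least \<open>R\<close>.\<close>
  have "ln (real (nstar cl cr \<omega> a b \<epsilon> d)) / ((1 + ln (1 / \<epsilon>)) powr s + real d powr t) \<le> \<eta>"
    if \<epsilon>: "0 < \<epsilon>" "\<epsilon> < 1" and d: "1 \<le> d" and M: "exp (R powr (1 / s)) + R powr (1 / t) \<le> 1 / \<epsilon> + real d" for \<epsilon> d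
  proof -
    define Z where "Z = (1 + ln (1 / \<epsilon>)) powr s + real d powr t"
    have L: "0 \<le> ln (1 / \<epsilon>)" using \<epsilon> by simp
    have Z: "0 < Z" using d by (simp add: Z_def add_nonneg_pos)
    have "R \<le> Z"
    proof (cases "exp (R powr (1 / s)) \<le> 1 / \<epsilon>")
      case True
      then have "R powr (1 / s) \<le> ln (1 / \<epsilon>)" using \<epsilon> by (subst ln_ge_iff) auto
      then have "(R powr (1 / s)) powr s \<le> (1 + ln (1 / \<epsilon>)) powr s" using st by (intro powr_mono2) auto
      then show ?thesis using st R by (simp add: Z_def powr_powr add_increasing2)
    next
      case False
      then have "R powr (1 / t) \<le> real d" using M by linarith
      then have "(R powr (1 / t)) powr t \<le> real d powr t" using st by (intro powr_mono2) auto
      then show ?thesis using st R by (simp add: Z_def powr_powr add_increasing)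
    qed
    then have "\<eta> / 2 * R \<le> \<eta> / 2 * Z" using \<eta> by (intro mult_left_mono) auto
    then have "ln (real (nstar cl cr \<omega> a b \<epsilon> d)) \<le> \<eta> * Z" using C[OF \<epsilon> d] R unfolding Z_def by argo
    then show ?thesis unfolding Z_def[symmetric] using Z by (simp add: divide_le_eq)
  qed
  then show "\<exists>M. \<forall>\<epsilon> d. 0 < \<epsilon> \<longrightarrow> \<epsilon> < 1 \<longrightarrow> 1 \<le> d \<longrightarrow> M \<le> 1 / \<epsilon> + real d \<longrightarrow>
      ln (real (nstar cl cr \<omega> a b \<epsilon> d)) / ((1 + ln (1 / \<epsilon>)) powr s + real d powr t) \<le> \<eta>"
    by blast
qed

lemma ln_S_nonneg: "0 < \<tau> \<Longrightarrow> 0 \<le> ln (S d \<tau>)"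
  using S_ge_1 by simp

lemma ln_nstar_le_half:
  assumes "0 < \<epsilon>" "\<epsilon> < 1" "0 < \<tau>" "\<tau> \<le> 1 / 2"
  shows "ln (real (nstar cl cr \<omega> a b \<epsilon> d)) \<le> 12 * (ln (S d \<tau>) + \<tau> * (1 + ln (1 / \<epsilon>)))"
proof -
  have "0 \<le> ln (1 / \<epsilon>)" using assms by simp
  then have "0 \<le> ln (S d \<tau>) + \<tau> * (1 + ln (1 / \<epsilon>))" using assms ln_S_nonneg by simp
  moreover have "6 / (1 - \<tau>) \<le> 12" using assms by (simp add: field_simps)
  ultimately have "6 / (1 - \<tau>) * (ln (S d \<tau>) + \<tau> * (1 + ln (1 / \<epsilon>))) \<le> 12 * (ln (S d \<tau>) + \<tau> * (1 + ln (1 / \<epsilon>)))"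
    by (intro mult_right_mono)
  then show ?thesis using ln_nstar_le[of \<epsilon> \<tau> cl cr d] assms by linarith
qed

text \<open>\<open>\<tau> = 1 / (2 * L)\<close> keeps \<open>\<tau> * L\<close> bounded, and every
  coordinate then costs at most a multiple of \<open>L powr p\<close> with \<open>p\<close> as small
  as desired. As \<open>t > 1\<close>, \<open>d * L powr p\<close> is sublinear in the
  denominator.\<close>

lemma EXP_WT_gt_1:
  assumes "0 < s" "1 < t"
  shows "EXP_WT cl cr \<omega> a b s t"
proof (rule EXP_WT_I)
  fix \<eta> :: real assume \<eta>: "0 < \<eta>"
  \<comment> \<open>Half of the largest \<open>p\<close> for which \<open>p / s + 1 / t\<close> is
    at most 1.\<close>
  define p where "p = s * (1 - 1 / t) / 2"
  have p: "0 < p" using assms by (simp add: p_def)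
  have "p / s + 1 / t = 1 / 2 + 1 / (2 * t)" using assms by (simp add: p_def field_simps)
  also have "\<dots> < 1" using assms by (simp add: field_simps)
  finally have pst: "p / s + 1 / t < 1" .
  obtain C where C: "C > 0" "\<And>y b. 0 < y \<Longrightarrow> \<beta> \<le> b \<Longrightarrow> ln (theta y b) \<le> C * y powr (- p)"
    using ln_theta_le_powr[OF \<beta> p] by blast
  define C' where "C' = C * (x 1 / 2) powr (- p)"
  have C': "C' > 0" using C x_1_pos by (simp add: C'_def)
  obtain D where D: "0 \<le> D" "\<And>X Y. 1 \<le> X \<Longrightarrow> 1 \<le> Y \<Longrightarrow> X powr p * Y powr 1 \<le> \<eta> / (12 * C') * (X powr s + Y powr t) + D"
    using powr_mult_powr_le[of s t p 1 "\<eta> / (12 * C')"] assms p pst \<eta> C' by auto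
  have "ln (real (nstar cl cr \<omega> a b \<epsilon> d)) \<le> \<eta> * ((1 + ln (1 / \<epsilon>)) powr s + real d powr t) + (12 * C' * D + 6)"
    if \<epsilon>: "0 < \<epsilon>" "\<epsilon> < 1" and d: "1 \<le> d" for \<epsilon> d
  proof -
    define L where "L = 1 + ln (1 / \<epsilon>)"
    have L: "1 \<le> L" using \<epsilon> by (simp add: L_def)
    define \<tau> where "\<tau> = 1 / (2 * L)"
    have \<tau>: "0 < \<tau>" "\<tau> \<le> 1 / 2" using L by (auto simp: \<tau>_def field_simps)
    have "ln (S d \<tau>) = (\<Sum>k=1..d. ln (theta (\<tau> * x k) (b k)))" by (rule ln_S[OF \<tau>(1)])
    also have "\<dots> \<le> (\<Sum>k=1..d. C' * L powr p)"
    proof (rule sum_mono)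
      fix k assume k: "k \<in> {1..d}"
      have "ln (theta (\<tau> * x k) (b k)) \<le> C * (\<tau> * x k) powr (- p)"
        using k \<tau> x_pos b_ge by (intro C) auto
      also have "\<dots> \<le> C * (\<tau> * x 1) powr (- p)"
        using C \<tau> x_1_pos p k x_mono[of 1 k] by (intro mult_left_mono powr_mono2') auto
      also have "\<tau> * x 1 = (x 1 / 2) * (1 / L)" by (simp add: \<tau>_def)
      also have "C * ((x 1 / 2) * (1 / L)) powr (- p) = C' * L powr p"
        using x_1_pos L by (simp add: C'_def powr_mult powr_divide powr_minus field_simps)
      finally show "ln (theta (\<tau> * x k) (b k)) \<le> C' * L powr p" .
    qed
    also have "\<dots> = C' * (L powr p * real d powr 1)" using d by simp
    also have "\<dots> \<le> C' * (\<eta> / (12 * C') * (L powr s + real d powr t) + D)"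
      using C' L d by (intro mult_left_mono D) auto
    also have "\<dots> = \<eta> / 12 * (L powr s + real d powr t) + C' * D" using C' by (simp add: field_simps)
    finally have "12 * (ln (S d \<tau>) + \<tau> * L) \<le> 12 * ((\<eta> / 12 * (L powr s + real d powr t) + C' * D) + 1 / 2)"
      using L by (simp add: \<tau>_def)
    also have "\<dots> = \<eta> * (L powr s + real d powr t) + (12 * C' * D + 6)" by simp
    finally show ?thesis using ln_nstar_le_half[OF \<epsilon> \<tau>, of cl cr d] unfolding L_def by linarith
  qed
  then show "\<exists>C. \<forall>\<epsilon> d. 0 < \<epsilon> \<longrightarrow> \<epsilon> < 1 \<longrightarrow> 1 \<le> d \<longrightarrow>
      ln (real (nstar cl cr \<omega> a b \<epsilon> d)) \<le> \<eta> * ((1 + ln (1 / \<epsilon>)) powr s + real d powr t) + C" by blast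
qed (use assms in auto)

lemma neg_ln_\<omega>_pos: "0 < - ln \<omega>"
  using \<omega> by simp

lemma x_div_at_top:
  assumes "filterlim (\<lambda>j. a j / g j) at_top sequentially"
  shows "filterlim (\<lambda>j. x j / g j) at_top sequentially"
proof -
  have "filterlim (\<lambda>j. - ln \<omega> * (a j / g j)) at_top sequentially"
    by (rule filterlim_tendsto_pos_mult_at_top[OF tendsto_const neg_ln_\<omega>_pos assms])
  then show ?thesis by (simp add: x_def)
qed

text \<open>For a fixed small \<open>\<tau> = \<delta>\<close> the sum \<open>S d \<delta>\<close>
  is bounded in \<open>d\<close>, because \<open>exp (- (\<delta> * x j))\<close> is eventually at
  most \<open>j powr (- 2)\<close>. What remains is
  \<open>12 * \<delta> * L <= \<eta> * L\<close>.\<close>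

lemma EXP_WT_1_sufficient:
  assumes "0 < t" and lim: "filterlim (\<lambda>j. a j / ln (real j)) at_top sequentially"
  shows "EXP_WT cl cr \<omega> a b 1 t"
proof (rule EXP_WT_I)
  fix \<eta> :: real assume \<eta>: "0 < \<eta>"
  define \<delta> where "\<delta> = min (1 / 2) (\<eta> / 12)"
  have \<delta>: "0 < \<delta>" "\<delta> \<le> 1 / 2" "12 * \<delta> \<le> \<eta>" using \<eta> by (auto simp: \<delta>_def min_def)
  have \<delta>x: "0 < \<delta> * x 1" using \<delta> x_1_pos by simp
  obtain C where C: "C > 0" "\<And>y b. \<delta> * x 1 \<le> y \<Longrightarrow> \<beta> \<le> b \<Longrightarrow> ln (theta y b) \<le> C * exp (- y)"
    using ln_theta_le_exp[OF \<beta> \<delta>x] by blast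
  have ev: "eventually (\<lambda>j. 2 / \<delta> \<le> x j / ln (real j) \<and> 1 < j) sequentially"
    using x_div_at_top[OF lim] eventually_gt_at_top[of 1]
    by (auto simp: filterlim_at_top intro: eventually_conj)
  have sm: "summable (\<lambda>j. exp (- (\<delta> * x j)))"
  proof (rule summable_comparison_test_ev)
    show "eventually (\<lambda>j. norm (exp (- (\<delta> * x j))) \<le> real j powr (- 2)) sequentially"
      using ev
    proof eventually_elim
      case (elim j)
      then have "0 < ln (real j)" by simp
      then have "2 / \<delta> * ln (real j) \<le> x j" using elim pos_le_divide_eq by blast
      then have "2 * ln (real j) \<le> \<delta> * x j" using \<delta> by (simp add: field_simps)
      then have "exp (- (\<delta> * x j)) \<le> exp (- (2 * ln (real j)))" by simp
      also have "\<dots> = real j powr (- 2)" using elim by (simp add: powr_def)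
      finally show ?case by simp
    qed
    show "summable (\<lambda>j. real j powr (- 2))" by (simp add: summable_real_powr_iff)
  qed
  define D where "D = suminf (\<lambda>j. exp (- (\<delta> * x j)))"
  have "ln (real (nstar cl cr \<omega> a b \<epsilon> d)) \<le> \<eta> * ((1 + ln (1 / \<epsilon>)) powr 1 + real d powr t) + 12 * (C * D)"
    if \<epsilon>: "0 < \<epsilon>" "\<epsilon> < 1" for \<epsilon> d
  proof -
    define L where "L = 1 + ln (1 / \<epsilon>)"
    have L: "1 \<le> L" using \<epsilon> by (simp add: L_def)
    have "ln (S d \<delta>) = (\<Sum>k=1..d. ln (theta (\<delta> * x k) (b k)))" by (rule ln_S[OF \<delta>(1)])
    also have "\<dots> \<le> (\<Sum>k=1..d. C * exp (- (\<delta> * x k)))"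
      using \<delta> x_mono[of 1] b_ge by (intro sum_mono C) auto
    also have "\<dots> = C * (\<Sum>k=1..d. exp (- (\<delta> * x k)))" by (simp add: sum_distrib_left)
    also have "\<dots> \<le> C * D" unfolding D_def using C by (intro mult_left_mono sum_le_suminf sm) auto
    finally have "ln (S d \<delta>) \<le> C * D" .
    moreover have "12 * \<delta> * L \<le> \<eta> * L" using \<delta> L by (intro mult_right_mono) auto
    moreover have "0 \<le> \<eta> * real d powr t" using \<eta> by simp
    ultimately have "12 * (ln (S d \<delta>) + \<delta> * L) \<le> \<eta> * (L + real d powr t) + 12 * (C * D)"
      by (simp add: algebra_simps)
    then show ?thesis using ln_nstar_le_half[OF \<epsilon> \<delta>(1,2), of cl cr d] L unfolding L_def by simp
  qed
  then show "\<exists>C. \<forall>\<epsilon> d. 0 < \<epsilon> \<longrightarrow> \<epsilon> < 1 \<longrightarrow> 1 \<le> d \<longrightarrow>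
      ln (real (nstar cl cr \<omega> a b \<epsilon> d)) \<le> \<eta> * ((1 + ln (1 / \<epsilon>)) powr 1 + real d powr t) + C" by blast
qed (use assms in auto)

text \<open>With \<open>N = L powr s\<close> and \<open>\<tau> = \<delta> * L powr (s - 1)\<close>
  one has \<open>\<tau> * L = \<delta> * N\<close>, and the growth condition becomes
  \<open>\<tau> * x k >= R * (k / N) powr q\<close>. So late coordinates act only through
  \<open>k / N\<close>, and their logarithms add up to a multiple of \<open>N\<close>.\<close>

lemma EXP_WT_less_1_sufficient:
  assumes s: "0 < s" "s < 1" and t: "0 < t"
    and lim: "filterlim (\<lambda>j. a j / real j powr ((1 - s) / s)) at_top sequentially"
  shows "EXP_WT cl cr \<omega> a b s t"
proof (rule EXP_WT_I)
  fix \<eta> :: real assume \<eta>: "0 < \<eta>"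
  define q where "q = (1 - s) / s"
  have q: "0 < q" "s * q = 1 - s" using s by (auto simp: q_def)
  \<comment> \<open>The exponents \<open>1 / (2 * q)\<close> and \<open>2 / q\<close> become -1/2
    and -2 in \<open>k / N\<close>, for \<open>k\<close> up to \<open>N\<close> and beyond;
    \<open>C3\<close> serves the finitely many indices without the growth bound.\<close>
  obtain C1 where C1: "C1 > 0" "\<And>y b. 0 < y \<Longrightarrow> \<beta> \<le> b \<Longrightarrow> ln (theta y b) \<le> C1 * y powr (- (1 / (2 * q)))"
    using ln_theta_le_powr[OF \<beta>, of "1 / (2 * q)"] q by auto
  obtain C2 where C2: "C2 > 0" "\<And>y b. 0 < y \<Longrightarrow> \<beta> \<le> b \<Longrightarrow> ln (theta y b) \<le> C2 * y powr (- (2 / q))"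
    using ln_theta_le_powr[OF \<beta>, of "2 / q"] q by auto
  obtain C3 where C3: "C3 > 0" "\<And>y b. 0 < y \<Longrightarrow> \<beta> \<le> b \<Longrightarrow> ln (theta y b) \<le> C3 * y powr (- (s / 2))"
    using ln_theta_le_powr[OF \<beta>, of "s / 2"] s by auto
  define \<delta> where "\<delta> = min (1 / 2) (\<eta> / 36)"
  have \<delta>: "0 < \<delta>" "\<delta> \<le> 1 / 2" "36 * \<delta> \<le> \<eta>" using \<eta> by (auto simp: \<delta>_def min_def)
  \<comment> \<open>Makes \<open>12 * 4 * (C1 + C2) * R powr (- (1 / (2 * q)))\<close> at most
    \<open>\<eta> / 3\<close>, with 12 from the bound on \<open>ln n\<close> and 4 from the Riemann
    sum.\<close>
  define R where "R = max 1 ((144 * (C1 + C2) / \<eta>) powr (2 * q))"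
  have R: "1 \<le> R" by (simp add: R_def)
  have RC: "48 * (C1 + C2) * R powr (- (1 / (2 * q))) \<le> \<eta> / 3"
  proof -
    define W where "W = 144 * (C1 + C2) / \<eta>"
    have W: "0 < W" using C1 C2 \<eta> by (simp add: W_def)
    have "(W powr (2 * q)) powr (1 / (2 * q)) \<le> R powr (1 / (2 * q))"
      using q by (intro powr_mono2) (auto simp: R_def W_def)
    then have "W \<le> R powr (1 / (2 * q))" using W q by (simp add: powr_powr)
    then have "144 * (C1 + C2) \<le> \<eta> * R powr (1 / (2 * q))" using \<eta> by (simp add: W_def field_simps)
    then show ?thesis using R by (simp add: powr_minus field_simps)
  qed
  have "eventually (\<lambda>j. R / \<delta> \<le> x j / real j powr q) sequentially"
    using x_div_at_top[OF lim] by (auto simp: filterlim_at_top q_def)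
  then obtain J where J: "\<And>j. J \<le> j \<Longrightarrow> R / \<delta> \<le> x j / real j powr q" by (auto simp: eventually_sequentially)
  define C4 where "C4 = C3 * (\<delta> * x 1) powr (- (s / 2))"
  have C4: "0 < C4" using C3 \<delta> x_1_pos by (simp add: C4_def)
  define K where "K = 12 * (real J * C4) + 1"
  have K: "0 < K" using C4 by (simp add: K_def add_nonneg_pos)
  have "((1 - s) * (s / 2)) / s + 0 / t < 1" using s by simp
  then obtain D where D: "0 \<le> D" "\<And>X Y. 1 \<le> X \<Longrightarrow> 1 \<le> Y \<Longrightarrow>
      X powr ((1 - s) * (s / 2)) * Y powr 0 \<le> \<eta> / (3 * K) * (X powr s + Y powr t) + D"
    using powr_mult_powr_le[of s t "(1 - s) * (s / 2)" 0 "\<eta> / (3 * K)"] s t \<eta> K by auto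
  have "ln (real (nstar cl cr \<omega> a b \<epsilon> d)) \<le> \<eta> * ((1 + ln (1 / \<epsilon>)) powr s + real d powr t) + K * D"
    if \<epsilon>: "0 < \<epsilon>" "\<epsilon> < 1" and d: "1 \<le> d" for \<epsilon> d
  proof -
    define L where "L = 1 + ln (1 / \<epsilon>)"
    have L: "1 \<le> L" using \<epsilon> by (simp add: L_def)
    define N where "N = L powr s"
    have N: "1 \<le> N" using L s by (simp add: N_def ge_one_powr_ge_zero)
    define \<tau> where "\<tau> = \<delta> * L powr (s - 1)"
    have "L powr (s - 1) \<le> L powr 0" using L s by (intro powr_mono) auto
    then have "L powr (s - 1) \<le> 1" using L by simp
    then have "\<delta> * L powr (s - 1) \<le> \<delta> * 1" using \<delta> by (intro mult_left_mono) auto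
    then have "\<tau> \<le> 1 / 2" unfolding \<tau>_def using \<delta>(2) by linarith
    moreover have "0 < \<tau>" using \<delta> L by (simp add: \<tau>_def)
    ultimately have \<tau>: "0 < \<tau>" "\<tau> \<le> 1 / 2" by auto
    have LN: "L powr (s - 1) = N powr (- q)" using q by (simp add: N_def powr_powr)
    have \<tau>L: "\<tau> * L = \<delta> * N"
    proof -
      have "L powr (s - 1) * L powr 1 = N" unfolding N_def powr_add[symmetric] by simp
      then show ?thesis using L by (simp add: \<tau>_def)
    qed
    define A where "A = (C1 + C2) * R powr (- (1 / (2 * q)))"
    have A: "0 \<le> A" using C1 C2 by (simp add: A_def)
    let ?m = "\<lambda>k. min ((real k / N) powr (- (1 / 2))) ((real k / N) powr (- 2))"
    let ?B = "C4 * L powr ((1 - s) * (s / 2))"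
    have B: "0 \<le> ?B" using C4 by simp
    have term_le: "ln (theta (\<tau> * x k) (b k)) \<le> A * ?m k + (if k < J then ?B else 0)" if k: "k \<in> {1..d}" for k
    proof (cases "k < J")
      \<comment> \<open>Only \<open>x k >= x 1\<close> is available here; it costs
        \<open>L powr ((1 - s) * (s / 2))\<close>, of lower order than
        \<open>L powr s\<close>.\<close>
      case True
      have "ln (theta (\<tau> * x k) (b k)) \<le> C3 * (\<tau> * x k) powr (- (s / 2))"
        using k \<tau> x_pos b_ge by (intro C3) auto
      also have "\<dots> \<le> C3 * (\<tau> * x 1) powr (- (s / 2))"
        using C3 \<tau> x_1_pos s k x_mono[of 1 k] by (intro mult_left_mono powr_mono2') auto
      also have "\<tau> * x 1 = (\<delta> * x 1) * L powr (s - 1)" by (simp add: \<tau>_def)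
      also have "C3 * ((\<delta> * x 1) * L powr (s - 1)) powr (- (s / 2)) = C3 * ((\<delta> * x 1) powr (- (s / 2)) * L powr ((s - 1) * (- (s / 2))))"
        using x_1_pos L \<delta> by (simp add: powr_mult powr_powr)
      also have "(s - 1) * (- (s / 2)) = (1 - s) * (s / 2)" by (simp add: field_simps)
      finally have "ln (theta (\<tau> * x k) (b k)) \<le> ?B" by (simp add: C4_def)
      then show ?thesis using True A N by (simp add: add_increasing)
    next
      case False
      have k0: "0 < real k" using k by simp
      have "R / \<delta> \<le> x k / real k powr q" using J False by simp
      then have "R * real k powr q \<le> \<delta> * x k" using \<delta> k0 by (simp add: field_simps)
      then have "R * real k powr q * N powr (- q) \<le> \<delta> * x k * N powr (- q)" by (intro mult_right_mono) auto
      then have ge: "R * (real k / N) powr q \<le> \<tau> * x k"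
        using N k0 unfolding \<tau>_def LN by (simp add: powr_divide powr_minus field_simps)
      have pos: "0 < R * (real k / N) powr q" using R N k0 by simp
      have 1: "ln (theta (\<tau> * x k) (b k)) \<le> A * (real k / N) powr (- (1 / 2))"
      proof -
        have "ln (theta (\<tau> * x k) (b k)) \<le> C1 * (\<tau> * x k) powr (- (1 / (2 * q)))"
          using k \<tau> x_pos b_ge by (intro C1) auto
        also have "\<dots> \<le> C1 * (R * (real k / N) powr q) powr (- (1 / (2 * q)))"
          using C1 pos ge q by (intro mult_left_mono powr_mono2') auto
        also have "\<dots> = C1 * R powr (- (1 / (2 * q))) * (real k / N) powr (- (1 / 2))"
          using R k0 N q by (simp add: powr_mult powr_powr)
        also have "\<dots> \<le> A * (real k / N) powr (- (1 / 2))"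
          unfolding A_def using C2 by (intro mult_right_mono) auto
        finally show ?thesis .
      qed
      have 2: "ln (theta (\<tau> * x k) (b k)) \<le> A * (real k / N) powr (- 2)"
      proof -
        have "ln (theta (\<tau> * x k) (b k)) \<le> C2 * (\<tau> * x k) powr (- (2 / q))"
          using k \<tau> x_pos b_ge by (intro C2) auto
        also have "\<dots> \<le> C2 * (R * (real k / N) powr q) powr (- (2 / q))"
          using C2 pos ge q by (intro mult_left_mono powr_mono2') auto
        also have "\<dots> = C2 * R powr (- (2 / q)) * (real k / N) powr (- 2)"
          using R k0 N q by (simp add: powr_mult powr_powr)
        also have "\<dots> \<le> A * (real k / N) powr (- 2)"
          unfolding A_def using C1 C2 R q by (intro mult_right_mono mult_mono powr_mono) (auto simp: field_simps)
        finally show ?thesis .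
      qed
      show ?thesis using 1 2 False by (simp add: min_def)
    qed
    have "ln (S d \<tau>) = (\<Sum>k=1..d. ln (theta (\<tau> * x k) (b k)))" by (rule ln_S[OF \<tau>(1)])
    also have "\<dots> \<le> (\<Sum>k=1..d. A * ?m k + (if k < J then ?B else 0))"
      by (intro sum_mono term_le)
    also have "\<dots> = A * (\<Sum>k=1..d. ?m k) + (\<Sum>k\<in>{1..d} \<inter> {..<J}. ?B)"
      by (simp only: sum.distrib sum_distrib_left sum.inter_restrict finite_atLeastAtMost lessThan_iff)
    also have "\<dots> \<le> A * (4 * N) + (\<Sum>k<J. ?B)"
      using A B by (intro add_mono mult_left_mono sum_min_powr_le[OF N] sum_mono2) auto
    finally have lnS: "ln (S d \<tau>) \<le> 4 * A * N + real J * ?B" by simp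
    have "12 * (real J * ?B) \<le> K * (L powr ((1 - s) * (s / 2)) * real d powr 0)"
      using d by (simp add: K_def distrib_right)
    also have "\<dots> \<le> K * (\<eta> / (3 * K) * (L powr s + real d powr t) + D)"
      using K L d by (intro mult_left_mono D) auto
    also have "\<dots> = \<eta> / 3 * (N + real d powr t) + K * D" using K by (simp add: field_simps N_def)
    finally have a1: "12 * (real J * ?B) \<le> \<eta> / 3 * (N + real d powr t) + K * D" .
    have "48 * A * N \<le> \<eta> / 3 * N"
    proof (rule mult_right_mono)
      show "48 * A \<le> \<eta> / 3" using RC unfolding A_def by (simp only: mult.assoc)
    qed (use N in simp)
    moreover have "12 * (\<tau> * L) \<le> \<eta> / 3 * N"
    proof -
      have "12 * \<delta> * N \<le> \<eta> / 3 * N" using \<delta> N by (intro mult_right_mono) auto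
      then show ?thesis unfolding \<tau>L by simp
    qed
    moreover have "0 \<le> \<eta> * real d powr t" using \<eta> by simp
    moreover have "ln (real (nstar cl cr \<omega> a b \<epsilon> d)) \<le> 12 * ln (S d \<tau>) + 12 * (\<tau> * L)"
      using ln_nstar_le_half[OF \<epsilon> \<tau>, of cl cr d] unfolding L_def by simp
    ultimately have "ln (real (nstar cl cr \<omega> a b \<epsilon> d)) \<le> \<eta> * (N + real d powr t) + K * D"
      using a1 lnS by (simp add: algebra_simps)
    then show ?thesis by (simp add: N_def L_def)
  qed
  then show "\<exists>C. \<forall>\<epsilon> d. 0 < \<epsilon> \<longrightarrow> \<epsilon> < 1 \<longrightarrow> 1 \<le> d \<longrightarrow>
      ln (real (nstar cl cr \<omega> a b \<epsilon> d)) \<le> \<eta> * ((1 + ln (1 / \<epsilon>)) powr s + real d powr t) + C" by blast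
qed (use assms in auto)

lemma \<omega>_powr_a: "\<omega> powr (a j) = exp (- x j)"
  using \<omega> by (simp add: powr_def x_def mult.commute)

text \<open>With \<open>l = 1 + ln d\<close> and \<open>1 - \<tau> = 1 / (2 * l)\<close> the
  prefactor is \<open>12 * l\<close>, but passing from order 1 to \<open>\<tau>\<close> costs only a
  constant. So \<open>l\<close> times the sum of the \<open>exp (- x k)\<close> must be small
  against \<open>d powr t\<close>, and the factor \<open>a j\<close> pays for \<open>l\<close>. The
  other term, \<open>l * L\<close>, is where \<open>s > 1\<close> enters.\<close>

lemma EXP_WT_greater_1_sufficient:
  assumes s: "1 < s" and t: "0 < t" "t < 1"
    and lim: "(\<lambda>j. real j powr (1 - t) * a j * \<omega> powr (a j)) \<longlonglongrightarrow> 0"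
  shows "EXP_WT cl cr \<omega> a b s t"
proof (rule EXP_WT_I)
  define E where "E j = exp (- x j)" for j
  define u where "u j = real j powr (1 - t) * E j" for j
  have lim': "(\<lambda>j. u j * a j) \<longlonglongrightarrow> 0" using lim by (simp add: u_def E_def \<omega>_powr_a mult_ac)
  have ulim: "u \<longlonglongrightarrow> 0"
  proof (rule tendsto_sandwich[of "\<lambda>_. 0"])
    show "eventually (\<lambda>j. u j \<le> 1 / a 1 * (u j * a j)) sequentially"
      using eventually_ge_at_top[of 1]
    proof eventually_elim
      case (elim j)
      have "u j * a 1 \<le> u j * a j" using elim a_mono[of 1 j] by (intro mult_left_mono) (auto simp: u_def E_def)
      then show ?case using a1 by (simp add: field_simps)
    qed
    show "(\<lambda>j. 1 / a 1 * (u j * a j)) \<longlonglongrightarrow> 0" using tendsto_mult_right_zero[OF lim'] .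
  qed (auto simp: u_def E_def)
  \<comment> \<open>The factor \<open>a j\<close> is traded for \<open>ln j\<close>: once
    \<open>u j < 1\<close>, \<open>x j\<close> is at least \<open>(1 - t) * ln j\<close>.\<close>
  define v where "v j = u j * (1 + ln (real j))" for j
  have vlim: "v \<longlonglongrightarrow> 0"
  proof (rule tendsto_sandwich[of "\<lambda>_. 0"])
    have "eventually (\<lambda>j. u j < 1) sequentially" using ulim by (intro order_tendstoD) auto
    then show "eventually (\<lambda>j. v j \<le> u j + - ln \<omega> / (1 - t) * (u j * a j)) sequentially"
      using eventually_ge_at_top[of 1]
    proof eventually_elim
      case (elim j)
      have "ln (u j) \<le> 0" using elim by (simp add: u_def E_def)
      moreover have "ln (u j) = (1 - t) * ln (real j) - x j"
        using elim by (simp add: u_def E_def ln_mult)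
      ultimately have "ln (real j) \<le> x j / (1 - t)" using t by (simp add: field_simps)
      then have "u j * ln (real j) \<le> u j * (x j / (1 - t))" by (intro mult_left_mono) (auto simp: u_def E_def)
      then show ?case by (simp add: v_def x_def distrib_left mult_ac)
    qed
    show "(\<lambda>j. u j + - ln \<omega> / (1 - t) * (u j * a j)) \<longlonglongrightarrow> 0"
      using tendsto_add[OF ulim tendsto_mult_right_zero[OF lim', of "- ln \<omega> / (1 - t)"]] by simp
    show "eventually (\<lambda>j. 0 \<le> v j) sequentially"
      using eventually_ge_at_top[of 1] by eventually_elim (auto simp: v_def u_def E_def)
  qed auto
  fix \<eta> :: real assume \<eta>: "0 < \<eta>"
  have x2: "0 < x 1 / 2" using x_1_pos by simp
  obtain C0 where C0: "C0 > 0" "\<And>y b. x 1 / 2 \<le> y \<Longrightarrow> \<beta> \<le> b \<Longrightarrow> ln (theta y b) \<le> C0 * exp (- y)"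
    using ln_theta_le_exp[OF \<beta> x2] by blast
  define G where "G = 12 * C0 * exp 2"
  have G: "0 < G" using C0 by (simp add: G_def)
  define \<gamma> where "\<gamma> = \<eta> / (4 * G)"
  have \<gamma>: "0 < \<gamma>" using \<eta> G by (simp add: \<gamma>_def)
  obtain Dv where Dv: "0 \<le> Dv" "\<And>d. (\<Sum>j=1..d. v j * real j powr (t - 1)) \<le> \<gamma> * real d powr t + Dv"
    using weighted_sum_null_sequence_le[OF vlim, of t \<gamma>] t \<gamma> by auto
  obtain Du where Du: "0 \<le> Du" "\<And>d. (\<Sum>j=1..d. u j * real j powr (t / 2 - 1)) \<le> (t / 2 * \<gamma>) * real d powr (t / 2) + Du"
    using weighted_sum_null_sequence_le[OF ulim, of "t / 2" "t / 2 * \<gamma>"] t \<gamma> by auto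
  define H where "H = G * (2 / t * Du) + 1"
  have H: "0 < H" using G Du t by (simp add: H_def add_nonneg_pos)
  have "0 / s + (t / 2) / t < 1" using t by simp
  then obtain D1 where D1: "0 \<le> D1" "\<And>X Y. 1 \<le> X \<Longrightarrow> 1 \<le> Y \<Longrightarrow>
      X powr 0 * Y powr (t / 2) \<le> \<eta> / (4 * H) * (X powr s + Y powr t) + D1"
    using powr_mult_powr_le[of s t 0 "t / 2" "\<eta> / (4 * H)"] s t \<eta> H by auto
  \<comment> \<open>Half of the largest \<open>\<kappa>\<close> with
    \<open>1 / s + \<kappa> / t\<close> at most 1, positive since \<open>s > 1\<close>;
    \<open>d powr \<kappa>\<close> will dominate \<open>ln d\<close>.\<close>
  define \<kappa> where "\<kappa> = t * (1 - 1 / s) / 2"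
  have \<kappa>: "0 < \<kappa>" using s t by (simp add: \<kappa>_def)
  define I where "I = 12 * (C0 + 1) * (1 + 1 / \<kappa>)"
  have I: "0 < I" using C0 \<kappa> by (simp add: I_def add_pos_pos)
  have "1 / s + \<kappa> / t = 1 / 2 + 1 / (2 * s)" using s t by (simp add: \<kappa>_def field_simps)
  also have "\<dots> < 1" using s by (simp add: field_simps)
  finally obtain D2 where D2: "0 \<le> D2" "\<And>X Y. 1 \<le> X \<Longrightarrow> 1 \<le> Y \<Longrightarrow>
      X powr 1 * Y powr \<kappa> \<le> \<eta> / (4 * I) * (X powr s + Y powr t) + D2"
    using powr_mult_powr_le[of s t 1 \<kappa> "\<eta> / (4 * I)"] s t \<eta> I \<kappa> by auto
  have "ln (real (nstar cl cr \<omega> a b \<epsilon> d)) \<le> \<eta> * ((1 + ln (1 / \<epsilon>)) powr s + real d powr t) + (G * Dv + H * D1 + I * D2)"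
    if \<epsilon>: "0 < \<epsilon>" "\<epsilon> < 1" and d: "1 \<le> d" for \<epsilon> d
  proof -
    define L where "L = 1 + ln (1 / \<epsilon>)"
    have L: "1 \<le> L" using \<epsilon> by (simp add: L_def)
    define l where "l = 1 + ln (real d)"
    have l: "1 \<le> l" using d by (simp add: l_def)
    define Z where "Z = L powr s + real d powr t"
    have dZ: "real d powr t \<le> Z" by (simp add: Z_def)
    define \<tau> where "\<tau> = 1 - 1 / (2 * l)"
    have \<tau>: "1 / 2 \<le> \<tau>" "\<tau> < 1" using l by (auto simp: \<tau>_def field_simps)
    have \<tau>0: "0 < \<tau>" using \<tau> by linarith
    \<comment> \<open>For \<open>x k <= 4 * l\<close> the change of order costs at most
      \<open>exp 2\<close>; beyond, each term is at most \<open>1 / d\<close>, so together they give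
      at most 1.\<close>
    have Esum: "(\<Sum>k=1..d. exp (- (\<tau> * x k))) \<le> exp 2 * (\<Sum>k=1..d. E k) + 1"
    proof -
      have "(\<Sum>k=1..d. exp (- (\<tau> * x k))) \<le> (\<Sum>k=1..d. exp 2 * E k + 1 / real d)"
      proof (rule sum_mono)
        fix k assume k: "k \<in> {1..d}"
        have xk: "0 < x k" using k x_pos by auto
        show "exp (- (\<tau> * x k)) \<le> exp 2 * E k + 1 / real d"
        proof (cases "x k \<le> 4 * l")
          case True
          then have "x k / (2 * l) \<le> 2" using l by (simp add: field_simps)
          then have "- (\<tau> * x k) \<le> 2 + - x k" by (simp add: \<tau>_def algebra_simps)
          then have "exp (- (\<tau> * x k)) \<le> exp 2 * E k" unfolding E_def exp_add[symmetric] by simp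
          then show ?thesis by (simp add: add_increasing2)
        next
          case False
          have "1 / 2 * x k \<le> \<tau> * x k" using \<tau> xk by (intro mult_right_mono) auto
          then have "2 * l \<le> \<tau> * x k" using False by linarith
          moreover have "ln (real d) \<le> 2 * l" using l by (simp add: l_def)
          ultimately have "- (\<tau> * x k) \<le> - ln (real d)" by linarith
          then have "exp (- (\<tau> * x k)) \<le> exp (- ln (real d))" by simp
          also have "\<dots> = 1 / real d" using d by (simp add: exp_minus inverse_eq_divide)
          finally show ?thesis by (simp add: E_def add_increasing)
        qed
      qed
      also have "\<dots> = exp 2 * (\<Sum>k=1..d. E k) + 1" using d by (simp add: sum.distrib sum_distrib_left)
      finally show ?thesis .
    qed
    \<comment> \<open>\<open>l\<close> contains \<open>ln d\<close> rather than \<open>ln k\<close>.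
      The part \<open>1 + ln k\<close> goes into \<open>v k\<close>; the rest
      \<open>ln (d / k)\<close> is at most a multiple of \<open>(d / k) powr (t / 2)\<close>, and
      the sum tilted by this power keeps the rate \<open>d powr t\<close>.\<close>
    have lE: "l * (\<Sum>k=1..d. E k) \<le> 2 * \<gamma> * real d powr t + Dv + 2 / t * Du * real d powr (t / 2)"
    proof -
      have "l * (\<Sum>k=1..d. E k) = (\<Sum>k=1..d. l * E k)" by (rule sum_distrib_left)
      also have "\<dots> \<le> (\<Sum>k=1..d. v k * real k powr (t - 1) + 2 / t * real d powr (t / 2) * (u k * real k powr (t / 2 - 1)))"
      proof (rule sum_mono)
        fix k assume k: "k \<in> {1..d}"
        have k0: "0 < real k" "real k \<le> real d" using k by auto
        have Ek: "E k = u k * real k powr (t - 1)" using k0 by (simp add: u_def mult_ac flip: powr_add)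
        have "ln (real d / real k) \<le> (real d / real k) powr (t / 2) / (t / 2)"
          using k0 t by (intro ln_powr_bound) auto
        then have "E k * (ln (real d) - ln (real k)) \<le> E k * ((real d / real k) powr (t / 2) / (t / 2))"
          using k0 by (intro mult_left_mono) (auto simp: ln_divide_pos E_def)
        also have "\<dots> = 2 / t * real d powr (t / 2) * (u k * (real k powr (t - 1) * real k powr (- (t / 2))))"
          unfolding Ek using k0 by (simp add: powr_divide powr_minus field_simps)
        also have "real k powr (t - 1) * real k powr (- (t / 2)) = real k powr (t / 2 - 1)"
          by (simp flip: powr_add)
        finally have "E k * (ln (real d) - ln (real k)) \<le> 2 / t * real d powr (t / 2) * (u k * real k powr (t / 2 - 1))" .
        moreover have "E k * (1 + ln (real k)) = v k * real k powr (t - 1)" unfolding Ek v_def by simp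
        ultimately show "l * E k \<le> v k * real k powr (t - 1) + 2 / t * real d powr (t / 2) * (u k * real k powr (t / 2 - 1))"
          by (simp add: l_def algebra_simps)
      qed
      also have "\<dots> = (\<Sum>k=1..d. v k * real k powr (t - 1)) + 2 / t * real d powr (t / 2) * (\<Sum>k=1..d. u k * real k powr (t / 2 - 1))"
        by (simp add: sum.distrib sum_distrib_left)
      also have "\<dots> \<le> (\<gamma> * real d powr t + Dv) + 2 / t * real d powr (t / 2) * ((t / 2 * \<gamma>) * real d powr (t / 2) + Du)"
        using t by (intro add_mono Dv mult_left_mono Du) auto
      also have "\<dots> = \<gamma> * real d powr t + Dv + (\<gamma> * (real d powr (t / 2) * real d powr (t / 2)) + 2 / t * Du * real d powr (t / 2))"
        using t by (simp add: field_simps)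
      also have "real d powr (t / 2) * real d powr (t / 2) = real d powr t" by (simp flip: powr_add)
      finally show ?thesis by simp
    qed
    have "ln (S d \<tau>) = (\<Sum>k=1..d. ln (theta (\<tau> * x k) (b k)))" by (rule ln_S[OF \<tau>0])
    also have "\<dots> \<le> (\<Sum>k=1..d. C0 * exp (- (\<tau> * x k)))"
    proof (intro sum_mono C0)
      fix k assume k: "k \<in> {1..d}"
      have "1 / 2 * x 1 \<le> \<tau> * x k" using \<tau> x_mono[of 1 k] x_1_pos k by (intro mult_mono) auto
      then show "x 1 / 2 \<le> \<tau> * x k" by simp
    qed (use b_ge in auto)
    also have "\<dots> \<le> C0 * (exp 2 * (\<Sum>k=1..d. E k) + 1)"
      unfolding sum_distrib_left[symmetric] using C0 Esum by (intro mult_left_mono) auto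
    finally have lnS: "ln (S d \<tau>) \<le> C0 * (exp 2 * (\<Sum>k=1..d. E k) + 1)" .
    have "ln (real (nstar cl cr \<omega> a b \<epsilon> d)) \<le> 6 / (1 - \<tau>) * (ln (S d \<tau>) + \<tau> * L)"
      unfolding L_def by (rule ln_nstar_le[OF \<epsilon> \<tau>0 \<tau>(2)])
    also have "6 / (1 - \<tau>) = 12 * l" using l by (simp add: \<tau>_def)
    also have "12 * l * (ln (S d \<tau>) + \<tau> * L) \<le> 12 * l * (C0 * (exp 2 * (\<Sum>k=1..d. E k) + 1) + 1 * L)"
      using lnS l L \<tau> by (intro mult_left_mono add_mono mult_right_mono) auto
    also have "\<dots> = G * (l * (\<Sum>k=1..d. E k)) + 12 * C0 * l + 12 * (l * L)" by (simp add: G_def algebra_simps)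
    also have "\<dots> \<le> G * (l * (\<Sum>k=1..d. E k)) + 12 * (C0 + 1) * (l * L)"
    proof -
      have "C0 * l * 1 \<le> C0 * l * L" using C0 l L by (intro mult_left_mono) auto
      then show ?thesis by (simp add: algebra_simps)
    qed
    also have "\<dots> \<le> G * (2 * \<gamma> * real d powr t + Dv + 2 / t * Du * real d powr (t / 2)) + I * (L powr 1 * real d powr \<kappa>)"
    proof (rule add_mono)
      show "G * (l * (\<Sum>k=1..d. E k)) \<le> G * (2 * \<gamma> * real d powr t + Dv + 2 / t * Du * real d powr (t / 2))"
        using lE G by (intro mult_left_mono) auto
      have "ln (real d) \<le> real d powr \<kappa> / \<kappa>" using d \<kappa> by (intro ln_powr_bound) auto
      moreover have "1 \<le> real d powr \<kappa>" using d \<kappa> by (intro ge_one_powr_ge_zero) auto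
      ultimately have "l \<le> (1 + 1 / \<kappa>) * real d powr \<kappa>" by (simp add: l_def distrib_right)
      then have "12 * (C0 + 1) * (l * L) \<le> 12 * (C0 + 1) * ((1 + 1 / \<kappa>) * real d powr \<kappa> * L)"
        using C0 L by (intro mult_left_mono mult_right_mono) auto
      then show "12 * (C0 + 1) * (l * L) \<le> I * (L powr 1 * real d powr \<kappa>)" using L by (simp add: I_def mult_ac)
    qed
    also have "\<dots> \<le> (2 * G * \<gamma> * real d powr t + G * Dv + H * (L powr 0 * real d powr (t / 2))) + I * (L powr 1 * real d powr \<kappa>)"
      using L by (simp add: H_def algebra_simps)
    also have "\<dots> \<le> (\<eta> / 2 * Z + G * Dv + H * (\<eta> / (4 * H) * Z + D1)) + I * (\<eta> / (4 * I) * Z + D2)"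
    proof (intro add_mono mult_left_mono)
      have "2 * G * \<gamma> = \<eta> / 2" using G by (simp add: \<gamma>_def)
      then show "2 * G * \<gamma> * real d powr t \<le> \<eta> / 2 * Z"
        using mult_left_mono[OF dZ, of "\<eta> / 2"] \<eta> by (simp only:)
    qed (use D1 D2 L d G H I in \<open>auto simp: Z_def\<close>)
    also have "\<dots> = \<eta> * Z + (G * Dv + H * D1 + I * D2)" using H I by (simp add: field_simps)
    finally show ?thesis by (simp add: Z_def L_def)
  qed
  then show "\<exists>C. \<forall>\<epsilon> d. 0 < \<epsilon> \<longrightarrow> \<epsilon> < 1 \<longrightarrow> 1 \<le> d \<longrightarrow>
      ln (real (nstar cl cr \<omega> a b \<epsilon> d)) \<le> \<eta> * ((1 + ln (1 / \<epsilon>)) powr s + real d powr t) + C" by blast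
qed (use s t in auto)

end

section \<open>Necessary conditions\<close>

lemma filterlim_at_topI_pos:
  fixes f :: "nat \<Rightarrow> real"
  assumes "\<And>Z. 0 < Z \<Longrightarrow> eventually (\<lambda>j. Z \<le> f j) sequentially"
  shows "filterlim f at_top sequentially"
  by (rule filterlim_at_top_gt[THEN iffD2, of 0]) (use assms in blast)

lemma eventually_const_le_powr:
  fixes t C :: real
  assumes "0 < t"
  shows "eventually (\<lambda>d. C \<le> real d powr t) sequentially"
proof -
  have "eventually (\<lambda>d. max C 0 powr (1 / t) \<le> real d) sequentially"
    using filterlim_real_sequentially by (simp add: filterlim_at_top)
  then show ?thesis
  proof eventually_elim
    case (elim d)
    then have "(max C 0 powr (1 / t)) powr t \<le> real d powr t" using assms by (intro powr_mono2) auto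
    then show ?case using assms by (simp add: powr_powr)
  qed
qed

lemma eventually_const_le_ln: "eventually (\<lambda>d. C \<le> ln (real d)) sequentially"
proof -
  have "filterlim (\<lambda>d. ln (real d)) at_top sequentially"
    by (intro filterlim_compose[OF ln_at_top filterlim_real_sequentially])
  then show ?thesis by (simp add: filterlim_at_top)
qed

context korobov
begin

text \<open>At \<open>\<theta> = 1\<close> no weight is truncated, so for fixed
  \<open>\<epsilon> < 1\<close> the whole trace is at most a multiple of \<open>n\<close>.\<close>

lemma good_n_S_le:
  assumes "good_n cl cr \<omega> a b \<epsilon> d n" "0 < \<epsilon>"
  shows "S d 1 \<le> \<epsilon>\<^sup>2 * S d 1 + real n"
proof (rule has_sum_le_finite_sums[OF has_sum_w])
  fix F assume F: "finite F" "F \<subseteq> freqs d"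
  have "sum (w d) F = (\<Sum>h\<in>F. min (w d h) 1)" using w_le_1 by (simp add: min_def)
  then show "sum (w d) F \<le> \<epsilon>\<^sup>2 * S d 1 + real n"
    using good_n_lower_bound_finite[OF assms F, of 1] by simp
qed

text \<open>The weights exceeding \<open>\<theta>\<close> are absorbed by the sum of the \<open>p\<close>-th powers.
  With \<open>p\<close> close to 1, this compares \<open>ln n\<close> with the entropy of the normalised weights.\<close>

lemma good_n_S_le_power_sum:
  assumes "good_n cl cr \<omega> a b \<epsilon> d n" "0 < \<epsilon>" "0 < \<theta>" "1 < p"
  shows "S d 1 \<le> \<epsilon>\<^sup>2 * S d 1 + real n * \<theta> + \<theta> powr (1 - p) * S d p"
proof (rule has_sum_le_finite_sums[OF has_sum_w])
  fix F assume F: "finite F" "F \<subseteq> freqs d"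
  have "w d h \<le> min (w d h) \<theta> + \<theta> powr (1 - p) * w d h powr p" for h
  proof (cases "w d h \<le> \<theta>")
    case True
    then show ?thesis by simp
  next
    case False
    have "w d h = w d h powr (1 - p) * w d h powr p"
      using w_pos[of d h] by (simp flip: powr_add)
    also have "\<dots> \<le> \<theta> powr (1 - p) * w d h powr p"
      using False assms by (intro mult_right_mono powr_mono2') auto
    finally show ?thesis using assms w_pos[of d h] by (simp add: min_def add_increasing)
  qed
  then have "sum (w d) F \<le> (\<Sum>h\<in>F. min (w d h) \<theta> + \<theta> powr (1 - p) * w d h powr p)"
    by (intro sum_mono)
  also have "\<dots> = (\<Sum>h\<in>F. min (w d h) \<theta>) + \<theta> powr (1 - p) * (\<Sum>h\<in>F. w d h powr p)"
    by (simp add: sum.distrib sum_distrib_left)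
  also have "(\<Sum>h\<in>F. min (w d h) \<theta>) \<le> \<epsilon>\<^sup>2 * S d 1 + real n * \<theta>"
    using good_n_lower_bound_finite[OF assms(1,2) F, of \<theta>] assms by simp
  also have "(\<Sum>h\<in>F. w d h powr p) \<le> S d p"
    by (rule finite_sum_le_has_sum[OF has_sum_w_powr]) (use assms F in auto)
  finally show "sum (w d) F \<le> \<epsilon>\<^sup>2 * S d 1 + real n * \<theta> + \<theta> powr (1 - p) * S d p"
    by (simp add: mult_left_mono)
qed

text \<open>At \<open>\<theta> = exp (- (k * x d))\<close> every 0/1 vector with \<open>k\<close>
  ones has truncated weight exactly \<open>\<theta>\<close>, while the tolerance is at most
  \<open>\<theta> / 2\<close>. So there must be a functional for each of them.\<close>

lemma good_n_ge_binomial: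
  assumes good: "good_n cl cr \<omega> a b \<epsilon> d n" and \<epsilon>: "0 < \<epsilon>" and k: "1 \<le> k" "k \<le> d"
    and small: "\<epsilon>\<^sup>2 * S d 1 \<le> exp (- (real k * x d)) / 2"
  shows "(real d / real k) ^ k \<le> real n"
proof -
  define \<theta> where "\<theta> = exp (- (real k * x d))"
  define g where "g T = (\<lambda>i. if i \<in> T then 1 else 0 :: int)" for T :: "nat set"
  define B where "B = g ` {T. T \<subseteq> {1..d} \<and> card T = k}"
  have "inj g" by (rule injI) (metis g_def equalityI subsetI zero_neq_one)
  then have "card B = card {T. T \<subseteq> {1..d} \<and> card T = k}"
    unfolding B_def by (intro card_image) (auto intro: inj_on_subset)
  then have cardB: "card B = d choose k" by (simp add: n_subsets)
  have fin: "finite B" "B \<subseteq> freqs d" by (auto simp: B_def g_def freqs_def)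
  have w_ge: "\<theta> \<le> w d h" if h: "h \<in> B" for h
  proof -
    obtain T where T: "T \<subseteq> {1..d}" "card T = k" "h = g T" using h by (auto simp: B_def)
    have "(\<Sum>i=1..d. x i * \<bar>real_of_int (h i)\<bar> powr b i) = (\<Sum>i\<in>{1..d} \<inter> T. x i)"
      unfolding T(3) g_def by (subst sum.inter_restrict) (auto intro!: sum.cong)
    also have "{1..d} \<inter> T = T" using T by auto
    also have "(\<Sum>i\<in>T. x i) \<le> (\<Sum>i\<in>T. x d)" using T by (intro sum_mono x_mono) auto
    finally show ?thesis using T by (simp add: w_eq_exp \<theta>_def)
  qed
  have "(\<Sum>h\<in>B. min (w d h) \<theta>) = real (card B) * \<theta>" using w_ge by (simp add: min_absorb2)
  then have "real (card B) * \<theta> - real n * \<theta> \<le> \<theta> / 2"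
    using good_n_lower_bound_finite[OF good \<epsilon> fin, of \<theta>] small by (simp add: \<theta>_def)
  then have "(real (card B) - real n) * \<theta> \<le> 1 / 2 * \<theta>" by (simp add: left_diff_distrib)
  then have "real (card B) - real n \<le> 1 / 2" by (rule mult_right_le_imp_le) (simp add: \<theta>_def)
  \<comment> \<open>Both numbers are integers, so an excess of at most 1/2 is none.\<close>
  then have "card B \<le> n" by linarith
  moreover have "(real d / real k) ^ k \<le> real (d choose k)" by (rule binomial_ge_n_over_k_pow_k[OF k(2)])
  ultimately show ?thesis unfolding cardB by linarith
qed

lemma EXP_WT_bound:
  assumes "EXP_WT cl cr \<omega> a b s t" "0 < \<eta>"
  obtains M where "\<And>\<epsilon> d. 0 < \<epsilon> \<Longrightarrow> \<epsilon> < 1 \<Longrightarrow> 1 \<le> d \<Longrightarrow> M \<le> 1 / \<epsilon> + real d \<Longrightarrow>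
        ln (real (nstar cl cr \<omega> a b \<epsilon> d)) / ((1 + ln (1 / \<epsilon>)) powr s + real d powr t) \<le> \<eta>"
proof -
  have "\<exists>M. \<forall>\<epsilon> d. 0 < \<epsilon> \<longrightarrow> \<epsilon> < 1 \<longrightarrow> 1 \<le> d \<longrightarrow> M \<le> 1 / \<epsilon> + real d \<longrightarrow>
        ln (real (nstar cl cr \<omega> a b \<epsilon> d)) / ((1 + ln (1 / \<epsilon>)) powr s + real d powr t) \<le> \<eta>"
    using assms unfolding EXP_WT_def by blast
  then show ?thesis using that by blast
qed

text \<open>The bound covers all \<open>\<epsilon>\<close> at once for large \<open>d\<close>, so
  lower bounds may let \<open>\<epsilon>\<close> depend on \<open>d\<close>.\<close>

lemma EXP_WT_D:
  assumes "EXP_WT cl cr \<omega> a b s t" "0 < \<eta>"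
  shows "eventually (\<lambda>d. \<forall>\<epsilon>. 0 < \<epsilon> \<longrightarrow> \<epsilon> < 1 \<longrightarrow> (\<exists>n. good_n cl cr \<omega> a b \<epsilon> d n \<and>
      ln (real n) \<le> \<eta> * ((1 + ln (1 / \<epsilon>)) powr s + real d powr t))) sequentially"
proof -
  obtain M where M: "\<And>\<epsilon> d. 0 < \<epsilon> \<Longrightarrow> \<epsilon> < 1 \<Longrightarrow> d \<ge> 1 \<Longrightarrow> 1 / \<epsilon> + real d \<ge> M \<Longrightarrow>
        ln (real (nstar cl cr \<omega> a b \<epsilon> d)) / ((1 + ln (1 / \<epsilon>)) powr s + real d powr t) \<le> \<eta>"
    using EXP_WT_bound[OF assms] by blast
  have "eventually (\<lambda>d. M \<le> real d) sequentially"
    using filterlim_real_sequentially by (simp add: filterlim_at_top)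
  then show ?thesis using eventually_ge_at_top[of 1]
  proof eventually_elim
    case (elim d)
    show ?case
    proof (intro allI impI)
      fix \<epsilon> :: real assume \<epsilon>: "0 < \<epsilon>" "\<epsilon> < 1"
      have "0 < (1 + ln (1 / \<epsilon>)) powr s + real d powr t" using elim by (simp add: add_nonneg_pos)
      moreover have "1 / \<epsilon> + real d \<ge> M" using elim \<epsilon> by (simp add: add_increasing)
      ultimately have "ln (real (nstar cl cr \<omega> a b \<epsilon> d)) \<le> \<eta> * ((1 + ln (1 / \<epsilon>)) powr s + real d powr t)"
        using M[OF \<epsilon> elim(2)] by (simp add: divide_le_eq)
      moreover have "good_n cl cr \<omega> a b \<epsilon> d (nstar cl cr \<omega> a b \<epsilon> d)"
        unfolding nstar_def using exists_good_n_any[OF \<epsilon>] by (rule LeastI_ex)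
      ultimately show "\<exists>n. good_n cl cr \<omega> a b \<epsilon> d n \<and>
          ln (real n) \<le> \<eta> * ((1 + ln (1 / \<epsilon>)) powr s + real d powr t)" by blast
    qed
  qed
qed

text \<open>At fixed \<open>\<epsilon>\<close> the first summand of the denominator is a constant
  and is absorbed by \<open>d powr t\<close>.\<close>

lemma EXP_WT_half:
  assumes "EXP_WT cl cr \<omega> a b s t" "0 < s" "0 < t" "0 < \<eta>"
  shows "eventually (\<lambda>d. \<exists>n. good_n cl cr \<omega> a b (1 / 2) d n \<and> ln (real n) \<le> \<eta> * real d powr t) sequentially"
proof -
  have "eventually (\<lambda>d. \<forall>\<epsilon>. 0 < \<epsilon> \<longrightarrow> \<epsilon> < 1 \<longrightarrow> (\<exists>n. good_n cl cr \<omega> a b \<epsilon> d n \<and>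
      ln (real n) \<le> \<eta> / 2 * ((1 + ln (1 / \<epsilon>)) powr s + real d powr t))) sequentially"
    by (rule EXP_WT_D[OF assms(1)]) (use assms in simp)
  moreover have "eventually (\<lambda>d. (1 + ln 2) powr s \<le> real d powr t) sequentially"
    by (rule eventually_const_le_powr[OF assms(3)])
  ultimately show ?thesis
  proof eventually_elim
    case (elim d)
    obtain n where n: "good_n cl cr \<omega> a b (1 / 2) d n" "ln (real n) \<le> \<eta> / 2 * ((1 + ln (1 / (1 / 2))) powr s + real d powr t)"
      using elim(1)[rule_format, of "1 / 2"] by auto
    have "\<eta> / 2 * ((1 + ln (1 / (1 / 2))) powr s + real d powr t) \<le> \<eta> / 2 * (real d powr t + real d powr t)"
      using elim(2) assms by (intro mult_left_mono add_mono) auto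
    then show ?case using n by (intro exI[of _ n]) auto
  qed
qed

lemma EXP_WT_ln_S_le:
  assumes "EXP_WT cl cr \<omega> a b s t" "0 < s" "0 < t" "0 < \<eta>"
  shows "eventually (\<lambda>d. ln (S d 1) \<le> \<eta> * real d powr t) sequentially"
proof -
  have "eventually (\<lambda>d. \<exists>n. good_n cl cr \<omega> a b (1 / 2) d n \<and> ln (real n) \<le> \<eta> / 2 * real d powr t) sequentially"
    by (rule EXP_WT_half[OF assms(1-3)]) (use assms in simp)
  moreover have "eventually (\<lambda>d. 2 / \<eta> \<le> real d powr t) sequentially"
    by (rule eventually_const_le_powr[OF assms(3)])
  ultimately show ?thesis
  proof eventually_elim
    case (elim d)
    obtain n where n: "good_n cl cr \<omega> a b (1 / 2) d n" "ln (real n) \<le> \<eta> / 2 * real d powr t"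
      using elim(1) by blast
    have "S d 1 \<le> (1 / 2)\<^sup>2 * S d 1 + real n" by (rule good_n_S_le[OF n(1)]) simp
    then have "S d 1 / 2 \<le> real n" using S_ge_1[of 1 d] by (simp add: power2_eq_square)
    moreover have S: "1 \<le> S d 1" by (rule S_ge_1) simp
    ultimately have "ln (S d 1 / 2) \<le> ln (real n)" by (intro ln_mono) auto
    moreover have "ln (S d 1 / 2) = ln (S d 1) - ln 2" using S by (simp add: ln_divide_pos)
    moreover have "1 \<le> \<eta> / 2 * real d powr t" using elim(2) assms by (simp add: field_simps)
    ultimately show ?case using n(2) ln_2_less_1 by argo
  qed
qed

text \<open>With \<open>y = k * x d\<close> this is the largest \<open>\<epsilon>\<close> that the
  counting of 0/1 vectors permits. Its logarithm involves \<open>ln (S d 1)\<close>, which has to be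
  controlled separately.\<close>

lemma exists_small_\<epsilon>:
  assumes "0 \<le> y"
  obtains \<epsilon> where "0 < \<epsilon>" "\<epsilon> < 1" "\<epsilon>\<^sup>2 * S d 1 = exp (- y) / 2" "1 + ln (1 / \<epsilon>) \<le> 2 + y + ln (S d 1)"
proof -
  have S: "1 \<le> S d 1" by (rule S_ge_1) simp
  define q where "q = exp (- y) / (2 * S d 1)"
  have q0: "0 < q" using S by (simp add: q_def)
  have "exp (- y) \<le> 1" using assms by simp
  then have "exp (- y) < 2 * S d 1" using S by linarith
  then have q1: "q < 1" using S by (simp add: q_def)
  have "ln q = - y - (ln 2 + ln (S d 1))" using S by (simp add: q_def ln_divide_pos ln_mult_pos)
  moreover have "ln (1 / sqrt q) = - (ln q / 2)" using q0 by (simp add: ln_divide_pos ln_sqrt)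
  ultimately have "1 + ln (1 / sqrt q) = 1 + (y + (ln 2 + ln (S d 1))) / 2" by argo
  also have "\<dots> \<le> 2 + y + ln (S d 1)"
  proof -
    have "0 \<le> ln (S d 1)" using S by simp
    then show ?thesis using assms ln_2_less_1 by simp
  qed
  finally have "1 + ln (1 / sqrt q) \<le> 2 + y + ln (S d 1)" .
  moreover have "(sqrt q)\<^sup>2 * S d 1 = exp (- y) / 2" using q0 S by (simp add: q_def)
  ultimately show ?thesis using q0 q1 by (intro that[of "sqrt q"]) auto
qed

text \<open>At an index \<open>d\<close> violating the condition take \<open>k = d div 2\<close>: at
  least \<open>2 ^ k\<close> functionals are needed, yet \<open>L\<close> is at most of order
  \<open>d powr (1 / s)\<close>, which allows only a small multiple of \<open>d\<close> for
  \<open>ln n\<close>. The trivial bound \<open>ln (S d 1) <= C0 * d\<close> suffices.\<close>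

lemma EXP_WT_less_1_necessary:
  assumes wt: "EXP_WT cl cr \<omega> a b s t" and s: "0 < s" "s < 1" and t: "0 < t" "t \<le> 1"
  shows "filterlim (\<lambda>j. a j / real j powr ((1 - s) / s)) at_top sequentially"
proof (rule filterlim_at_topI_pos)
  fix Z :: real assume Z: "0 < Z"
  define C0 where "C0 = ln (theta (x 1) \<beta>)"
  have C0: "0 \<le> C0" using theta_ge_1[OF x_1_pos \<beta>] by (simp add: C0_def)
  define K where "K = 2 + - ln \<omega> * Z + C0"
  have "0 < - ln \<omega> * Z" using Z neg_ln_\<omega>_pos by (intro mult_pos_pos)
  then have K: "0 < K" using C0 unfolding K_def by linarith
  \<comment> \<open>Makes the allowed logarithm \<open>ln 2 / 4 * d\<close>, below the
    \<open>ln 2 / 3 * d\<close> enforced by \<open>k >= d / 3\<close>.\<close>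
  define \<eta> where "\<eta> = ln 2 / (4 * (K powr s + 1))"
  have \<eta>: "0 < \<eta>" by (simp add: \<eta>_def add_nonneg_pos)
  show "eventually (\<lambda>j. Z \<le> a j / real j powr ((1 - s) / s)) sequentially"
    using EXP_WT_D[OF wt \<eta>] eventually_ge_at_top[of 2]
  proof eventually_elim
    case (elim d)
    show ?case
    proof (rule ccontr)
      assume "\<not> Z \<le> a d / real d powr ((1 - s) / s)"
      then have ad: "a d \<le> Z * real d powr ((1 - s) / s)" using elim(2) by (simp add: field_simps)
      have d1: "1 \<le> real d" using elim(2) by simp
      define k where "k = d div 2"
      have k: "1 \<le> k" "k \<le> d" "2 * k \<le> d" "d \<le> 3 * k" using elim(2) by (auto simp: k_def)
      have "0 \<le> real k * x d" using x_pos[of d] elim(2) by simp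
      then obtain \<epsilon> where \<epsilon>: "0 < \<epsilon>" "\<epsilon> < 1" "\<epsilon>\<^sup>2 * S d 1 = exp (- (real k * x d)) / 2"
        "1 + ln (1 / \<epsilon>) \<le> 2 + real k * x d + ln (S d 1)" by (rule exists_small_\<epsilon>)
      obtain n where n: "good_n cl cr \<omega> a b \<epsilon> d n"
        "ln (real n) \<le> \<eta> * ((1 + ln (1 / \<epsilon>)) powr s + real d powr t)" using elim(1) \<epsilon> by blast
      have "ln (S d 1) = (\<Sum>k=1..d. ln (theta (1 * x k) (b k)))" by (rule ln_S) simp
      also have "\<dots> \<le> (\<Sum>k=1..d. C0)"
      proof (rule sum_mono)
        fix k assume k: "k \<in> {1..d}"
        have "theta (x k) (b k) \<le> theta (x 1) (b k)" using k x_1_pos x_mono[of 1 k] b_pos by (intro theta_antimono) auto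
        also have "\<dots> \<le> theta (x 1) \<beta>" using k x_1_pos b_ge \<beta> by (intro theta_antimono_exponent) auto
        finally show "ln (theta (1 * x k) (b k)) \<le> C0"
          unfolding C0_def using k theta_ge_1[of "x k" "b k"] x_pos b_pos by (intro ln_mono) auto
      qed
      finally have lnS: "ln (S d 1) \<le> C0 * real d" by (simp add: mult.commute)
      have dq: "real d * real d powr ((1 - s) / s) = real d powr (1 / s)"
      proof -
        have "real d powr 1 * real d powr ((1 - s) / s) = real d powr (1 / s)"
          unfolding powr_add[symmetric] using s by (simp add: field_simps)
        then show ?thesis using d1 by simp
      qed
      have "real d powr 1 \<le> real d powr (1 / s)" using d1 s by (intro powr_mono) auto
      then have dd: "real d \<le> real d powr (1 / s)" using d1 by simp
      have "x d \<le> - ln \<omega> * (Z * real d powr ((1 - s) / s))"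
        unfolding x_def using ad neg_ln_\<omega>_pos by (intro mult_left_mono) auto
      then have "real k * x d \<le> real d * (- ln \<omega> * (Z * real d powr ((1 - s) / s)))"
        using k x_pos[of d] elim(2) by (intro mult_mono) auto
      also have "\<dots> = - ln \<omega> * Z * (real d * real d powr ((1 - s) / s))" by (simp add: mult_ac)
      also have "\<dots> = - ln \<omega> * Z * real d powr (1 / s)" by (simp only: dq)
      finally have kx: "real k * x d \<le> - ln \<omega> * Z * real d powr (1 / s)" .
      have "C0 * real d \<le> C0 * real d powr (1 / s)" using dd C0 by (intro mult_left_mono)
      moreover have "2 \<le> 2 * real d powr (1 / s)" using dd d1 by linarith
      ultimately have "1 + ln (1 / \<epsilon>) \<le> K * real d powr (1 / s)"
        using \<epsilon>(4) kx lnS unfolding K_def distrib_right by linarith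
      then have "(1 + ln (1 / \<epsilon>)) powr s \<le> (K * real d powr (1 / s)) powr s"
        using \<epsilon> s by (intro powr_mono2) auto
      also have "\<dots> = K powr s * real d" using K d1 s by (simp add: powr_mult powr_powr)
      finally have L: "(1 + ln (1 / \<epsilon>)) powr s \<le> K powr s * real d" .
      have "real d powr t \<le> real d powr 1" using d1 t by (intro powr_mono) auto
      then have "real d powr t \<le> real d" using d1 by simp
      then have "ln (real n) \<le> \<eta> * (K powr s * real d + real d)"
        using n(2) L \<eta> by (meson add_mono mult_left_mono order_trans less_imp_le)
      also have "\<dots> = \<eta> * (K powr s + 1) * real d" by (simp add: algebra_simps)
      also have "\<eta> * (K powr s + 1) = ln 2 / 4"
      proof -
        have "K powr s + 1 \<noteq> 0" using powr_ge_zero[of K s] by linarith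
        moreover have "ln 2 / (4 * V) * V = ln 2 / 4" if "V \<noteq> 0" for V :: real using that by simp
        ultimately show ?thesis unfolding \<eta>_def by blast
      qed
      finally have up: "ln (real n) \<le> ln 2 / 4 * real d" .
      have "(2::real) ^ k \<le> (real d / real k) ^ k" using k by (intro power_mono) (auto simp: field_simps)
      also have "\<dots> \<le> real n" by (rule good_n_ge_binomial[OF n(1) \<epsilon>(1) k(1,2)]) (simp add: \<epsilon>(3))
      finally have "ln (2 ^ k) \<le> ln (real n)" by (intro ln_mono) auto
      then have low: "real k * ln 2 \<le> ln (real n)" by (simp add: ln_realpow)
      have "real d / 3 * ln 2 \<le> real k * ln 2" using k by (intro mult_right_mono) auto
      then have "real d / 3 * ln 2 \<le> ln 2 / 4 * real d" using up low by linarith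
      then show False using d1 by (simp add: field_simps)
    qed
  qed
qed

text \<open>At a violating index take \<open>k\<close> near \<open>d powr t'\<close> with
  \<open>t < t' < 1\<close>. Then \<open>d / k\<close> is still a power of \<open>d\<close>, so
  \<open>ln n\<close> is at least a multiple of \<open>k * ln d\<close>, while \<open>L\<close> is
  at most a multiple of the same quantity. A linear bound on \<open>ln (S d 1)\<close> would be too
  weak here; tractability at fixed \<open>\<epsilon>\<close> gives \<open>d powr t\<close>.\<close>

lemma EXP_WT_1_necessary:
  assumes wt: "EXP_WT cl cr \<omega> a b 1 t" and t: "0 < t" "t < 1"
  shows "filterlim (\<lambda>j. a j / ln (real j)) at_top sequentially"
proof (rule filterlim_at_topI_pos)
  fix Z :: real assume Z: "0 < Z"
  define c where "c = - ln \<omega> * Z + 4"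
  have "0 < - ln \<omega> * Z" using Z neg_ln_\<omega>_pos by (intro mult_pos_pos)
  then have c: "0 < c" unfolding c_def by linarith
  define t' where "t' = (1 + t) / 2"
  have t': "t < t'" "t' < 1" "0 < t'" using t by (auto simp: t'_def)
  define \<eta> where "\<eta> = (1 - t') / (4 * c)"
  have \<eta>: "0 < \<eta>" using t' c by (simp add: \<eta>_def)
  show "eventually (\<lambda>j. Z \<le> a j / ln (real j)) sequentially"
    using EXP_WT_D[OF wt \<eta>] EXP_WT_ln_S_le[OF wt _ t(1), of 1, OF zero_less_one zero_less_one] eventually_const_le_ln[of 1]
      eventually_const_le_ln[of "2 * ln 2 / (1 - t')"] eventually_ge_at_top[of 2]
  proof eventually_elim
    case (elim d)
    have ln1: "1 \<le> ln (real d)" using elim(3) .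
    have d1: "1 \<le> real d" using elim(5) by simp
    show ?case
    proof (rule ccontr)
      assume "\<not> Z \<le> a d / ln (real d)"
      then have "a d / ln (real d) < Z" by simp
      then have ad: "a d \<le> Z * ln (real d)" using ln1 by (simp add: divide_less_eq)
      define k where "k = nat \<lceil>real d powr t'\<rceil>"
      have dt': "1 \<le> real d powr t'" using d1 t' by (intro ge_one_powr_ge_zero) auto
      have kd: "real d powr t' \<le> real k" "real k \<le> 2 * real d powr t'" unfolding k_def using dt' by linarith+
      have "real d powr t' \<le> real d powr 1" using d1 t' by (intro powr_mono) auto
      then have "real d powr t' \<le> real d" using d1 by simp
      then have "\<lceil>real d powr t'\<rceil> \<le> int d" by (simp add: ceiling_le_iff)
      then have "k \<le> d" unfolding k_def by linarith
      moreover have k1: "1 \<le> real k" using kd dt' by linarith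
      ultimately have k: "1 \<le> k" "k \<le> d" by auto
      have "0 \<le> real k * x d" using x_pos[of d] elim(5) by simp
      then obtain \<epsilon> where \<epsilon>: "0 < \<epsilon>" "\<epsilon> < 1" "\<epsilon>\<^sup>2 * S d 1 = exp (- (real k * x d)) / 2"
        "1 + ln (1 / \<epsilon>) \<le> 2 + real k * x d + ln (S d 1)" by (rule exists_small_\<epsilon>)
      obtain n where n: "good_n cl cr \<omega> a b \<epsilon> d n"
        "ln (real n) \<le> \<eta> * ((1 + ln (1 / \<epsilon>)) powr 1 + real d powr t)" using elim(1) \<epsilon> by blast
      define Q where "Q = real k * ln (real d)"
      have "1 * 1 \<le> real k * ln (real d)" "real k * 1 \<le> real k * ln (real d)"
        using k1 ln1 by (intro mult_mono mult_left_mono; simp)+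
      then have Q: "1 \<le> Q" "real k \<le> Q" by (auto simp: Q_def)
      have "real d powr t \<le> real d powr t'" using d1 t' by (intro powr_mono) auto
      then have dt: "real d powr t \<le> Q" using kd Q by linarith
      have "x d \<le> - ln \<omega> * (Z * ln (real d))"
        unfolding x_def using ad neg_ln_\<omega>_pos by (intro mult_left_mono) auto
      then have "real k * x d \<le> real k * (- ln \<omega> * (Z * ln (real d)))" by (intro mult_left_mono) auto
      also have "\<dots> = - ln \<omega> * Z * Q" by (simp add: Q_def mult_ac)
      finally have kx: "real k * x d \<le> - ln \<omega> * Z * Q" .
      have "(1 + ln (1 / \<epsilon>)) powr 1 = 1 + ln (1 / \<epsilon>)" using \<epsilon> by simp
      also have "\<dots> \<le> 2 * Q + - ln \<omega> * Z * Q + Q" using \<epsilon>(4) kx elim(2) dt Q(1) by linarith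
      finally have "(1 + ln (1 / \<epsilon>)) powr 1 + real d powr t \<le> c * Q" using dt by (simp add: c_def algebra_simps)
      then have "\<eta> * ((1 + ln (1 / \<epsilon>)) powr 1 + real d powr t) \<le> \<eta> * (c * Q)" using \<eta> by (intro mult_left_mono) auto
      also have "\<dots> = (1 - t') / 4 * Q" using c by (simp add: \<eta>_def)
      finally have up: "ln (real n) \<le> (1 - t') / 4 * Q" using n(2) by linarith
      have "(real d / real k) ^ k \<le> real n" by (rule good_n_ge_binomial[OF n(1) \<epsilon>(1) k]) (simp add: \<epsilon>(3))
      then have "ln ((real d / real k) ^ k) \<le> ln (real n)" using k d1 by (intro ln_mono) auto
      then have low: "real k * ln (real d / real k) \<le> ln (real n)" by (simp add: ln_realpow)
      have "ln (real k) \<le> ln (2 * real d powr t')" using kd(2) k by (intro ln_mono) auto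
      also have "\<dots> = ln 2 + t' * ln (real d)" using d1 by (simp add: ln_mult_pos)
      finally have "ln (real d / real k) \<ge> (1 - t') * ln (real d) - ln 2"
        using k d1 by (simp add: ln_divide_pos algebra_simps)
      moreover have "ln 2 \<le> (1 - t') / 2 * ln (real d)" using elim(4) t' by (simp add: field_simps)
      ultimately have "(1 - t') / 2 * ln (real d) \<le> ln (real d / real k)" by argo
      then have "real k * ((1 - t') / 2 * ln (real d)) \<le> real k * ln (real d / real k)" by (intro mult_left_mono) auto
      then have "(1 - t') / 2 * Q \<le> (1 - t') / 4 * Q" using up low by (simp add: Q_def mult_ac)
      moreover have "0 < (1 - t') * Q" using Q t' by simp
      ultimately show False by (simp add: mult.commute)
    qed
  qed
qed

text \<open>Each of the first \<open>d\<close> coordinates adds at least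
  \<open>2 / 3 * exp (- x d)\<close> to \<open>ln (S d 1)\<close>, which tractability keeps below
  \<open>d powr t / 2\<close>.\<close>

lemma EXP_WT_exp_x_le:
  assumes wt: "EXP_WT cl cr \<omega> a b s t" and st: "0 < s" "0 < t"
  shows "eventually (\<lambda>d. (1 - t) * ln (real d) \<le> x d) sequentially"
  using EXP_WT_ln_S_le[OF wt st, of "1 / 2", simplified] eventually_ge_at_top[of 1]
proof eventually_elim
  case (elim d)
  have d: "0 < real d" using elim(2) by simp
  define E where "E = exp (- x d)"
  have E: "0 < E" "E \<le> 1" using x_pos[of d] elim(2) by (auto simp: E_def)
  have "real d * (2 / 3 * E) = (\<Sum>k=1..d. 2 / 3 * E)" by simp
  also have "\<dots> \<le> (\<Sum>k=1..d. ln (theta (1 * x k) (b k)))"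
  proof (rule sum_mono)
    fix k assume k: "k \<in> {1..d}"
    have "1 + 2 * exp (- x k) \<le> theta (x k) (b k)" using k x_pos b_pos by (intro theta_ge) auto
    moreover have "E \<le> exp (- x k)" unfolding E_def using x_mono[of k d] k by auto
    ultimately have th: "1 + 2 * E \<le> theta (x k) (b k)" by linarith
    have "2 * E / 3 \<le> 2 * E / (1 + 2 * E)" using E by (intro divide_left_mono) auto
    also have "\<dots> = 1 - 1 / (1 + 2 * E)" using E by (simp add: field_simps)
    also have "\<dots> \<le> ln (1 + 2 * E)"
      using ln_le_minus_one[of "1 / (1 + 2 * E)"] E by (simp add: ln_divide_pos)
    also have "\<dots> \<le> ln (theta (x k) (b k))" using th E by (intro ln_mono) auto
    finally show "2 / 3 * E \<le> ln (theta (1 * x k) (b k))" by simp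
  qed
  also have "\<dots> = ln (S d 1)" by (rule ln_S[symmetric]) simp
  finally have "real d * (2 / 3 * E) \<le> real d powr t / 2" using elim(1) by linarith
  then have "4 * (real d * E) \<le> 3 * real d powr t" by simp
  then have "real d * E \<le> real d powr t" using powr_ge_zero[of "real d" t] by linarith
  then have "ln (real d * E) \<le> ln (real d powr t)" using d E by (intro ln_mono) auto
  then have "ln (real d) + - x d \<le> t * ln (real d)" using d by (simp add: ln_mult_pos E_def)
  then show ?case by (simp add: algebra_simps)
qed

text \<open>The order \<open>p = 1 + 1 / ln d\<close> multiplies the drop of \<open>ln S\<close>
  between orders 1 and \<open>p\<close> by \<open>1 / (p - 1) = ln d\<close>. The drop is at least a
  multiple of \<open>d * exp (- x d)\<close>: for \<open>k > d / 2\<close> the crude growth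
  \<open>x k >= (1 - t) * ln k\<close> keeps \<open>(p - 1) * x k\<close> away from 0.\<close>

lemma EXP_WT_entropy_bound:
  assumes wt: "EXP_WT cl cr \<omega> a b s t" and st: "0 < s" "0 < t" "t < 1" and \<eta>: "0 < \<eta>"
  shows "eventually (\<lambda>d. real d powr (1 - t) * exp (- x d) * ln (real d) \<le> \<eta>) sequentially"
proof -
  \<comment> \<open>\<open>(1 - t) / 2\<close> is the lower bound for \<open>(p - 1) * x k\<close>
    in the upper half of the coordinates.\<close>
  define \<kappa> where "\<kappa> = exp (- ((1 - t) / 2))"
  have \<kappa>: "\<kappa> < 1" using st by (simp add: \<kappa>_def)
  define c where "c = (1 - \<kappa>) / 3"
  have c: "0 < c" using \<kappa> by (simp add: c_def)
  define \<gamma> where "\<gamma> = c * \<eta> / 2"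
  have \<gamma>: "0 < \<gamma>" using c \<eta> by (simp add: \<gamma>_def)
  obtain D where D: "\<And>k. D \<le> k \<Longrightarrow> (1 - t) * ln (real k) \<le> x k"
    using EXP_WT_exp_x_le[OF wt st(1,2)] by (auto simp: eventually_sequentially)
  have "(\<lambda>d. ln (real d) / real d powr t) \<longlonglongrightarrow> 0" by (rule lim_ln_over_power[OF st(2)])
  then have "eventually (\<lambda>d. ln (real d) / real d powr t < \<gamma> / 3) sequentially"
    using \<gamma> by (intro order_tendstoD) auto
  with EXP_WT_half[OF wt st(1,2) \<gamma>] show ?thesis
    using eventually_const_le_ln[of 2] eventually_ge_at_top[of "2 * D"] eventually_ge_at_top[of 1]
  proof eventually_elim
    case (elim d)
    have d: "0 < real d" using elim(5) by simp
    have l: "2 \<le> ln (real d)" using elim(3) .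
    define E where "E = exp (- x d)"
    define p where "p = 1 + 1 / ln (real d)"
    have p: "1 < p" "p - 1 = 1 / ln (real d)" using l by (auto simp: p_def)
    obtain n where n: "good_n cl cr \<omega> a b (1 / 2) d n" "ln (real n) \<le> \<gamma> * real d powr t" using elim(1) by blast
    have S1: "1 \<le> S d 1" "1 \<le> S d p" using S_ge_1 p by auto
    have diff: "c * (real d * E) \<le> ln (S d 1) - ln (S d p)"
    proof -
      let ?f = "\<lambda>k. ln (theta (1 * x k) (b k)) - ln (theta (p * x k) (b k))"
      have nonneg: "0 \<le> ?f k" if k: "k \<in> {1..d}" for k
      proof -
        have xk: "0 < x k" "0 < b k" using k x_pos b_pos by auto
        then have "theta (p * x k) (b k) \<le> theta (x k) (b k)" using p by (intro theta_antimono) auto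
        moreover have "1 \<le> theta (p * x k) (b k)" using xk p by (intro theta_ge_1) auto
        ultimately show ?thesis by simp
      qed
      have large: "(1 - \<kappa>) * (2 / 3) * E \<le> ?f k" if k: "k \<in> {Suc (d div 2)..d}" for k
      proof -
        have kD: "D \<le> k" "1 \<le> k" "k \<le> d" "d \<le> 2 * k" using k elim(4) by auto
        have "ln (real d) \<le> ln (2 * real k)" using d kD by (intro ln_mono) auto
        also have "\<dots> = ln 2 + ln (real k)" using kD by (simp add: ln_mult_pos)
        finally have "ln (real d) / 2 \<le> ln (real k)" using l ln_2_less_1 by linarith
        then have "(1 - t) * (ln (real d) / 2) \<le> (1 - t) * ln (real k)" using st by (intro mult_left_mono) auto
        then have "(1 - t) * (ln (real d) / 2) \<le> x k" using D[OF kD(1)] by linarith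
        then have "(1 - t) / 2 \<le> (p - 1) * x k" using l unfolding p(2) by (simp add: field_simps)
        then have "exp (- ((p - 1) * x k)) \<le> \<kappa>" by (simp add: \<kappa>_def)
        then have "(1 - \<kappa>) * (2 / 3) * exp (- x k) \<le> ln (theta (x k) (b k)) - ln (theta (p * x k) (b k))"
          using x_pos[OF kD(2)] b_pos[OF kD(2)] p \<kappa> by (intro ln_theta_scale_diff) auto
        moreover have "(1 - \<kappa>) * (2 / 3) * E \<le> (1 - \<kappa>) * (2 / 3) * exp (- x k)"
          unfolding E_def using x_mono[of k d] kD \<kappa> by (intro mult_left_mono) auto
        ultimately show ?thesis by simp
      qed
      have "d \<le> 2 * (d - d div 2)" by simp
      then have "real d / 2 \<le> real (d - d div 2)" by linarith
      then have "real d / 2 * ((1 - \<kappa>) * (2 / 3) * E) \<le> real (d - d div 2) * ((1 - \<kappa>) * (2 / 3) * E)"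
        using \<kappa> by (intro mult_right_mono) (auto simp: E_def)
      also have "\<dots> = (\<Sum>k=Suc (d div 2)..d. (1 - \<kappa>) * (2 / 3) * E)" by simp
      also have "\<dots> \<le> (\<Sum>k=Suc (d div 2)..d. ?f k)" by (intro sum_mono large)
      also have "\<dots> \<le> (\<Sum>k=1..d. ?f k)" by (rule sum_mono2) (use nonneg in auto)
      also have "\<dots> = ln (S d 1) - ln (S d p)" using p by (simp add: ln_S sum_subtractf)
      finally have "real d / 2 * ((1 - \<kappa>) * (2 / 3) * E) \<le> ln (S d 1) - ln (S d p)" .
      moreover have "real d / 2 * ((1 - \<kappa>) * (2 / 3) * E) = c * (real d * E)" unfolding c_def by (simp add: field_simps)
      ultimately show ?thesis by (simp only:)
    qed
    \<comment> \<open>Solves \<open>\<theta> powr (1 - p) * S d p = S d 1 / 4\<close>. With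
      \<open>\<epsilon> ^ 2 = 1 / 4\<close> this leaves half of \<open>S d 1\<close> to be covered
      by \<open>n * \<theta>\<close>.\<close>
    define \<theta> where "\<theta> = (4 * S d p / S d 1) powr (ln (real d))"
    have q: "0 < 4 * S d p / S d 1" using S1 by simp
    have \<theta>: "0 < \<theta>" unfolding \<theta>_def using q by (subst powr_gt_zero) auto
    have "\<theta> powr (1 - p) = (4 * S d p / S d 1) powr (- 1)"
      unfolding \<theta>_def powr_powr using p l by (simp add: algebra_simps)
    also have "\<dots> = S d 1 / (4 * S d p)" unfolding powr_minus using S1 by (simp add: field_simps)
    finally have "\<theta> powr (1 - p) * S d p = S d 1 / 4" using S1 by simp
    then have "S d 1 \<le> (1 / 2)\<^sup>2 * S d 1 + real n * \<theta> + S d 1 / 4"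
      using good_n_S_le_power_sum[OF n(1) _ \<theta> p(1)] by simp
    then have n\<theta>: "1 / 2 \<le> real n * \<theta>" using S1 by (simp add: power2_eq_square)
    then have n0: "0 < real n" using \<theta> by (cases "n = 0") auto
    have "ln (1 / 2) \<le> ln (real n * \<theta>)" using n\<theta> by (intro ln_mono) auto
    also have "\<dots> = ln (real n) + ln \<theta>" using n0 \<theta> by (simp add: ln_mult_pos)
    also have "ln \<theta> = ln (real d) * (ln 4 + ln (S d p) - ln (S d 1))"
      unfolding \<theta>_def using S1 by (simp add: ln_divide_pos ln_mult_pos)
    finally have "ln (real d) * (ln (S d 1) - ln (S d p)) \<le> ln (real n) + ln (real d) * ln 4 + ln 2"
      by (simp add: ln_divide_pos algebra_simps)
    moreover have "ln (real d) * (c * (real d * E)) \<le> ln (real d) * (ln (S d 1) - ln (S d p))"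
      using diff l by (intro mult_left_mono) auto
    moreover have "ln (real d) * ln 4 \<le> ln (real d) * 2"
    proof (rule mult_left_mono)
      have "ln (4::real) = 2 * ln 2" using ln_realpow[of 2 2] by simp
      then show "ln (4::real) \<le> 2" using ln_2_less_1 by simp
    qed (use l in simp)
    moreover have "3 * ln (real d) \<le> \<gamma> * real d powr t" using elim(2) d by (simp add: field_simps)
    ultimately have "ln (real d) * (c * (real d * E)) \<le> 2 * \<gamma> * real d powr t"
      using n(2) l ln_2_less_1 by linarith
    then have "c * (real d * E * ln (real d)) \<le> c * (\<eta> * real d powr t)" by (simp add: \<gamma>_def mult_ac)
    then have up: "real d * E * ln (real d) \<le> \<eta> * real d powr t" using c by (simp add: mult_le_cancel_left_pos)
    have "real d powr (1 - t) * exp (- x d) * ln (real d) = real d * E * ln (real d) / real d powr t"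
      using d by (simp add: powr_diff E_def)
    also have "\<dots> \<le> \<eta>" using up d by (simp add: pos_divide_le_eq)
    finally show ?case .
  qed
qed

text \<open>Exchanges \<open>ln j\<close> for \<open>x j\<close>: direct for
  \<open>x j <= 2 * ln j\<close>, and otherwise \<open>x j <= exp (x j / 2)\<close> bounds the whole
  term by \<open>j powr (- t)\<close>.\<close>

lemma EXP_WT_greater_1_necessary:
  assumes wt: "EXP_WT cl cr \<omega> a b s t" and st: "0 < s" "0 < t" "t < 1"
  shows "(\<lambda>j. real j powr (1 - t) * a j * \<omega> powr (a j)) \<longlonglongrightarrow> 0"
proof -
  let ?f = "\<lambda>j. real j powr (1 - t) * exp (- x j) * ln (real j)"
  have f0: "eventually (\<lambda>j. 0 \<le> ?f j) sequentially"
    using eventually_ge_at_top[of 1] by eventually_elim auto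
  have flim: "?f \<longlonglongrightarrow> 0"
  proof (rule order_tendstoI)
    fix y :: real assume "y < 0"
    with f0 show "eventually (\<lambda>j. y < ?f j) sequentially" by (auto elim: eventually_mono)
  next
    fix y :: real assume "0 < y"
    then have "eventually (\<lambda>j. ?f j \<le> y / 2) sequentially" by (intro EXP_WT_entropy_bound[OF wt st]) auto
    then show "eventually (\<lambda>j. ?f j < y) sequentially"
      by eventually_elim (use \<open>0 < y\<close> in linarith)
  qed
  have glim: "(\<lambda>j. real j powr (- t)) \<longlonglongrightarrow> 0"
    using st by (intro tendsto_neg_powr filterlim_real_sequentially) auto
  have "(\<lambda>j. real j powr (1 - t) * exp (- x j) * x j) \<longlonglongrightarrow> 0"
  proof (rule tendsto_sandwich[of "\<lambda>_. 0"])
    show "(\<lambda>j. 2 * ?f j + real j powr (- t)) \<longlonglongrightarrow> 0"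
      using tendsto_add[OF tendsto_mult_right_zero[OF flim, of 2] glim] by simp
    show "eventually (\<lambda>j. real j powr (1 - t) * exp (- x j) * x j \<le> 2 * ?f j + real j powr (- t)) sequentially"
      using eventually_ge_at_top[of 1]
    proof eventually_elim
      case (elim j)
      have j: "0 < real j" using elim by simp
      show ?case
      proof (cases "x j \<le> 2 * ln (real j)")
        case True
        then have "real j powr (1 - t) * exp (- x j) * x j \<le> real j powr (1 - t) * exp (- x j) * (2 * ln (real j))"
          by (intro mult_left_mono) auto
        then show ?thesis by (simp add: mult_ac add_increasing2)
      next
        case False
        have "x j / 2 \<le> exp (x j / 2 - 1)" using exp_ge_add_one_self[of "x j / 2 - 1"] by simp
        moreover have "exp (x j / 2 - 1) = exp (x j / 2) * exp (- 1)" unfolding exp_add[symmetric] by simp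
        ultimately have "x j \<le> exp (x j / 2) * (2 * exp (- 1))" by linarith
        also have "\<dots> \<le> exp (x j / 2) * 1"
          using exp_ge_add_one_self[of 1] by (intro mult_left_mono) (auto simp: exp_minus field_simps)
        finally have "exp (- x j) * x j \<le> exp (- x j) * exp (x j / 2)" by (intro mult_left_mono) auto
        also have "\<dots> = exp (- (x j / 2))" by (simp flip: exp_add)
        also have "\<dots> \<le> exp (- ln (real j))" using False by simp
        also have "\<dots> = 1 / real j" using j by (simp add: exp_minus inverse_eq_divide)
        finally have "real j powr (1 - t) * (exp (- x j) * x j) \<le> real j powr (1 - t) * (1 / real j)"
          by (intro mult_left_mono) auto
        also have "\<dots> = real j powr (- t)" using j by (simp add: powr_diff powr_minus field_simps)
        finally show ?thesis using elim by (simp add: mult.assoc add_increasing)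
      qed
    qed
    show "eventually (\<lambda>j. 0 \<le> real j powr (1 - t) * exp (- x j) * x j) sequentially"
      using eventually_ge_at_top[of 1] by eventually_elim (use x_pos in \<open>auto simp: less_imp_le\<close>)
  qed auto
  then have "(\<lambda>j. 1 / (- ln \<omega>) * (real j powr (1 - t) * exp (- x j) * x j)) \<longlonglongrightarrow> 0"
    by (rule tendsto_mult_right_zero)
  moreover have "1 / (- ln \<omega>) * (real j powr (1 - t) * exp (- x j) * x j) = real j powr (1 - t) * a j * \<omega> powr (a j)" for j
    using neg_ln_\<omega>_pos by (simp add: \<omega>_powr_a) (simp add: x_def)
  ultimately show ?thesis by simp
qed

section \<open>Uniform weak tractability\<close>

text \<open>Since \<open>1 + ln (1 / \<epsilon>) >= 1\<close>, a larger exponent only enlarges the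
  denominator.\<close>

lemma EXP_WT_mono:
  assumes "EXP_WT cl cr \<omega> a b s t" "s \<le> s'"
  shows "EXP_WT cl cr \<omega> a b s' t"
  unfolding EXP_WT_def
proof (intro conjI allI impI)
  show "\<exists>n. good_n cl cr \<omega> a b \<epsilon> d n" if "0 < \<epsilon>" "\<epsilon> < 1" for \<epsilon> d
    using exists_good_n_any that by blast
next
  fix \<eta> :: real assume \<eta>: "0 < \<eta>"
  obtain M where M: "\<And>\<epsilon> d. 0 < \<epsilon> \<Longrightarrow> \<epsilon> < 1 \<Longrightarrow> d \<ge> 1 \<Longrightarrow> 1 / \<epsilon> + real d \<ge> M \<Longrightarrow>
        ln (real (nstar cl cr \<omega> a b \<epsilon> d)) / ((1 + ln (1 / \<epsilon>)) powr s + real d powr t) \<le> \<eta>"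
    using EXP_WT_bound[OF assms(1) \<eta>] by blast
  have "ln (real (nstar cl cr \<omega> a b \<epsilon> d)) / ((1 + ln (1 / \<epsilon>)) powr s' + real d powr t) \<le> \<eta>"
    if \<epsilon>: "0 < \<epsilon>" "\<epsilon> < 1" and d: "1 \<le> d" and "M \<le> 1 / \<epsilon> + real d" for \<epsilon> d
  proof (rule order_trans[OF divide_left_mono M[OF that]])
    show "(1 + ln (1 / \<epsilon>)) powr s + real d powr t \<le> (1 + ln (1 / \<epsilon>)) powr s' + real d powr t"
      using \<epsilon> assms by (intro add_right_mono powr_mono) auto
    \<comment> \<open>For \<open>nstar = 0\<close> the logarithm is 0 by convention.\<close>
    show "0 \<le> ln (real (nstar cl cr \<omega> a b \<epsilon> d))" by (cases "nstar cl cr \<omega> a b \<epsilon> d = 0") auto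
    show "0 < ((1 + ln (1 / \<epsilon>)) powr s' + real d powr t) * ((1 + ln (1 / \<epsilon>)) powr s + real d powr t)"
      using d by (intro mult_pos_pos add_nonneg_pos) auto
  qed
  then show "\<exists>M. \<forall>\<epsilon> d. 0 < \<epsilon> \<longrightarrow> \<epsilon> < 1 \<longrightarrow> 1 \<le> d \<longrightarrow> M \<le> 1 / \<epsilon> + real d \<longrightarrow>
      ln (real (nstar cl cr \<omega> a b \<epsilon> d)) / ((1 + ln (1 / \<epsilon>)) powr s' + real d powr t) \<le> \<eta>"
    by blast
qed

text \<open>Superpolynomial growth in two forms. As \<open>(1 - s) / s\<close> takes every positive
  value for \<open>0 < s < 1\<close>, the second form links the uniform notion to the case
  \<open>s < 1\<close>.\<close>

lemma ln_a_over_ln_iff: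
  "filterlim (\<lambda>j. ln (a j) / ln (real j)) at_top sequentially \<longleftrightarrow>
   (\<forall>q>0. filterlim (\<lambda>j. a j / real j powr q) at_top sequentially)"
proof (intro iffI allI impI)
  fix q :: real assume lim: "filterlim (\<lambda>j. ln (a j) / ln (real j)) at_top sequentially" and q: "0 < q"
  show "filterlim (\<lambda>j. a j / real j powr q) at_top sequentially"
  proof (rule filterlim_at_top_mono)
    show "filterlim real at_top sequentially" by (rule filterlim_real_sequentially)
    have "eventually (\<lambda>j. q + 1 \<le> ln (a j) / ln (real j)) sequentially"
      using lim by (simp add: filterlim_at_top)
    then show "eventually (\<lambda>j. real j \<le> a j / real j powr q) sequentially"
      using eventually_gt_at_top[of 1]
    proof eventually_elim
      case (elim j)
      then have "0 < ln (real j)" by simp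
      then have "(q + 1) * ln (real j) \<le> ln (a j)" using elim(1) pos_le_divide_eq by blast
      then have "real j powr (q + 1) \<le> a j"
        using elim(2) a_pos[of j] by (simp add: powr_def ln_ge_iff)
      then show ?case using elim(2) by (simp add: pos_le_divide_eq powr_add mult.commute)
    qed
  qed
next
  assume lim: "\<forall>q>0. filterlim (\<lambda>j. a j / real j powr q) at_top sequentially"
  show "filterlim (\<lambda>j. ln (a j) / ln (real j)) at_top sequentially"
  proof (rule filterlim_at_topI_pos)
    fix Z :: real assume "0 < Z"
    then have "eventually (\<lambda>j. 1 \<le> a j / real j powr Z) sequentially"
      using lim by (simp add: filterlim_at_top)
    then show "eventually (\<lambda>j. Z \<le> ln (a j) / ln (real j)) sequentially"
      using eventually_gt_at_top[of 1]
    proof eventually_elim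
      case (elim j)
      have "real j powr Z \<le> a j" using elim by (simp add: pos_le_divide_eq)
      then have "ln (real j powr Z) \<le> ln (a j)" using elim by (intro ln_mono) auto
      then have "Z * ln (real j) \<le> ln (a j)" by simp
      moreover have "0 < ln (real j)" using elim by simp
      ultimately show ?case using pos_le_divide_eq by blast
    qed
  qed
qed

lemma EXP_UWT_iff:
  "EXP_UWT cl cr \<omega> a b \<longleftrightarrow> filterlim (\<lambda>j. ln (a j) / ln (real j)) at_top sequentially"
  unfolding ln_a_over_ln_iff
proof (intro iffI allI impI)
  fix q :: real assume uwt: "EXP_UWT cl cr \<omega> a b" and q: "0 < q"
  \<comment> \<open>Solves \<open>(1 - s) / s = q\<close>.\<close>
  define s where "s = 1 / (1 + q)"
  have s: "0 < s" "s < 1" "(1 - s) / s = q" using q by (auto simp: s_def field_simps)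
  have "EXP_WT cl cr \<omega> a b s 1" using uwt s by (simp add: EXP_UWT_def)
  from EXP_WT_less_1_necessary[OF this s(1,2)] show "filterlim (\<lambda>j. a j / real j powr q) at_top sequentially"
    by (simp add: s(3))
next
  assume lim: "\<forall>q>0. filterlim (\<lambda>j. a j / real j powr q) at_top sequentially"
  show "EXP_UWT cl cr \<omega> a b"
    unfolding EXP_UWT_def
  proof (intro allI impI)
    fix \<alpha> \<beta>' :: real assume \<alpha>: "0 < \<alpha>" "0 < \<beta>'"
    \<comment> \<open>The growth criterion applies to \<open>s < 1\<close>; larger exponents follow
      by monotonicity.\<close>
    define s where "s = min \<alpha> (1 / 2)"
    have s: "0 < s" "s < 1" "s \<le> \<alpha>" using \<alpha> by (auto simp: s_def)
    have "0 < (1 - s) / s" using s by simp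
    then have "EXP_WT cl cr \<omega> a b s \<beta>'" using lim \<alpha> s by (intro EXP_WT_less_1_sufficient) auto
    then show "EXP_WT cl cr \<omega> a b \<alpha> \<beta>'" using s(3) by (rule EXP_WT_mono)
  qed
qed

end

theorem theorem5p8:
  fixes \<omega> :: real and a b :: "nat \<Rightarrow> real" and cl :: info_class and cr :: err_crit
  assumes "0 < \<omega>" and "\<omega> < 1"
    and "0 < a 1" and "\<And>j. j \<ge> 1 \<Longrightarrow> a j \<le> a (Suc j)"
    and "\<exists>\<beta>>0. \<forall>i\<ge>1. b i \<ge> \<beta>"
  shows "(EXP_UWT cl cr \<omega> a b \<longleftrightarrow> filterlim (\<lambda>j. ln (a j) / ln (real j)) at_top sequentially)
    \<and> (\<forall>s t. s > 0 \<longrightarrow> t > 1 \<longrightarrow> EXP_WT cl cr \<omega> a b s t)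
    \<and> (\<forall>s t. 0 < s \<longrightarrow> s < 1 \<longrightarrow> 0 < t \<longrightarrow> t \<le> 1 \<longrightarrow>
         (EXP_WT cl cr \<omega> a b s t \<longleftrightarrow>
            filterlim (\<lambda>j. a j / real j powr ((1 - s) / s)) at_top sequentially))
    \<and> (\<forall>t. 0 < t \<longrightarrow> t < 1 \<longrightarrow>
         (EXP_WT cl cr \<omega> a b 1 t \<longleftrightarrow> filterlim (\<lambda>j. a j / ln (real j)) at_top sequentially))
    \<and> (\<forall>s t. s > 1 \<longrightarrow> 0 < t \<longrightarrow> t < 1 \<longrightarrow>
         (EXP_WT cl cr \<omega> a b s t \<longleftrightarrow>
            (\<lambda>j. real j powr (1 - t) * a j * \<omega> powr (a j)) \<longlonglongrightarrow> 0))"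
proof -
  obtain \<beta> where \<beta>: "0 < \<beta>" "\<And>i. 1 \<le> i \<Longrightarrow> \<beta> \<le> b i" using assms(5) by blast
  interpret korobov \<omega> a b \<beta> by unfold_locales (use assms \<beta> in auto)
  have "EXP_WT cl cr \<omega> a b s t \<longleftrightarrow> filterlim (\<lambda>j. a j / real j powr ((1 - s) / s)) at_top sequentially"
    if "0 < s" "s < 1" "0 < t" "t \<le> 1" for s t
    using EXP_WT_less_1_sufficient EXP_WT_less_1_necessary that by blast
  moreover have "EXP_WT cl cr \<omega> a b 1 t \<longleftrightarrow> filterlim (\<lambda>j. a j / ln (real j)) at_top sequentially"
    if "0 < t" "t < 1" for t
    using EXP_WT_1_sufficient EXP_WT_1_necessary that by blast
  moreover have "EXP_WT cl cr \<omega> a b s t \<longleftrightarrow> (\<lambda>j. real j powr (1 - t) * a j * \<omega> powr (a j)) \<longlonglongrightarrow> 0"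
    if "1 < s" "0 < t" "t < 1" for s t
    using EXP_WT_greater_1_sufficient EXP_WT_greater_1_necessary[of cl cr s t] that by fastforce
  ultimately show ?thesis using EXP_UWT_iff EXP_WT_gt_1 by blast
qed

end
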